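(* Let $n\ge1$, $\beta>0$ and $\gamma>0$. Let $\Omega\subset\mathbf{R}^n$ be a non-empty star-shaped bounded open set with $C^2$ boundary, and let $\Gamma\colon\mathbf{R}^n\setminus\Omega\to\mathbf{R}$ be a continuous function such that (i) $\Gamma$ is harmonic and positive on $\mathbf{R}^n\setminus\overline{\Omega}$; (ii) $\Gamma=0$ on $\partial\Omega$; (iii) $\nabla\Gamma(x)\ne0$ for all $x\in\mathbf{R}^n\setminus\overline{\Omega}$; (iv) $\Gamma$ has a $C^1$ extension up to the boundary and for all $x\in\partial\Omega$ there exists $t>0$ such that $\nabla\Gamma(x)=t\,\nu_\Omega(x)$, where $\nu_\Omega(x)$ is the outward unit normal vector of $\Omega$ at $x$. Define for $x\in\mathbf{R}^n\setminus\overline{\Omega}$ $$\nu(x)=\frac{\nabla\Gamma(x)}{|\nabla\Gamma(x)|}\qquad\text{and}\qquad\delta(x)=\frac{1}{1+\beta\,|\nabla\Gamma(x)|^{-1}\,\Gamma(x)},$$ and assume that $\mathrm{div}(\nu)$ is bounded on $\mathbf{R}^n\setminus\overline{\Omega}$. If for all $x\in\mathbf{R}^n\setminus\overline{\Omega}$ $$\left(\beta^2-\beta\,\mathrm{div}(\nu)(x)\right)\delta(x)^2\le\gamma^2,$$ then the indicator function $\mathbf{1}_\Omega$ has a calibration.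
   Context: Fix parameters $\beta,\gamma>0$. The problem under consideration is the minimization of $E(u)=\int|\nabla u|^2\,\mathrm{d}x+\beta\int_{J_u}\big((u^+)^2+(u^-)^2\big)\,\mathrm{d}\mathcal{H}^{n-1}+\gamma^2\mathcal{L}^n(\{u>0\})$ among $u\in SBV(\mathbf{R}^n)$ with $u=1$ on $\Omega$ and $0\le u\le1$. Jump set: for $u\in SBV(\mathbf{R}^n)$, $J_u$ is the set of jump points of $u$, i.e. points $x$ for which there are real numbers $u^-(x)<u^+(x)$ and a unit vector $\nu_u(x)$ such that $u$ has approximate limit (in the $L^1$-average sense on half-balls centred at $x$, as the radius tends to $0$) $u^+(x)$ on the side $\{(y-x)\cdot\nu_u(x)>0\}$ and $u^-(x)$ on the side $\{(y-x)\cdot\nu_u(x)<0\}$; thus $\nu_u$ points toward the higher trace. Approximately regular: for $D\subset\mathbf{R}^n\times\mathbf{R}$, a bounded Borel vector field $\phi\colon D\to\mathbf{R}^n\times\mathbf{R}$ is approximately regular on $D$ if for every Lipschitz hypersurface $S\subset\mathbf{R}^n\times\mathbf{R}$ with unit normal $\nu_S$, for $\mathcal{H}^n$-a.e. $z_0\in S\cap D$, the function $z\mapsto\phi(z)\cdot\nu_S(z_0)$, $z\in D$, has approximate limit $\phi(z_0)\cdot\nu_S(z_0)$ at $z_0$ (i.e. for every $\varepsilon>0$ the set $\{z\in D:|(\phi(z)-\phi(z_0))\cdot\nu_S(z_0)|>\varepsilon\}$ has Lebesgue density $0$ at $z_0$). Calibration: let $\Omega$ be a bounded open set of $\mathbf{R}^n$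 with Lipschitz boundary and let $u\in SBV(\mathbf{R}^n)$ have compact support, with $u=1$ on $\Omega$ and $0\le u\le1$ in $\mathbf{R}^n$. A calibration for $u$ is a Borel map $\phi=(\phi^x,\phi^t)\colon(\mathbf{R}^n\setminus\Omega)\times[0,1]\to\mathbf{R}^n\times\mathbf{R}$ which is bounded and approximately regular on $(\mathbf{R}^n\setminus\Omega)\times[0,1]$, divergence-free on $(\mathbf{R}^n\setminus\overline{\Omega})\times\,]0,1[$ in the sense of distributions, and such that (a) $\phi^t(x,t)\ge\frac14|\phi^x(x,t)|^2-\gamma^2\mathbf{1}_{\{t>0\}}(t)$ for $\mathcal{L}^n$-a.e. $x\in\mathbf{R}^n\setminus\overline{\Omega}$ and every $t\in[0,1]$; (b) $\left|\int_r^s\phi^x(x,t)\,\mathrm{d}t\right|\le\beta(r^2+s^2)$ for $\mathcal{H}^{n-1}$-a.e. $x\in\mathbf{R}^n\setminus\Omega$ and every $r,s\in[0,1]$; (a') $\phi^x(x,u(x))=2\nabla u(x)$ and $\phi^t(x,u(x))=|\nabla u(x)|^2-\gamma^2\mathbf{1}_{\{t>0\}}(u(x))$ for $\mathcal{L}^n$-a.e. $x\in\mathbf{R}^n\setminus\overline{\Omega}$; (b') $\int_{u^-}^{u^+}\phi^x(x,t)\,\mathrm{d}t=\beta\left[(u^-)^2+(u^+)^2\right]\nu_u$ for $\mathcal{H}^{n-1}$-a.e. $x\in J_u$. Star-shaped means star-shaped with respect to some point of $\Omega$. *)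

theory Defs
  imports "HOL-Analysis.Analysis"
begin

section \<open>Differential operators and smoothness classes\<close>

definition gradient :: "('a::euclidean_space \<Rightarrow> real) \<Rightarrow> 'a \<Rightarrow> 'a" where
  "gradient f x = (THE D. GDERIV f x :> D)"

definition divergence :: "('a::euclidean_space \<Rightarrow> 'a) \<Rightarrow> 'a \<Rightarrow> real" where
  "divergence F x = (\<Sum>b\<in>Basis. frechet_derivative F (at x) b \<bullet> b)"

text \<open>\<open>C\<^sup>k\<close> through iterated partial derivatives; only meant for open \<open>S\<close>.\<close>

primrec Ck_on :: "nat \<Rightarrow> 'a::euclidean_space set \<Rightarrow> ('a \<Rightarrow> real) \<Rightarrow> bool" where
  "Ck_on 0 S f \<longleftrightarrow> continuous_on S f"
| "Ck_on (Suc k) S f \<longleftrightarrow>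
     (\<forall>x\<in>S. f differentiable (at x)) \<and>
     (\<forall>b\<in>Basis. Ck_on k S (\<lambda>x. frechet_derivative f (at x) b))"

definition harmonic_on :: "'a::euclidean_space set \<Rightarrow> ('a \<Rightarrow> real) \<Rightarrow> bool" where
  "harmonic_on S f \<longleftrightarrow> Ck_on 2 S f \<and> (\<forall>x\<in>S. divergence (gradient f) x = 0)"

definition test_function_on :: "'a::euclidean_space set \<Rightarrow> ('a \<Rightarrow> real) \<Rightarrow> bool" where
  "test_function_on W \<psi> \<longleftrightarrow>
     (\<forall>k. Ck_on k UNIV \<psi>) \<and>
     compact (closure {x. \<psi> x \<noteq> 0}) \<and> closure {x. \<psi> x \<noteq> 0} \<subseteq> W"

text \<open>Meant for Borel \<open>F\<close> that is locally integrable on \<open>W\<close>; the values of \<open>F\<close> off \<open>W\<close> are irrelevant.\<close>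

definition distr_divergence_free_on :: "'a::euclidean_space set \<Rightarrow> ('a \<Rightarrow> 'a) \<Rightarrow> bool" where
  "distr_divergence_free_on W F \<longleftrightarrow>
     (\<forall>\<psi>. test_function_on W \<psi> \<longrightarrow> (LINT z|lborel. F z \<bullet> gradient \<psi> z) = 0)"


section \<open>Hausdorff measure\<close>

text \<open>The empty set must be given weight \<open>0\<close> separately because \<open>0 ^ 0 = 1\<close>; with this
  convention the zero-dimensional measure is counting measure. Boundedness is required because
  \<^const>\<open>diameter\<close> is meaningless on unbounded sets.\<close>

definition hausdorff_weight :: "nat \<Rightarrow> 'a::metric_space set \<Rightarrow> ennreal" where
  "hausdorff_weight s A =
     (if A = {} then 0 else ennreal (unit_ball_vol (real s) * (diameter A / 2) ^ s))"

definition hausdorff_premeasure :: "nat \<Rightarrow> real \<Rightarrow> 'a::metric_space set \<Rightarrow> ennreal" where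
  "hausdorff_premeasure s d E =
     (INF A \<in> {A :: nat \<Rightarrow> 'a set. E \<subseteq> (\<Union>i. A i) \<and> (\<forall>i. bounded (A i) \<and> diameter (A i) \<le> d)}.
        \<Sum>i. hausdorff_weight s (A i))"

definition hausdorff_outer :: "nat \<Rightarrow> 'a::metric_space set \<Rightarrow> ennreal" where
  "hausdorff_outer s E = (SUP d\<in>{0<..}. hausdorff_premeasure s d E)"

definition hausdorff_ae :: "nat \<Rightarrow> 'a::metric_space set \<Rightarrow> ('a \<Rightarrow> bool) \<Rightarrow> bool" where
  "hausdorff_ae s A P \<longleftrightarrow> hausdorff_outer s {x\<in>A. \<not> P x} = 0"


section \<open>Lipschitz and \<open>C\<^sup>2\<close> boundaries, hypersurfaces and normals\<close>

text \<open>For a unit vector \<open>e\<close>, \<open>perp_part e\<close> is the orthogonal projection onto the hyperplane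
  \<open>e\<^sup>\<bottom>\<close>, over which graphs in the direction \<open>e\<close> are taken.\<close>

definition perp_part :: "'a::real_inner \<Rightarrow> 'a \<Rightarrow> 'a" where
  "perp_part e y = y - (y \<bullet> e) *\<^sub>R e"

definition lipschitz_boundary :: "'a::euclidean_space set \<Rightarrow> bool" where
  "lipschitz_boundary \<Omega> \<longleftrightarrow>
     (\<forall>x\<in>frontier \<Omega>. \<exists>U e f L. open U \<and> x \<in> U \<and> norm e = 1 \<and>
        L-lipschitz_on {y. y \<bullet> e = 0} (f :: 'a \<Rightarrow> real) \<and>
        \<Omega> \<inter> U = {y\<in>U. y \<bullet> e < f (perp_part e y)})"

text \<open>Asking for \<open>f\<close> to be \<open>C\<^sup>2\<close> on the whole space rather than on \<open>e\<^sup>\<bottom>\<close> is no restriction: compose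
  with \<open>perp_part e\<close>.\<close>

definition C2_boundary :: "'a::euclidean_space set \<Rightarrow> bool" where
  "C2_boundary \<Omega> \<longleftrightarrow>
     (\<forall>x\<in>frontier \<Omega>. \<exists>U e f. open U \<and> x \<in> U \<and> norm e = 1 \<and>
        Ck_on 2 UNIV (f :: 'a \<Rightarrow> real) \<and>
        \<Omega> \<inter> U = {y\<in>U. y \<bullet> e < f (perp_part e y)})"

definition lipschitz_hypersurface :: "'a::euclidean_space set \<Rightarrow> bool" where
  "lipschitz_hypersurface S \<longleftrightarrow>
     (\<forall>x\<in>S. \<exists>U e f L. open U \<and> x \<in> U \<and> norm e = 1 \<and>
        L-lipschitz_on {y. y \<bullet> e = 0} (f :: 'a \<Rightarrow> real) \<and>
        S \<inter> U = {y\<in>U. y \<bullet> e = f (perp_part e y)})"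

text \<open>\<open>v\<close> is a unit vector orthogonal to the tangent hyperplane of \<open>S\<close> at \<open>x\<close>. On a Lipschitz graph
  such a \<open>v\<close> exists exactly at the points above which the graph function is differentiable,
  hence almost everywhere by Rademacher's theorem, and it is then unique up to sign.\<close>

definition unit_normal :: "'a::euclidean_space set \<Rightarrow> 'a \<Rightarrow> 'a \<Rightarrow> bool" where
  "unit_normal S x v \<longleftrightarrow> norm v = 1 \<and>
     ((\<lambda>y. ((y - x) \<bullet> v) / norm (y - x)) \<longlongrightarrow> 0) (at x within S)"

definition outward_unit_normal :: "'a::euclidean_space set \<Rightarrow> 'a \<Rightarrow> 'a \<Rightarrow> bool" where
  "outward_unit_normal \<Omega> x v \<longleftrightarrow> unit_normal (frontier \<Omega>) x v \<and>
     (\<forall>\<^sub>F t in at_right (0::real). x - t *\<^sub>R v \<in> \<Omega> \<and> x + t *\<^sub>R v \<notin> closure \<Omega>)"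


section \<open>Approximately regular vector fields\<close>

text \<open>Meant for Lebesgue measurable \<open>A\<close>.\<close>

definition density_zero_at :: "'a::euclidean_space set \<Rightarrow> 'a \<Rightarrow> bool" where
  "density_zero_at A z \<longleftrightarrow>
     ((\<lambda>r. measure lebesgue (A \<inter> ball z r) / measure lebesgue (ball z r)) \<longlongrightarrow> 0) (at_right 0)"

definition approx_regular_on :: "'a::euclidean_space set \<Rightarrow> ('a \<Rightarrow> 'a) \<Rightarrow> bool" where
  "approx_regular_on D \<phi> \<longleftrightarrow>
     (\<forall>S. lipschitz_hypersurface S \<longrightarrow>
        hausdorff_ae (DIM('a) - 1) (S \<inter> D)
          (\<lambda>z\<^sub>0. \<forall>v. unit_normal S z\<^sub>0 v \<longrightarrow>
             (\<forall>\<epsilon>>0. density_zero_at {z\<in>D. \<bar>(\<phi> z - \<phi> z\<^sub>0) \<bullet> v\<bar> > \<epsilon>} z\<^sub>0)))"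


section \<open>Jump points and special functions of bounded variation\<close>

definition half_ball :: "'a::euclidean_space \<Rightarrow> real \<Rightarrow> 'a \<Rightarrow> 'a set" where
  "half_ball x r v = {y\<in>ball x r. (y - x) \<bullet> v > 0}"

text \<open>\<open>c\<close> is the \<open>L\<^sup>1\<close> trace at \<open>x\<close> on the side to which \<open>v\<close> points (for locally integrable \<open>u\<close>).\<close>

definition one_sided_limit :: "('a::euclidean_space \<Rightarrow> real) \<Rightarrow> 'a \<Rightarrow> 'a \<Rightarrow> real \<Rightarrow> bool" where
  "one_sided_limit u x v c \<longleftrightarrow>
     ((\<lambda>r. (LINT y:half_ball x r v|lebesgue. \<bar>u y - c\<bar>) / measure lebesgue (half_ball x r v))
        \<longlongrightarrow> 0) (at_right 0)"

text \<open>\<open>jump_triple u x a b v\<close> says \<open>u\<^sup>-(x) = a\<close>, \<open>u\<^sup>+(x) = b\<close>, \<open>\<nu>\<^sub>u(x) = v\<close>; these are determined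
  by \<open>u\<close> and \<open>x\<close>.\<close>

definition jump_triple :: "('a::euclidean_space \<Rightarrow> real) \<Rightarrow> 'a \<Rightarrow> real \<Rightarrow> real \<Rightarrow> 'a \<Rightarrow> bool" where
  "jump_triple u x a b v \<longleftrightarrow> a < b \<and> norm v = 1 \<and>
     one_sided_limit u x v b \<and> one_sided_limit u x (- v) a"

definition jump_set :: "('a::euclidean_space \<Rightarrow> real) \<Rightarrow> 'a set" where
  "jump_set u = {x. \<exists>a b v. jump_triple u x a b v}"

text \<open>\<open>sbv_gradient u g\<close> says that \<open>u \<in> SBV\<close> and that \<open>g\<close> represents \<open>\<nabla>u\<close>, the density of the absolutely
  continuous part of the distributional derivative: \<open>Du\<close> is the finite vector measure
  \<open>g \<cdot> lborel + \<sigma> \<cdot> \<mu>\<close>, where the second term (in polar form, \<open>|\<sigma>| = 1\<close>) is concentrated on the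
  Lebesgue null set \<^term>\<open>jump_set u\<close>. So \<open>\<sigma> \<cdot> \<mu>\<close> is the singular part of \<open>Du\<close> and there is no Cantor part.\<close>

definition sbv_gradient :: "('a::euclidean_space \<Rightarrow> real) \<Rightarrow> ('a \<Rightarrow> 'a) \<Rightarrow> bool" where
  "sbv_gradient u g \<longleftrightarrow>
     integrable lebesgue u \<and> integrable lborel g \<and>
     (\<exists>(\<mu> :: 'a measure) \<sigma> :: 'a \<Rightarrow> 'a.
        sets \<mu> = sets borel \<and> finite_measure \<mu> \<and>
        \<sigma> \<in> borel_measurable borel \<and> (\<forall>x. norm (\<sigma> x) = 1) \<and>
        (AE x in \<mu>. x \<in> jump_set u) \<and>
        (\<forall>\<psi>. test_function_on UNIV \<psi> \<longrightarrow>
           (LINT x|lebesgue. u x *\<^sub>R gradient \<psi> x) =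
             - ((LINT x|lborel. \<psi> x *\<^sub>R g x) + (LINT x|\<mu>. \<psi> x *\<^sub>R \<sigma> x))))"

definition SBV :: "('a::euclidean_space \<Rightarrow> real) set" where
  "SBV = {u. \<exists>g. sbv_gradient u g}"


section \<open>Calibrations\<close>

text \<open>The standing assumptions on \<open>\<Omega>\<close> and \<open>u\<close> under which calibrations are considered.\<close>

definition admissible :: "'a::euclidean_space set \<Rightarrow> ('a \<Rightarrow> real) \<Rightarrow> bool" where
  "admissible \<Omega> u \<longleftrightarrow>
     bounded \<Omega> \<and> open \<Omega> \<and> lipschitz_boundary \<Omega> \<and>
     u \<in> SBV \<and> compact (closure {x. u x \<noteq> 0}) \<and>
     (\<forall>x\<in>\<Omega>. u x = 1) \<and> (\<forall>x. 0 \<le> u x \<and> u x \<le> 1)"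

text \<open>The map \<open>\<phi>\<close> is a total function, but only its values on \<open>(- \<Omega>) \<times> {0..1}\<close> matter. The gradient
  \<open>g\<close> of \<open>u\<close> is unique up to Lebesgue null sets, so the quantifier over it is immaterial.\<close>

definition calibration ::
  "real \<Rightarrow> real \<Rightarrow> 'a::euclidean_space set \<Rightarrow> ('a \<Rightarrow> real) \<Rightarrow> ('a \<times> real \<Rightarrow> 'a \<times> real) \<Rightarrow> bool" where
  "calibration \<beta> \<gamma> \<Omega> u \<phi> \<longleftrightarrow>
     admissible \<Omega> u \<and>
     \<phi> \<in> borel_measurable (restrict_space borel ((- \<Omega>) \<times> {0..1})) \<and>
     bounded (\<phi> ` ((- \<Omega>) \<times> {0..1})) \<and>
     approx_regular_on ((- \<Omega>) \<times> {0..1}) \<phi> \<and>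
     distr_divergence_free_on ((- closure \<Omega>) \<times> {0<..<1}) \<phi> \<and>
     (AE x in lborel. x \<notin> closure \<Omega> \<longrightarrow>
        (\<forall>t\<in>{0..1}. snd (\<phi> (x, t)) \<ge>
           1 / 4 * (norm (fst (\<phi> (x, t))))\<^sup>2 - \<gamma>\<^sup>2 * indicator {0<..} t)) \<and>
     hausdorff_ae (DIM('a) - 1) (- \<Omega>)
       (\<lambda>x. \<forall>r\<in>{0..1}. \<forall>s\<in>{0..1}.
          norm (LBINT t=ereal r..ereal s. fst (\<phi> (x, t))) \<le> \<beta> * (r\<^sup>2 + s\<^sup>2)) \<and>
     (\<exists>g. sbv_gradient u g \<and>
        (AE x in lborel. x \<notin> closure \<Omega> \<longrightarrow>
           fst (\<phi> (x, u x)) = 2 *\<^sub>R g x \<and>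
           snd (\<phi> (x, u x)) = (norm (g x))\<^sup>2 - \<gamma>\<^sup>2 * indicator {0<..} (u x))) \<and>
     hausdorff_ae (DIM('a) - 1) (jump_set u)
       (\<lambda>x. \<forall>a b v. jump_triple u x a b v \<longrightarrow>
          (LBINT t=ereal a..ereal b. fst (\<phi> (x, t))) = (\<beta> * (a\<^sup>2 + b\<^sup>2)) *\<^sub>R v)"

end

theory Submission
  imports Defs
begin

text \<open>Write \<open>\<nu> = \<nabla>\<Gamma> / |\<nabla>\<Gamma>|\<close> and \<open>a = |\<nabla>\<Gamma>| / \<Gamma>\<close>, so that \<open>\<delta> = a / (a + \<beta>)\<close>. The calibration is built from two
  explicit fields, glued along the graph \<open>t = \<delta>(x)\<close>. Below it, \<open>\<phi>\<^sup>x = - 2 \<beta> t \<nu>\<close>, which turns the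
  jump condition into an equality on the boundary; vanishing divergence then forces
  \<open>\<phi>\<^sup>t = \<beta> t\<^sup>2 div \<nu>\<close>. Above it, \<open>\<phi>\<^sup>x = - 2 (1 - t) a \<nu>\<close>, the field attached to the harmonic competitors
  \<open>1 - k \<Gamma>\<close>; here \<open>\<phi>\<^sup>t = (1 - t)\<^sup>2 a\<^sup>2 + c(x)\<close> with a free function \<open>c\<close> of \<open>x\<close> alone. The two horizontal parts
  agree exactly at \<open>t = \<delta>\<close>, and matching the vertical parts there gives \<open>c = (\<beta> div \<nu> - \<beta>\<^sup>2) \<delta>\<^sup>2\<close>, so the
  hypothesis on \<open>\<delta>\<close> says precisely that \<open>c \<ge> - \<gamma>\<^sup>2\<close>. With \<open>p = min (\<beta> t) (a (1 - t))\<close> and \<open>q = min t \<delta>\<close>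
  both halves read
    \<open>\<phi>\<^sup>x = - 2 p \<nu>\<close> and \<open>\<phi>\<^sup>t = \<beta> q\<^sup>2 div \<nu> + p\<^sup>2 - \<beta>\<^sup>2 q\<^sup>2\<close>,
  from which the pointwise conditions are immediate. On the boundary, where \<open>a = \<infinity>\<close> and \<open>\<delta> = 1\<close>, the field
  is \<open>(- 2 \<beta> t \<nu>, 0)\<close>.

  The remaining requirements are analytic.

  \<^item> The divergence: \<open>\<phi>\<close> has the \<open>C\<^sup>1\<close> potential \<open>\<Psi> = - h \<nu>\<close>, that is \<open>\<phi> = (\<partial>\<^sub>t \<Psi>, - div\<^sub>x \<Psi>)\<close>,
    with \<open>h = \<beta> t\<^sup>2 - (max 0 (\<beta> t - a (1 - t)))\<^sup>2 / (a + \<beta>)\<close>; fields of this form are divergence free by two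
    integrations by parts and the symmetry of mixed derivatives (\<open>distr_divergence_free_potential\<close>,
    \<open>field_divergence_free\<close>).

  \<^item> Approximate regularity: off the boundary cylinder \<open>\<partial>\<Omega> \<times> [0, 1]\<close> the field is continuous, and on it, for
    \<open>t < 1\<close>, its horizontal part still is. So a point can be bad only if the test hypersurface has a
    normal with a vertical component there, or if \<open>t = 1\<close>. The bad set is therefore tangent, at each of its
    points, both to the vertical cylinder and to a hyperplane that is not vertical, and such a set is
    Hausdorff null (\<open>hausdorff_null_transversal\<close>) by a density argument in a graph chart.

  \<^item> The indicator of \<open>\<Omega>\<close> is in \<open>SBV\<close> with gradient \<open>0\<close> (\<open>sbv_gradient_indicator\<close>): this is the divergence
    theorem for a \<open>C\<^sup>2\<close> domain, proved in graph charts from the translation invariance of Lebesgue measure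
    and glued by a partition of unity.

  \<^item> The jump points of the indicator and their normals are found by comparing \<open>\<Omega>\<close> with its tangent
    half-space (\<open>jump_triple_indicator\<close>).\<close>

section \<open>Sets of Hausdorff measure zero\<close>

lemma hausdorff_outer_zeroI:
  fixes E :: "'a::metric_space set"
  assumes "\<And>d e. d > 0 \<Longrightarrow> e > 0 \<Longrightarrow> \<exists>A :: nat \<Rightarrow> 'a set. E \<subseteq> (\<Union>i. A i) \<and>
      (\<forall>i. bounded (A i) \<and> diameter (A i) \<le> d) \<and> (\<Sum>i. hausdorff_weight s (A i)) \<le> ennreal e"
  shows "hausdorff_outer s E = 0"
proof -
  have "hausdorff_premeasure s d E \<le> 0" if "d > 0" for d
  proof (rule ennreal_le_epsilon)
    fix e :: real assume "e > 0"
    from assms[OF that this] obtain A :: "nat \<Rightarrow> 'a set" where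
      "E \<subseteq> (\<Union>i. A i)" "\<forall>i. bounded (A i) \<and> diameter (A i) \<le> d"
      and le: "(\<Sum>i. hausdorff_weight s (A i)) \<le> ennreal e"
      by blast
    then have "hausdorff_premeasure s d E \<le> (\<Sum>i. hausdorff_weight s (A i))"
      unfolding hausdorff_premeasure_def by (intro INF_lower) auto
    with le show "hausdorff_premeasure s d E \<le> 0 + ennreal e" by simp
  qed
  then show ?thesis
    unfolding hausdorff_outer_def by (auto intro!: antisym SUP_least)
qed

lemma hausdorff_outer_zeroD:
  fixes E :: "'a::metric_space set"
  assumes "hausdorff_outer s E = 0" "d > 0" "e > 0"
  obtains A :: "nat \<Rightarrow> 'a set" where "E \<subseteq> (\<Union>i. A i)"
      "\<And>i. bounded (A i) \<and> diameter (A i) \<le> d" "(\<Sum>i. hausdorff_weight s (A i)) \<le> ennreal e"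
proof -
  have "hausdorff_premeasure s d E \<le> hausdorff_outer s E"
    unfolding hausdorff_outer_def using assms by (intro SUP_upper) auto
  then have "hausdorff_premeasure s d E < ennreal e" using assms by auto
  then show ?thesis
    unfolding hausdorff_premeasure_def INF_less_iff using that by (force intro: less_imp_le)
qed

lemma hausdorff_outer_zero_subset:
  assumes "hausdorff_outer s B = 0" "A \<subseteq> B"
  shows "hausdorff_outer s A = 0"
proof (rule hausdorff_outer_zeroI)
  fix d e :: real assume "d > 0" "e > 0"
  from hausdorff_outer_zeroD[OF assms(1) this] obtain C where "B \<subseteq> (\<Union>i. C i)"
      "\<And>i. bounded (C i) \<and> diameter (C i) \<le> d" "(\<Sum>i. hausdorff_weight s (C i)) \<le> ennreal e"
    by blast
  then show "\<exists>C. A \<subseteq> (\<Union>i. C i) \<and> (\<forall>i::nat. bounded (C i) \<and> diameter (C i) \<le> d) \<and>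
      (\<Sum>i. hausdorff_weight s (C i)) \<le> ennreal e"
    using assms(2) by (intro exI[of _ C]) auto
qed

lemma suminf_interleave_le:
  fixes f g :: "nat \<Rightarrow> ennreal"
  shows "(\<Sum>i. if even i then f (i div 2) else g (i div 2)) \<le> suminf f + suminf g"
proof -
  let ?h = "\<lambda>i. if even i then f (i div 2) else g (i div 2)"
  have eq: "sum ?h {..<2*n} = sum f {..<n} + sum g {..<n}" for n
    by (induction n) (auto simp: algebra_simps)
  have "sum ?h {..<n} \<le> suminf f + suminf g" for n
  proof -
    have "sum ?h {..<n} \<le> sum ?h {..<2*n}" by (rule sum_mono2) auto
    also have "\<dots> \<le> suminf f + suminf g"
      unfolding eq by (intro add_mono sum_le_suminf) auto
    finally show ?thesis .
  qed
  then show ?thesis by (simp add: suminf_eq_SUP SUP_least)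
qed

lemma hausdorff_outer_zero_Un:
  fixes A B :: "'a::metric_space set"
  assumes "hausdorff_outer s A = 0" "hausdorff_outer s B = 0"
  shows "hausdorff_outer s (A \<union> B) = 0"
proof (rule hausdorff_outer_zeroI)
  fix d e :: real assume "d > 0" "e > 0"
  then have e2: "e/2 > 0" by simp
  from hausdorff_outer_zeroD[OF assms(1) \<open>d > 0\<close> e2] obtain C where C: "A \<subseteq> (\<Union>i. C i)"
      "\<And>i. bounded (C i) \<and> diameter (C i) \<le> d" "(\<Sum>i. hausdorff_weight s (C i)) \<le> ennreal (e/2)"
    by blast
  from hausdorff_outer_zeroD[OF assms(2) \<open>d > 0\<close> e2] obtain D where D: "B \<subseteq> (\<Union>i. D i)"
      "\<And>i. bounded (D i) \<and> diameter (D i) \<le> d" "(\<Sum>i. hausdorff_weight s (D i)) \<le> ennreal (e/2)"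
    by blast
  let ?H = "\<lambda>i. if even i then C (i div 2) else D (i div 2)"
  have sub: "A \<union> B \<subseteq> (\<Union>j. ?H j)"
  proof
    fix x assume "x \<in> A \<union> B"
    then obtain i where "x \<in> C i \<or> x \<in> D i" using C(1) D(1) by blast
    then show "x \<in> (\<Union>j. ?H j)"
    proof
      assume "x \<in> C i"
      then show ?thesis by (intro UN_I[of "2*i"]) simp_all
    next
      assume "x \<in> D i"
      then show ?thesis by (intro UN_I[of "2*i+1"]) simp_all
    qed
  qed
  have "(\<Sum>i. hausdorff_weight s (?H i)) =
      (\<Sum>i. if even i then hausdorff_weight s (C (i div 2)) else hausdorff_weight s (D (i div 2)))"
    by (rule suminf_cong) auto
  also have "\<dots> \<le> (\<Sum>i. hausdorff_weight s (C i)) + (\<Sum>i. hausdorff_weight s (D i))"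
    by (rule suminf_interleave_le)
  also have "\<dots> \<le> ennreal (e/2) + ennreal (e/2)" by (intro add_mono C D)
  also have "\<dots> = ennreal e" using e2 by (subst ennreal_plus[symmetric]) auto
  finally show "\<exists>H. A \<union> B \<subseteq> (\<Union>i. H i) \<and> (\<forall>i::nat. bounded (H i) \<and> diameter (H i) \<le> d) \<and>
      (\<Sum>i. hausdorff_weight s (H i)) \<le> ennreal e"
    using sub C(2) D(2) by (intro exI[of _ ?H] conjI allI) simp_all
qed

lemma hausdorff_outer_empty: "hausdorff_outer s {} = 0"
  by (rule hausdorff_outer_zeroI, rule exI[of _ "\<lambda>_. {}"]) (auto simp: hausdorff_weight_def)

lemma hausdorff_outer_zero_UN:
  assumes "finite I" "\<And>i. i \<in> I \<Longrightarrow> hausdorff_outer s (A i) = 0"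
  shows "hausdorff_outer s (\<Union>i\<in>I. A i) = 0"
  using assms by (induction I) (auto simp: hausdorff_outer_empty intro: hausdorff_outer_zero_Un)

lemma hausdorff_aeI: "(\<And>x. x \<in> A \<Longrightarrow> P x) \<Longrightarrow> hausdorff_ae s A P"
proof -
  assume "\<And>x. x \<in> A \<Longrightarrow> P x"
  then have "{x\<in>A. \<not> P x} = {}" by blast
  then show ?thesis unfolding hausdorff_ae_def by (simp only: hausdorff_outer_empty)
qed

lemma diameter_image_cube_le:
  fixes g :: "'a::euclidean_space \<Rightarrow> 'b::metric_space"
  assumes lip: "L-lipschitz_on N g" and side: "\<And>i. i \<in> Basis \<Longrightarrow> v \<bullet> i - u \<bullet> i = h"
    and "h \<ge> 0"
  shows "bounded (g ` (N \<inter> cbox u v))" "diameter (g ` (N \<inter> cbox u v)) \<le> L * DIM('a) * h"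
proof -
  have L: "L \<ge> 0" using lip by (rule lipschitz_on_nonneg)
  have d: "dist (g x) (g y) \<le> L * DIM('a) * h" if "x \<in> N \<inter> cbox u v" "y \<in> N \<inter> cbox u v" for x y
  proof -
    have "dist x y \<le> (\<Sum>i\<in>Basis. \<bar>(x - y) \<bullet> i\<bar>)"
      unfolding dist_norm by (rule norm_le_l1)
    also have "\<dots> \<le> (\<Sum>i\<in>(Basis::'a set). h)"
    proof (rule sum_mono)
      fix i :: 'a assume i: "i \<in> Basis"
      with that have "u \<bullet> i \<le> x \<bullet> i \<and> x \<bullet> i \<le> v \<bullet> i" "u \<bullet> i \<le> y \<bullet> i \<and> y \<bullet> i \<le> v \<bullet> i"
        by (auto simp: mem_box)
      with side[OF i] show "\<bar>(x - y) \<bullet> i\<bar> \<le> h" unfolding inner_diff_left by linarith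
    qed
    finally have "dist x y \<le> DIM('a) * h" by simp
    moreover have "dist (g x) (g y) \<le> L * dist x y"
      using lip that by (intro lipschitz_onD) auto
    ultimately show ?thesis using mult_left_mono[OF _ L, of "dist x y" "DIM('a) * h"] by simp
  qed
  show "bounded (g ` (N \<inter> cbox u v))"
  proof (cases "N \<inter> cbox u v = {}")
    case False
    then obtain x where "x \<in> N \<inter> cbox u v" by blast
    with d show ?thesis unfolding bounded_def by (intro exI[of _ "g x"] exI[of _ "L * DIM('a) * h"]) auto
  qed auto
  show "diameter (g ` (N \<inter> cbox u v)) \<le> L * DIM('a) * h"
    using d L assms(3) unfolding diameter_def by (auto intro!: cSUP_least)
qed

text \<open>Cover \<open>N\<close> by dyadic cubes of small total volume. The image of the part of \<open>N\<close> in a cube of side \<open>h\<close>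
  has diameter at most a constant times \<open>h\<close>, so its Hausdorff weight is at most a constant times \<open>h ^ DIM('a)\<close>,
  the volume of the cube.\<close>

lemma hausdorff_outer_lipschitz_image_negligible:
  fixes g :: "'a::euclidean_space \<Rightarrow> 'b::metric_space"
  assumes neg: "negligible N" and bN: "bounded N" and lip: "L-lipschitz_on N g"
  shows "hausdorff_outer DIM('a) (g ` N) = 0"
proof (rule hausdorff_outer_zeroI)
  fix d e :: real assume d: "d > 0" and e: "e > 0"
  let ?n = "DIM('a)"
  have L: "L \<ge> 0" using lip by (rule lipschitz_on_nonneg)
  define K where "K = unit_ball_vol (real ?n) * (L * ?n / 2) ^ ?n"
  have K: "K \<ge> 0" unfolding K_def using L by auto
  have "e / (K + 1) > 0" using e K by simp
  moreover have "N \<in> sets lebesgue" using neg by (simp add: negligible_iff_null_sets null_setsD2)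
  ultimately obtain T where T: "open T" "N \<subseteq> T" "T - N \<in> lmeasurable"
      "emeasure lebesgue (T - N) < ennreal (e / (K + 1))"
    using sets_lebesgue_outer_open[of N "e / (K + 1)"] by blast
  have Tm: "T \<in> lmeasurable"
    using T neg by (meson fmeasurable_Diff_D negligible_imp_measurable)
  have "measure lebesgue T = measure lebesgue (T - N)"
    using neg Tm by (simp add: measure_Diff_null_set negligible_iff_null_sets fmeasurableD)
  also have "\<dots> \<le> e / (K + 1)"
    using T(3,4) e K by (simp add: emeasure_eq_measure2 ennreal_less_iff)
  finally have mT: "measure lebesgue T \<le> e / (K + 1)" .
  \<comment> \<open>Cubes inside a ball of radius \<open>\<rho>\<close> have images of diameter at most \<open>d\<close>.\<close>
  define \<rho> where "\<rho> = d / (2 * (L * ?n + 1))"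
  have den: "L * ?n + 1 > 0" using L by (simp add: add_nonneg_pos)
  have \<rho>: "\<rho> > 0" unfolding \<rho>_def using d den by (intro divide_pos_pos) auto
  have "\<exists>r>0. r \<le> \<rho> \<and> (x \<in> N \<longrightarrow> ball x r \<subseteq> T)" for x
  proof (cases "x \<in> N")
    case True
    then obtain r where "r > 0" "ball x r \<subseteq> T" using T openE by blast
    then show ?thesis using \<rho> by (intro exI[of _ "min r \<rho>"]) auto
  qed (use \<rho> in auto)
  then obtain R where R: "\<And>x. R x > 0" "\<And>x. R x \<le> \<rho>" "\<And>x. x \<in> N \<Longrightarrow> ball x (R x) \<subseteq> T"
    by metis
  have gaugeR: "gauge (\<lambda>x. ball x (R x))" using R by (auto simp: gauge_def)
  obtain c where c: "N \<subseteq> cbox (-c *\<^sub>R One) (c *\<^sub>R One)" "box (-c *\<^sub>R One:: 'a) (c *\<^sub>R One) \<noteq> {}"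
  proof -
    obtain B where B: "\<And>x. x \<in> N \<Longrightarrow> norm x \<le> B"
      using bN bounded_iff by blast
    show ?thesis
    proof (rule_tac c = "abs B + 1" in that)
      show "N \<subseteq> cbox (- (\<bar>B\<bar> + 1) *\<^sub>R One) ((\<bar>B\<bar> + 1) *\<^sub>R One)"
        using norm_bound_Basis_le Basis_le_norm
        by (fastforce simp: mem_box dest!: B intro: order_trans)
      show "box (- (\<bar>B\<bar> + 1) *\<^sub>R One) ((\<bar>B\<bar> + 1) *\<^sub>R One) \<noteq> {}"
        by (simp add: box_eq_empty(1))
    qed
  qed
  obtain \<D> where cD: "countable \<D>"
     and cb: "\<And>K. K \<in> \<D> \<Longrightarrow> interior K \<noteq> {} \<and> (\<exists>c d. K = cbox c d)"
     and pw: "pairwise (\<lambda>A B. interior A \<inter> interior B = {}) \<D>"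
     and Ksub: "\<And>K. K \<in> \<D> \<Longrightarrow> \<exists>x \<in> N \<inter> K. K \<subseteq> ball x (R x)"
     and exN: "\<And>u v. cbox u v \<in> \<D> \<Longrightarrow> \<exists>n. \<forall>i \<in> Basis. v \<bullet> i - u \<bullet> i = (2*c) / 2^n"
     and ND: "N \<subseteq> \<Union>\<D>"
    using covering_lemma[OF c gaugeR] by force
  have DT: "Q \<subseteq> T" if "Q \<in> \<D>" for Q using Ksub[OF that] R(3) by blast
  have cube: "bounded (g ` (N \<inter> Q)) \<and> diameter (g ` (N \<inter> Q)) \<le> d \<and>
      hausdorff_weight ?n (g ` (N \<inter> Q)) \<le> ennreal (K * measure lebesgue Q)" if QD: "Q \<in> \<D>" for Q
  proof -
    obtain u v where Q: "Q = cbox u v" "box u v \<noteq> {}"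
      using cb[OF QD] by (metis interior_cbox)
    then obtain m where m: "\<And>i. i \<in> Basis \<Longrightarrow> v \<bullet> i - u \<bullet> i = (2*c) / 2^m"
      using exN QD by blast
    define h where "h = (2*c) / 2^m"
    have pos: "u \<bullet> i < v \<bullet> i" if "i \<in> Basis" for i using Q(2) that by (auto simp: box_ne_empty)
    obtain i0 :: 'a where i0: "i0 \<in> Basis" using nonempty_Basis by blast
    have l0: "h > 0" using pos[OF i0] m[OF i0] by (simp add: h_def)
    have diam: "bounded (g ` (N \<inter> Q))" "diameter (g ` (N \<inter> Q)) \<le> L * ?n * h"
      using diameter_image_cube_le[OF lip, of v u h] m l0 by (auto simp: h_def Q)
    obtain x where x: "Q \<subseteq> ball x (R x)" using Ksub[OF \<open>Q \<in> \<D>\<close>] by blast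
    have "u \<in> Q" "v \<in> Q" using pos less_imp_le by (auto simp: Q mem_box)
    then have "dist u x < \<rho>" "dist v x < \<rho>" using x R(2)[of x] by (auto simp: dist_commute)
    then have "dist u v < 2 * \<rho>" by (smt (verit) dist_triangle2)
    moreover have "h \<le> norm (v - u)"
      using Basis_le_norm[OF i0, of "v - u"] m[OF i0] unfolding h_def inner_diff_left by linarith
    ultimately have "h \<le> 2 * \<rho>" by (simp add: dist_norm norm_minus_commute)
    then have "L * ?n * h \<le> L * ?n * (2 * \<rho>)" using L by (intro mult_left_mono) auto
    also have "\<dots> \<le> (L * ?n + 1) * (2 * \<rho>)" using \<rho> by (intro mult_right_mono) auto
    also have "\<dots> = d"
    proof -
      have "X * (2 * (d / (2 * X))) = d" if "X > 0" for X :: real using that by simp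
      then show ?thesis using den unfolding \<rho>_def .
    qed
    finally have dd: "diameter (g ` (N \<inter> Q)) \<le> d" using diam by linarith
    have vol: "measure lebesgue Q = h ^ ?n"
    proof -
      have "measure lborel (cbox u v) = (\<Prod>i\<in>Basis. v \<bullet> i - u \<bullet> i)"
        using pos by (intro content_cbox) (auto intro: less_imp_le)
      also have "\<dots> = (\<Prod>i\<in>(Basis::'a set). h)" by (rule prod.cong) (auto simp: m h_def)
      finally show ?thesis by (simp add: Q)
    qed
    have "hausdorff_weight ?n (g ` (N \<inter> Q)) \<le>
        ennreal (unit_ball_vol (real ?n) * (diameter (g ` (N \<inter> Q)) / 2) ^ ?n)"
      by (simp add: hausdorff_weight_def)
    also have "\<dots> \<le> ennreal (unit_ball_vol (real ?n) * (L * ?n * h / 2) ^ ?n)"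
      using diam diameter_ge_0[OF diam(1)]
      by (intro ennreal_leI mult_left_mono power_mono divide_right_mono) auto
    also have "(L * ?n * h / 2) ^ ?n = (L * ?n / 2) ^ ?n * h ^ ?n"
      by (simp add: power_mult_distrib[symmetric])
    finally have "hausdorff_weight ?n (g ` (N \<inter> Q)) \<le> ennreal (K * measure lebesgue Q)"
      by (simp add: K_def vol mult.assoc)
    with diam dd show ?thesis by blast
  qed
  have finsum: "(\<Sum>Q\<in>\<F>. K * measure lebesgue Q) \<le> e" if "finite \<F>" "\<F> \<subseteq> \<D>" for \<F>
  proof -
    have div: "\<F> division_of \<Union>\<F>"
    proof -
      have "{} \<notin> \<F>" using cb that interior_empty by blast
      moreover have "\<And>K. K \<in> \<F> \<Longrightarrow> \<exists>a b. K = cbox a b" using cb that by blast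
      ultimately show ?thesis
        using pairwise_subset[OF pw that(2)] that unfolding pairwise_def
        by (force simp: division_of_def)
    qed
    have "sum (measure lebesgue) \<F> = measure lebesgue (\<Union>\<F>)"
      using content_division[OF div] by auto
    also have "\<dots> \<le> measure lebesgue T"
    proof (rule measure_mono_fmeasurable[OF _ _ Tm])
      show "\<Union>\<F> \<subseteq> T" using DT that by blast
      show "\<Union>\<F> \<in> sets lebesgue" using div lmeasurable_division by auto
    qed
    finally have "sum (measure lebesgue) \<F> \<le> e / (K + 1)" using mT by linarith
    then have "K * sum (measure lebesgue) \<F> \<le> K * (e / (K + 1))" using K by (rule mult_left_mono)
    also have "\<dots> \<le> e" using K e by (simp add: field_simps)
    finally show ?thesis by (simp add: sum_distrib_left)
  qed
  \<comment> \<open>The countable family of cubes is turned into a sequence, padded with empty sets of weight \<open>0\<close>.\<close>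
  let ?f = "to_nat_on \<D>"
  have inj: "inj_on ?f \<D>" using cD by (rule inj_on_to_nat_on)
  define A where "A i = (if i \<in> ?f ` \<D> then g ` (N \<inter> from_nat_into \<D> i) else {})" for i
  have Af: "A (?f Q) = g ` (N \<inter> Q)" if "Q \<in> \<D>" for Q
    using that cD by (simp add: A_def)
  have "g ` N \<subseteq> (\<Union>i. A i)"
  proof clarify
    fix x assume "x \<in> N"
    then obtain Q where "Q \<in> \<D>" "x \<in> Q" using ND by blast
    then show "g x \<in> (\<Union>i. A i)" using Af[of Q] \<open>x \<in> N\<close> by blast
  qed
  moreover have "bounded (A i) \<and> diameter (A i) \<le> d" for i
  proof (cases "i \<in> ?f ` \<D>")
    case True then show ?thesis using cube Af by auto
  next
    case False then show ?thesis using d by (simp add: A_def)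
  qed
  moreover have "(\<Sum>i. hausdorff_weight ?n (A i)) \<le> ennreal e"
  proof -
    have "(\<Sum>i<k. hausdorff_weight ?n (A i)) \<le> ennreal e" for k
    proof -
      define \<F> where "\<F> = {Q\<in>\<D>. ?f Q < k}"
      have "finite (?f ` \<F>)" by (rule finite_subset[of _ "{..<k}"]) (auto simp: \<F>_def)
      then have fin: "finite \<F>" using inj by (metis (no_types, lifting) \<F>_def finite_imageD inj_on_subset mem_Collect_eq subsetI)
      have "(\<Sum>i<k. hausdorff_weight ?n (A i)) = (\<Sum>i\<in>?f ` \<F>. hausdorff_weight ?n (A i))"
        by (rule sum.mono_neutral_right) (auto simp: \<F>_def A_def hausdorff_weight_def)
      also have "\<dots> = (\<Sum>Q\<in>\<F>. hausdorff_weight ?n (A (?f Q)))"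
        by (rule sum.reindex_cong[OF _ refl]) (auto intro: inj_on_subset[OF inj] simp: \<F>_def)
      also have "\<dots> \<le> (\<Sum>Q\<in>\<F>. ennreal (K * measure lebesgue Q))"
        using cube Af by (intro sum_mono) (auto simp: \<F>_def)
      also have "\<dots> = ennreal (\<Sum>Q\<in>\<F>. K * measure lebesgue Q)"
        using K by (intro sum_ennreal) auto
      also have "\<dots> \<le> ennreal e" using finsum[OF fin] by (intro ennreal_leI) (auto simp: \<F>_def)
      finally show ?thesis .
    qed
    then show ?thesis by (simp add: suminf_eq_SUP SUP_least)
  qed
  ultimately show "\<exists>A. g ` N \<subseteq> (\<Union>i. A i) \<and> (\<forall>i::nat. bounded (A i) \<and> diameter (A i) \<le> d) \<and>
      (\<Sum>i. hausdorff_weight ?n (A i)) \<le> ennreal e"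
    by blast
qed

section \<open>Slabs\<close>

text \<open>All slabs of relative width \<open>\<epsilon>\<close> in balls are similar to one in the unit ball, and the latter shrink
  to the intersection with a hyperplane, which is a null set; hence \<open>\<epsilon>\<close> depends neither on \<open>x\<close> nor on \<open>r\<close>.\<close>

lemma slab_small_measure:
  fixes w :: "'a::euclidean_space"
  assumes w: "w \<noteq> 0" and e: "e > 0"
  shows "\<exists>\<epsilon>>0. \<forall>x r. r > 0 \<longrightarrow> {y\<in>ball x r. \<bar>(y - x) \<bullet> w\<bar> \<le> \<epsilon> * r} \<in> lmeasurable \<and>
     measure lebesgue {y\<in>ball x r. \<bar>(y - x) \<bullet> w\<bar> \<le> \<epsilon> * r} < e * measure lebesgue (ball x r)"
proof -
  define S where "S k = {y\<in>ball 0 1. \<bar>y \<bullet> w\<bar> \<le> 1 / real (Suc k)}" for k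
  have S: "S k \<in> lmeasurable" for k
  proof (rule fmeasurableI2[OF lmeasurable_ball[of 0 1]])
    have "S k = ball 0 1 \<inter> {y. \<bar>y \<bullet> w\<bar> \<le> 1 / real (Suc k)}" by (auto simp: S_def)
    also have "\<dots> \<in> sets borel"
      by (intro sets.Int borel_open[OF open_ball] borel_closed[OF closed_Collect_le] continuous_intros)
    finally show "S k \<in> sets lebesgue" by (simp add: sets_completionI_sets)
  qed (auto simp: S_def)
  have "(\<lambda>k. measure lebesgue (S k)) \<longlonglongrightarrow> measure lebesgue (\<Inter>k. S k)"
  proof (rule Lim_measure_decseq)
    show "range S \<subseteq> sets lebesgue" using S by auto
    show "emeasure lebesgue (S k) \<noteq> \<infinity>" for k using fmeasurableD2[OF S] by (metis infinity_ennreal_def)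
    show "decseq S" unfolding S_def decseq_def
      by (auto intro: order_trans[OF _ divide_left_mono])
  qed
  moreover have "negligible (\<Inter>k. S k)"
  proof (rule negligible_subset[OF negligible_hyperplane[of w 0]])
    show "(\<Inter>k. S k) \<subseteq> {x. w \<bullet> x = 0}"
    proof clarify
      fix y assume "y \<in> (\<Inter>k. S k)"
      then have "\<bar>y \<bullet> w\<bar> \<le> 1 / real (Suc k)" for k by (auto simp: S_def)
      then have "\<not> 0 < \<bar>y \<bullet> w\<bar>"
        by (metis inverse_eq_divide linorder_not_le reals_Archimedean)
      then show "w \<bullet> y = 0" by (simp add: inner_commute)
    qed
  qed (use w in auto)
  ultimately have lim: "(\<lambda>k. measure lebesgue (S k)) \<longlonglongrightarrow> 0"
    by (simp add: negligible_imp_measure0)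
  have b1: "measure lebesgue (ball (0::'a) 1) > 0" by (simp add: content_ball_pos)
  then have "e * measure lebesgue (ball (0::'a) 1) > 0" using e by simp
  then obtain k where k: "measure lebesgue (S k) < e * measure lebesgue (ball (0::'a) 1)"
    using order_tendstoD(2)[OF lim] eventually_happens by (metis sequentially_bot)
  show ?thesis
  proof (intro exI[of _ "1 / real (Suc k)"] conjI allI impI)
    fix x :: 'a and r :: real assume r: "r > 0"
    have slab: "{y\<in>ball x r. \<bar>(y - x) \<bullet> w\<bar> \<le> 1 / real (Suc k) * r} = (\<lambda>z. x + r *\<^sub>R z) ` S k" (is "?L = ?R")
    proof
      have eq: "x + r *\<^sub>R z \<in> ?L \<longleftrightarrow> z \<in> S k" for z
      proof -
        have "\<bar>r * (z \<bullet> w)\<bar> = r * \<bar>z \<bullet> w\<bar>" using r by (simp add: abs_mult)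
        moreover have "r * \<bar>z \<bullet> w\<bar> \<le> 1 / real (Suc k) * r \<longleftrightarrow> \<bar>z \<bullet> w\<bar> \<le> 1 / real (Suc k)"
          using r by (simp only: mult.commute[of r] mult_le_cancel_right_pos)
        moreover have "dist x (x + r *\<^sub>R z) < r \<longleftrightarrow> norm z < 1"
          using r by (simp add: dist_norm)
        ultimately show ?thesis by (simp only: S_def mem_Collect_eq mem_ball dist_0_norm inner_scaleR_left add_diff_cancel_left')
      qed
      show "?L \<subseteq> ?R"
      proof
        fix y assume y: "y \<in> ?L"
        have yz: "y = x + r *\<^sub>R ((y - x) /\<^sub>R r)" using r by simp
        then have "(y - x) /\<^sub>R r \<in> S k" using y eq by metis
        with yz show "y \<in> ?R" by (rule image_eqI)
      qed
      show "?R \<subseteq> ?L" using eq by blast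
    qed
    have m: "measure lebesgue ?R = r ^ DIM('a) * measure lebesgue (S k)"
      using measure_lebesgue_affine[of r x "S k"] r by (simp add: add.commute)
    have meas: "?R \<in> lmeasurable"
    proof -
      have "?L = ball x r \<inter> {y. \<bar>(y - x) \<bullet> w\<bar> \<le> 1 / real (Suc k) * r}" by blast
      also have "\<dots> \<in> sets borel"
        by (intro sets.Int borel_open[OF open_ball] borel_closed[OF closed_Collect_le] continuous_intros)
      finally have "?L \<in> sets lebesgue" by (simp add: sets_completionI_sets)
      then show ?thesis
        unfolding slab[symmetric] by (rule fmeasurableI2[OF lmeasurable_ball[of x r], rotated]) blast
    qed
    have "measure lebesgue (ball x r) = r ^ DIM('a) * measure lebesgue (ball (0::'a) 1)"
      using r by (simp add: content_ball)
    moreover have "r ^ DIM('a) * measure lebesgue (S k) <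
        r ^ DIM('a) * (e * measure lebesgue (ball (0::'a) 1))"
      using k r by (intro mult_strict_left_mono) auto
    ultimately have "measure lebesgue ?R < e * measure lebesgue (ball x r)"
      unfolding m by (simp only: mult.left_commute)
    with meas show "{y\<in>ball x r. \<bar>(y - x) \<bullet> w\<bar> \<le> 1 / real (Suc k) * r} \<in> lmeasurable"
     "measure lebesgue {y\<in>ball x r. \<bar>(y - x) \<bullet> w\<bar> \<le> 1 / real (Suc k) * r} < e * measure lebesgue (ball x r)"
      unfolding slab by auto
  qed auto
qed

section \<open>Gradients\<close>

lemma gradient_eqI: "GDERIV f x :> D \<Longrightarrow> gradient f x = D"
proof -
  assume D: "GDERIV f x :> D"
  have "D' = D" if "GDERIV f x :> D'" for D'
  proof -
    have "(\<lambda>h. h \<bullet> D') = (\<lambda>h. h \<bullet> D)"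
      using D that unfolding gderiv_def by (rule has_derivative_unique[rotated])
    then show ?thesis by (metis inner_commute vector_eq_ldot)
  qed
  with D show ?thesis unfolding gradient_def by blast
qed

lemma gradient_zero_open:
  assumes "open W" "z \<in> W" "\<And>y. y \<in> W \<Longrightarrow> f y = 0"
  shows "gradient f z = 0"
proof -
  have "((\<lambda>_. 0) has_derivative (\<lambda>h. h \<bullet> 0)) (at z)" by simp
  then have "(f has_derivative (\<lambda>h. h \<bullet> 0)) (at z)"
    by (rule has_derivative_transform_within_open[OF _ assms(1,2)]) (simp add: assms(3))
  then show ?thesis by (intro gradient_eqI) (simp add: gderiv_def)
qed

lemma differentiable_imp_GDERIV_gradient:
  fixes f :: "'a::euclidean_space \<Rightarrow> real"
  assumes "f differentiable (at x)"
  shows "GDERIV f x :> gradient f x" "gradient f x \<bullet> h = frechet_derivative f (at x) h"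
proof -
  let ?D = "\<Sum>b\<in>Basis. frechet_derivative f (at x) b *\<^sub>R b"
  have fd: "(f has_derivative frechet_derivative f (at x)) (at x)"
    using assms frechet_derivative_works by blast
  then have lin: "linear (frechet_derivative f (at x))" by (rule has_derivative_linear)
  have eq: "h \<bullet> ?D = frechet_derivative f (at x) h" for h
  proof -
    have "frechet_derivative f (at x) h = frechet_derivative f (at x) (\<Sum>b\<in>Basis. (h \<bullet> b) *\<^sub>R b)"
      by (simp add: euclidean_representation)
    also have "\<dots> = (\<Sum>b\<in>Basis. (h \<bullet> b) *\<^sub>R frechet_derivative f (at x) b)"
      by (simp add: linear_sum[OF lin] linear_cmul[OF lin])
    finally show ?thesis by (simp add: inner_sum_right mult.commute)
  qed
  then have "(\<lambda>h. h \<bullet> ?D) = frechet_derivative f (at x)" by blast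
  then have G: "GDERIV f x :> ?D" using fd by (simp add: gderiv_def)
  then show "GDERIV f x :> gradient f x" by (simp add: gradient_eqI)
  show "gradient f x \<bullet> h = frechet_derivative f (at x) h"
    using eq[of h] G by (simp add: gradient_eqI inner_commute)
qed

lemma Ck_on_2_GDERIV:
  assumes "Ck_on 2 S f" "x \<in> S" shows "GDERIV f x :> gradient f x"
  using assms by (intro differentiable_imp_GDERIV_gradient) (simp add: numeral_2_eq_2)

lemma gradient_expand:
  assumes "f differentiable (at x)"
  shows "gradient f x = (\<Sum>b\<in>Basis. frechet_derivative f (at x) b *\<^sub>R b)"
proof -
  have "gradient f x = (\<Sum>b\<in>Basis. (gradient f x \<bullet> b) *\<^sub>R b)"
    by (simp add: euclidean_representation)
  then show ?thesis using differentiable_imp_GDERIV_gradient[OF assms] by simp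
qed

lemma Ck_on_2_gradient_differentiable:
  assumes f: "Ck_on 2 S f" and S: "open S" and x: "x \<in> S"
  shows "(gradient f has_derivative
     (\<lambda>h. \<Sum>b\<in>Basis. frechet_derivative (\<lambda>x. frechet_derivative f (at x) b) (at x) h *\<^sub>R b)) (at x)"
proof (rule has_derivative_transform_within_open[OF _ S x])
  show "((\<lambda>x. \<Sum>b\<in>Basis. frechet_derivative f (at x) b *\<^sub>R b) has_derivative
     (\<lambda>h. \<Sum>b\<in>Basis. frechet_derivative (\<lambda>x. frechet_derivative f (at x) b) (at x) h *\<^sub>R b)) (at x)"
  proof (intro has_derivative_sum has_derivative_scaleR_left)
    fix b :: 'a assume "b \<in> Basis"
    then have "(\<lambda>x. frechet_derivative f (at x) b) differentiable (at x)"
      using f x by (simp add: numeral_2_eq_2)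
    then show "((\<lambda>x. frechet_derivative f (at x) b) has_derivative
       frechet_derivative (\<lambda>x. frechet_derivative f (at x) b) (at x)) (at x)"
      using frechet_derivative_works by blast
  qed
qed (use f in \<open>simp add: numeral_2_eq_2 gradient_expand\<close>)

lemma Ck_on_2_continuous_gradient:
  assumes "Ck_on 2 S f" and "open S" shows "continuous_on S (gradient f)"
  using Ck_on_2_gradient_differentiable[OF assms]
  by (meson continuous_at_imp_continuous_on has_derivative_continuous)

section \<open>Graphs of \<open>C\<^sup>1\<close> functions and \<open>C\<^sup>1\<close> charts of an open set\<close>

text \<open>A function on the hyperplane \<open>e\<^sup>\<bottom>\<close> is represented by its extension \<open>F\<close> that is constant in the
  direction \<open>e\<close>. In this way all integrals stay in the ambient space and no type for the hyperplane is
  needed.\<close>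

locale C1_graph =
  fixes e :: "'a::euclidean_space" and F :: "'a \<Rightarrow> real" and gF :: "'a \<Rightarrow> 'a"
  assumes norm_e: "norm e = 1"
    and F_shift: "F (y + s *\<^sub>R e) = F y"
    and F_gderiv: "GDERIV F y :> gF y"
    and gF_cont: "continuous_on UNIV gF"
begin

abbreviation prp :: "'a \<Rightarrow> 'a" where "prp \<equiv> perp_part e"

lemma e_e [simp]: "e \<bullet> e = 1" using norm_e by (simp add: norm_eq_1)

lemma prp_e [simp]: "prp y \<bullet> e = 0" by (simp add: perp_part_def inner_diff_left)

lemma prp_shift [simp]: "prp (y + s *\<^sub>R e) = prp y"
  by (simp add: perp_part_def inner_add_left algebra_simps)

lemma prp_prp [simp]: "prp (prp y) = prp y"
  by (simp add: perp_part_def inner_diff_left)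

lemma prp_add: "prp (y + z) = prp y + prp z"
  by (simp add: perp_part_def inner_add_left algebra_simps)

lemma prp_diff: "prp (y - z) = prp y - prp z"
  by (simp add: perp_part_def inner_diff_left algebra_simps)

lemma prp_split: "y = prp y + (y \<bullet> e) *\<^sub>R e"
  by (simp add: perp_part_def)

lemma prp_perp: "w \<bullet> e = 0 \<Longrightarrow> prp w = w"
  by (simp add: perp_part_def)

lemma norm_prp_le: "norm (prp y) \<le> norm y"
proof -
  have "(norm y)\<^sup>2 = (norm (prp y))\<^sup>2 + (y \<bullet> e)\<^sup>2"
    unfolding power2_norm_eq_inner
    by (simp add: perp_part_def inner_diff_left inner_diff_right power2_eq_square inner_commute)
  then have "(norm (prp y))\<^sup>2 \<le> (norm y)\<^sup>2" by simp
  then show ?thesis by (rule power2_le_imp_le) simp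
qed

lemma continuous_prp [continuous_intros]:
  "continuous_on A f \<Longrightarrow> continuous_on A (\<lambda>x. prp (f x))"
  unfolding perp_part_def by (intro continuous_intros)

lemma F_prp [simp]: "F (prp y) = F y"
  using F_shift[of "prp y" "y \<bullet> e"] prp_split[of y] by simp

lemma F_has_derivative: "(F has_derivative (\<lambda>h. h \<bullet> gF y)) (at y)"
  using F_gderiv[of y] by (simp add: gderiv_def)

lemma F_cont: "continuous_on A F"
  using F_has_derivative by (meson continuous_at_imp_continuous_on has_derivative_continuous)

lemma gF_e [simp]: "gF y \<bullet> e = 0"
proof -
  have "((\<lambda>s. F (y + s *\<^sub>R e)) has_derivative (\<lambda>s. (s *\<^sub>R e) \<bullet> gF y)) (at 0)"
  proof -
    have "((\<lambda>s. y + s *\<^sub>R e) has_derivative (\<lambda>s. s *\<^sub>R e)) (at 0)"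
      by (auto intro!: derivative_eq_intros)
    from diff_chain_at[OF this, of F "\<lambda>h. h \<bullet> gF y"] F_has_derivative[of y]
    show ?thesis by (simp add: o_def)
  qed
  moreover have "((\<lambda>s. F (y + s *\<^sub>R e)) has_derivative (\<lambda>s. 0)) (at 0)"
    by (simp add: F_shift)
  ultimately have "(\<lambda>s. (s *\<^sub>R e) \<bullet> gF y) = (\<lambda>s::real. 0)" by (rule has_derivative_unique)
  then have "(1 *\<^sub>R e) \<bullet> gF y = 0" by metis
  then show ?thesis by (simp add: inner_commute)
qed

lemma gF_shift: "gF (y + s *\<^sub>R e) = gF y"
proof -
  have "((\<lambda>z. F (z + s *\<^sub>R e)) has_derivative (\<lambda>h. h \<bullet> gF (y + s *\<^sub>R e))) (at y)"
  proof -
    have "((\<lambda>z. z + s *\<^sub>R e) has_derivative (\<lambda>h. h)) (at y)"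
      by (auto intro!: derivative_eq_intros)
    from diff_chain_at[OF this, of F "\<lambda>h. h \<bullet> gF (y + s *\<^sub>R e)"] F_has_derivative[of "y + s *\<^sub>R e"]
    show ?thesis by (simp add: o_def)
  qed
  then have "GDERIV F y :> gF (y + s *\<^sub>R e)" by (simp add: F_shift gderiv_def)
  with F_gderiv[of y] show ?thesis by (metis gradient_eqI)
qed

lemma gF_prp [simp]: "gF (prp y) = gF y"
  using gF_shift[of "prp y" "y \<bullet> e"] prp_split[of y] by simp

lemma F_lipschitz_cball: "\<exists>L\<ge>0. L-lipschitz_on (cball p R) F"
proof -
  have "compact (gF ` cball p R)"
    by (intro compact_continuous_image continuous_on_subset[OF gF_cont]) auto
  then obtain B where B: "B > 0" "\<And>y. y \<in> cball p R \<Longrightarrow> norm (gF y) \<le> B"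
    using compact_imp_bounded bounded_pos by (metis imageI)
  have "B-lipschitz_on (cball p R) F"
  proof (rule lipschitz_onI)
    fix y z assume yz: "y \<in> cball p R" "z \<in> cball p R"
    have "norm (F y - F z) \<le> B * norm (y - z)"
    proof (rule differentiable_bound[OF convex_cball _ _ yz])
      fix x assume x: "x \<in> cball p R"
      show "(F has_derivative (\<lambda>h. h \<bullet> gF x)) (at x within cball p R)"
        using F_has_derivative has_derivative_at_withinI by blast
      show "onorm (\<lambda>h. h \<bullet> gF x) \<le> B"
      proof (rule onorm_le)
        fix h show "norm (h \<bullet> gF x) \<le> B * norm h"
          using Cauchy_Schwarz_ineq2[of h "gF x"] mult_left_mono[OF B(2)[OF x], of "norm h"]
          by (simp add: mult.commute)
      qed
    qed
    then show "dist (F y) (F z) \<le> B * dist y z" by (simp add: dist_norm)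
  qed (use B in auto)
  with B show ?thesis by (intro exI[of _ B]) auto
qed

text \<open>\<open>height\<close> is a defining function of the domain below the graph, and \<open>nrm\<close>, its gradient, is an outward
  normal of that domain, normalised by \<open>nrm y \<bullet> e = 1\<close>.\<close>

definition height :: "'a \<Rightarrow> real" where "height y = y \<bullet> e - F y"

definition nrm :: "'a \<Rightarrow> 'a" where "nrm y = e - gF y"

lemma height_gderiv: "GDERIV height y :> nrm y"
  unfolding gderiv_def height_def nrm_def
  by (auto intro!: derivative_eq_intros F_has_derivative simp: inner_diff_right)

lemma nrm_e [simp]: "nrm y \<bullet> e = 1" by (simp add: nrm_def inner_diff_left)

lemma nrm_nonzero [simp]: "nrm y \<noteq> 0"
  using nrm_e[of y] by (metis inner_zero_left zero_neq_one)

lemma nrm_prp [simp]: "nrm (prp y) = nrm y" by (simp add: nrm_def)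

lemma nrm_cont: "continuous_on A nrm"
  unfolding nrm_def by (intro continuous_intros continuous_on_subset[OF gF_cont]) auto

lemma height_cont: "continuous_on A height"
  unfolding height_def by (intro continuous_intros F_cont)

end

locale C1_chart = C1_graph e F gF
  for e :: "'a::euclidean_space" and F gF +
  fixes \<Omega> U :: "'a set"
  assumes open_U: "open U" and \<Omega>_U: "\<Omega> \<inter> U = {y\<in>U. y \<bullet> e < F y}"
begin

lemma in_\<Omega>_iff: "y \<in> U \<Longrightarrow> y \<in> \<Omega> \<longleftrightarrow> height y < 0"
  using \<Omega>_U by (auto simp: height_def)

lemma in_closure_iff:
  assumes "y \<in> U" shows "y \<in> closure \<Omega> \<longleftrightarrow> height y \<le> 0"
proof
  assume y: "y \<in> closure \<Omega>"
  show "height y \<le> 0"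
  proof (rule ccontr)
    assume "\<not> height y \<le> 0"
    then have yo: "y \<in> U \<inter> height -` {0<..}" using assms by auto
    have "open (U \<inter> height -` {0<..})"
      using open_U height_cont by (intro continuous_open_preimage) auto
    then have "U \<inter> height -` {0<..} \<inter> \<Omega> \<noteq> {}"
      using y yo by (metis disjoint_iff open_Int_closure_eq_empty Int_commute)
    then show False using in_\<Omega>_iff by force
  qed
next
  assume h: "height y \<le> 0"
  \<comment> \<open>Approach \<open>y\<close> from below; the fallback point of \<open>\<Omega>\<close> is used only at the finitely many indices where \<open>y - e / (n + 1)\<close> has not yet entered the chart.\<close>
  show "y \<in> closure \<Omega>"
  proof (rule closure_sequential[THEN iffD2], intro exI[of _ "\<lambda>n. if y - (1 / real (Suc n)) *\<^sub>R e \<in> \<Omega> then y - (1 / real (Suc n)) *\<^sub>R e else (SOME z. z \<in> \<Omega>)"] conjI allI)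
    have lim: "(\<lambda>n. y - (1 / real (Suc n)) *\<^sub>R e) \<longlonglongrightarrow> y - 0 *\<^sub>R e"
      by (intro tendsto_intros LIMSEQ_Suc[OF lim_1_over_n])
    then have "\<forall>\<^sub>F n in sequentially. y - (1 / real (Suc n)) *\<^sub>R e \<in> U"
      using open_U assms by (intro topological_tendstoD) auto
    then have ev: "\<forall>\<^sub>F n in sequentially. y - (1 / real (Suc n)) *\<^sub>R e \<in> \<Omega>"
    proof eventually_elim
      case (elim n)
      have "height (y - (1 / real (Suc n)) *\<^sub>R e) = height y - 1 / real (Suc n)"
        using F_shift[of y "- (1 / real (Suc n))"] by (simp add: height_def inner_diff_left)
      moreover have "1 / real (Suc n) > 0" by simp
      ultimately have "height (y - (1 / real (Suc n)) *\<^sub>R e) < 0" using h by linarith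
      then show ?case using in_\<Omega>_iff[OF elim] by blast
    qed
    show "(\<lambda>n. if y - (1 / real (Suc n)) *\<^sub>R e \<in> \<Omega> then y - (1 / real (Suc n)) *\<^sub>R e else (SOME z. z \<in> \<Omega>)) \<longlonglongrightarrow> y"
      by (rule Lim_transform_eventually[OF lim[simplified scaleR_zero_left diff_zero]]) (use ev in eventually_elim, auto)
    fix n
    have "\<exists>z. z \<in> \<Omega>" using ev by (metis eventually_happens sequentially_bot)
    then show "(if y - (1 / real (Suc n)) *\<^sub>R e \<in> \<Omega> then y - (1 / real (Suc n)) *\<^sub>R e else (SOME z. z \<in> \<Omega>)) \<in> \<Omega>"
      by (auto intro: someI_ex)
  qed
qed

lemma in_frontier_iff:
  assumes "y \<in> U" "open \<Omega>" shows "y \<in> frontier \<Omega> \<longleftrightarrow> height y = 0"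
  using in_closure_iff[OF assms(1)] in_\<Omega>_iff[OF assms(1)] assms(2)
  by (auto simp: frontier_def interior_open)

end

lemma C2_boundary_chart:
  assumes "C2_boundary \<Omega>" "x \<in> frontier \<Omega>"
  shows "\<exists>e F gF U. C1_chart e F gF \<Omega> U \<and> x \<in> U"
proof -
  from assms obtain U e f where U: "open U" "x \<in> U" and e: "norm e = 1"
    and f: "Ck_on 2 UNIV (f :: 'a \<Rightarrow> real)"
    and eq: "\<Omega> \<inter> U = {y\<in>U. y \<bullet> e < f (perp_part e y)}"
    unfolding C2_boundary_def by blast
  have ee: "e \<bullet> e = 1" using e by (simp add: norm_eq_1)
  let ?g = "\<lambda>y. gradient f (perp_part e y)"
  have "C1_chart e (\<lambda>y. f (perp_part e y)) (\<lambda>y. ?g y - (?g y \<bullet> e) *\<^sub>R e) \<Omega> U"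
  proof
    show "f (perp_part e (y + s *\<^sub>R e)) = f (perp_part e y)" for y s
      by (simp add: perp_part_def inner_add_left ee algebra_simps)
    show "GDERIV (\<lambda>y. f (perp_part e y)) y :> ?g y - (?g y \<bullet> e) *\<^sub>R e" for y
    proof -
      have "(perp_part e has_derivative (\<lambda>h. h - (h \<bullet> e) *\<^sub>R e)) (at y)"
        unfolding perp_part_def by (auto intro!: derivative_eq_intros)
      moreover have "(f has_derivative (\<lambda>h. h \<bullet> ?g y)) (at (perp_part e y))"
        using Ck_on_2_GDERIV[OF f] by (simp add: gderiv_def)
      ultimately have "((\<lambda>y. f (perp_part e y)) has_derivative (\<lambda>h. (h - (h \<bullet> e) *\<^sub>R e) \<bullet> ?g y)) (at y)"
        using diff_chain_at by (fastforce simp: o_def)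
      then show ?thesis
        by (simp add: gderiv_def inner_diff_left inner_diff_right inner_commute mult.commute)
    qed
    show "continuous_on UNIV (\<lambda>y. ?g y - (?g y \<bullet> e) *\<^sub>R e)"
      unfolding perp_part_def
      by (intro continuous_intros continuous_on_compose2[OF Ck_on_2_continuous_gradient[OF f open_UNIV]]) auto
  qed (use e U eq in auto)
  with U show ?thesis by blast
qed

context C1_graph begin

text \<open>The velocity at \<open>s = 0\<close> of the curve above the segment from \<open>x\<close> in a direction \<open>w \<bottom> e\<close> that stays on the
  graph through \<open>x\<close>: these velocities span the tangent space.\<close>

lemma curve_derivative:
  fixes x w :: 'a
  shows "((\<lambda>s. x + s *\<^sub>R w + (F (x + s *\<^sub>R w) - F x) *\<^sub>R e) has_vector_derivative (w + (w \<bullet> gF x) *\<^sub>R e)) (at 0)"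
proof -
  have "((\<lambda>s. x + s *\<^sub>R w) has_derivative (\<lambda>s. s *\<^sub>R w)) (at 0)"
    by (auto intro!: derivative_eq_intros)
  from diff_chain_at[OF this, of F "\<lambda>h. h \<bullet> gF x"] F_has_derivative[of x]
  have "((\<lambda>s. F (x + s *\<^sub>R w)) has_derivative (\<lambda>s. (s *\<^sub>R w) \<bullet> gF x)) (at 0)" by (simp add: o_def)
  then have "((\<lambda>s. F (x + s *\<^sub>R w)) has_real_derivative (w \<bullet> gF x)) (at 0)"
    by (simp add: has_field_derivative_def mult_commute_abs)
  then show ?thesis
    by (auto intro!: derivative_eq_intros)
qed

end

context C1_chart begin

text \<open>A unit normal is orthogonal to the velocities of curves in the graph. Taking for \<open>w\<close> the horizontal
  defect between \<open>v\<close> and \<open>(v \<bullet> e) nrm x\<close> shows that this defect is orthogonal to itself.\<close>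

lemma unit_normal_frontier:
  assumes x: "x \<in> U" "x \<in> frontier \<Omega>" "open \<Omega>" and v: "unit_normal (frontier \<Omega>) x v"
  shows "v = (v \<bullet> e) *\<^sub>R nrm x"
proof -
  have hx: "x \<bullet> e = F x" using in_frontier_iff[OF x(1,3)] x(2) by (simp add: height_def)
  have orth: "(w + (w \<bullet> gF x) *\<^sub>R e) \<bullet> v = 0" if w: "w \<bullet> e = 0" "w \<noteq> 0" for w
  proof -
    define c where "c s = x + s *\<^sub>R w + (F (x + s *\<^sub>R w) - F x) *\<^sub>R e" for s
    define d where "d = w + (w \<bullet> gF x) *\<^sub>R e"
    have cd: "(c has_vector_derivative d) (at 0)" unfolding c_def d_def by (rule curve_derivative)
    have c0: "c 0 = x" by (simp add: c_def)
    have "((\<lambda>s. ((c s - c 0) - (s - 0) *\<^sub>R d) /\<^sub>R norm (s - 0)) \<longlongrightarrow> 0) (at 0)"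
      using cd by (simp add: has_vector_derivative_def has_derivative_def)
    then have "((\<lambda>s. ((c s - x) - s *\<^sub>R d) /\<^sub>R norm s) \<longlongrightarrow> 0) (at_right 0)"
      by (simp add: c0 filterlim_at_split)
    moreover have "\<forall>\<^sub>F s in at_right 0. ((c s - x) - s *\<^sub>R d) /\<^sub>R norm s = (c s - x) /\<^sub>R s - d"
      using eventually_at_right_less[of 0] by eventually_elim (simp add: scaleR_diff_right)
    ultimately have "((\<lambda>s. (c s - x) /\<^sub>R s - d) \<longlongrightarrow> 0) (at_right 0)" 
      by (simp add: tendsto_cong)
    then have q: "((\<lambda>s. (c s - x) /\<^sub>R s) \<longlongrightarrow> d) (at_right 0)"
      by (rule LIM_zero_cancel)
    have ne: "c s \<noteq> x" if "s > 0" for s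
    proof
      assume "c s = x"
      then have "prp (c s) = prp x" by simp
      then have "s *\<^sub>R w = 0"
        using w by (simp add: c_def prp_add prp_perp add.assoc[symmetric]) (simp add: perp_part_def)
      then show False using that w by simp
    qed
    have cc: "(c \<longlongrightarrow> x) (at_right 0)"
      using has_vector_derivative_continuous[OF cd] c0 by (simp add: continuous_at filterlim_at_split)
    have "\<forall>\<^sub>F s in at_right 0. c s \<in> frontier \<Omega>"
    proof -
      have "\<forall>\<^sub>F s in at_right 0. c s \<in> U" using cc open_U x(1) by (rule topological_tendstoD)
      then show ?thesis
      proof eventually_elim
        case (elim s)
        have "height (c s) = 0"
          using hx w by (simp add: height_def c_def F_shift inner_add_left)
        then show ?case using in_frontier_iff[OF elim x(3)] by simp
      qed
    qed
    then have ev: "\<forall>\<^sub>F s in at_right 0. c s \<in> frontier \<Omega> \<and> c s \<noteq> x"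
      using eventually_at_right_less[of 0] by eventually_elim (simp add: ne)
    then have "filterlim c (at x within frontier \<Omega>) (at_right 0)"
      unfolding filterlim_at using cc ev by blast
    then have "((\<lambda>s. ((c s - x) \<bullet> v) / norm (c s - x)) \<longlongrightarrow> 0) (at_right 0)"
      using v filterlim_compose unfolding unit_normal_def by blast
    moreover have "((\<lambda>s. norm ((c s - x) /\<^sub>R s)) \<longlongrightarrow> norm d) (at_right 0)"
      using q by (rule tendsto_norm)
    ultimately have "((\<lambda>s. ((c s - x) \<bullet> v) / norm (c s - x) * norm ((c s - x) /\<^sub>R s)) \<longlongrightarrow> 0 * norm d) (at_right 0)"
      by (rule tendsto_mult)
    moreover have "\<forall>\<^sub>F s in at_right 0. ((c s - x) \<bullet> v) / norm (c s - x) * norm ((c s - x) /\<^sub>R s) = ((c s - x) /\<^sub>R s) \<bullet> v"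
      using eventually_at_right_less[of 0]
    proof eventually_elim
      case (elim s)
      have "norm ((c s - x) /\<^sub>R s) = norm (c s - x) / s" using elim by (simp add: divide_inverse mult.commute)
      moreover have "((c s - x) /\<^sub>R s) \<bullet> v = ((c s - x) \<bullet> v) / s" by (simp add: divide_inverse mult.commute)
      ultimately show ?case using ne[OF elim] elim by simp
    qed
    ultimately have "((\<lambda>s. ((c s - x) /\<^sub>R s) \<bullet> v) \<longlongrightarrow> 0) (at_right 0)"
      by (simp add: tendsto_cong)
    moreover have "((\<lambda>s. ((c s - x) /\<^sub>R s) \<bullet> v) \<longlongrightarrow> d \<bullet> v) (at_right 0)"
      using q by (intro tendsto_intros)
    ultimately show ?thesis unfolding d_def[symmetric] using tendsto_unique trivial_limit_at_right_real by blast
  qed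
  define w where "w = prp v + (v \<bullet> e) *\<^sub>R gF x"
  have we: "w \<bullet> e = 0" by (simp add: w_def inner_add_left)
  have "w = 0"
  proof (rule ccontr)
    assume "w \<noteq> 0"
    with orth[OF we this] have "w \<bullet> v + (w \<bullet> gF x) * (v \<bullet> e) = 0"
      by (simp only: inner_add_left inner_scaleR_left inner_commute[of e v])
    moreover have "w \<bullet> v = w \<bullet> prp v" using we by (simp add: perp_part_def inner_diff_right)
    moreover have "w \<bullet> w = w \<bullet> prp v + (v \<bullet> e) * (w \<bullet> gF x)"
      by (subst (2) w_def) (simp add: inner_add_right)
    ultimately have "w \<bullet> w = 0" by (simp add: mult.commute)
    then show False using \<open>w \<noteq> 0\<close> by simp
  qed
  then have "prp v = - (v \<bullet> e) *\<^sub>R gF x" by (simp add: w_def eq_neg_iff_add_eq_0)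
  then show ?thesis using prp_split[of v] by (simp add: nrm_def algebra_simps)
qed

text \<open>By the previous lemma \<open>v\<close> is a multiple of \<open>nrm x\<close>. The factor is positive, because otherwise
  \<open>height\<close> would increase along \<open>x - t v\<close>, a path that has to enter \<open>\<Omega>\<close>.\<close>

lemma outward_unit_normal_eq:
  assumes x: "x \<in> U" "x \<in> frontier \<Omega>" "open \<Omega>" and v: "outward_unit_normal \<Omega> x v"
  shows "v = nrm x /\<^sub>R norm (nrm x)"
proof -
  have un: "unit_normal (frontier \<Omega>) x v" and out: "\<forall>\<^sub>F t in at_right (0::real). x - t *\<^sub>R v \<in> \<Omega>"
    using v unfolding outward_unit_normal_def by (auto elim: eventually_mono)
  have veq: "v = (v \<bullet> e) *\<^sub>R nrm x" using unit_normal_frontier[OF x un] .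
  have n1: "norm v = 1" using un by (simp add: unit_normal_def)
  have hx: "height x = 0" using in_frontier_iff[OF x(1,3)] x(2) by simp
  have "v \<bullet> e > 0"
  proof (rule ccontr)
    assume "\<not> v \<bullet> e > 0"
    moreover have "v \<bullet> e \<noteq> 0" using veq n1 by auto
    ultimately have neg: "v \<bullet> e < 0" by simp
    have "((\<lambda>t. x - t *\<^sub>R v) has_derivative (\<lambda>t. - t *\<^sub>R v)) (at 0)"
      by (auto intro!: derivative_eq_intros)
    from diff_chain_at[OF this, of height "\<lambda>h. h \<bullet> nrm x"] height_gderiv[of x]
    have "((\<lambda>t. height (x - t *\<^sub>R v)) has_derivative (\<lambda>t. (- t *\<^sub>R v) \<bullet> nrm x)) (at 0)"
      by (simp add: o_def gderiv_def)
    then have "((\<lambda>t. height (x - t *\<^sub>R v)) has_real_derivative - (v \<bullet> nrm x)) (at 0)"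
      unfolding has_field_derivative_def by (rule has_derivative_eq_rhs) (auto simp: fun_eq_iff)
    moreover have "v \<bullet> nrm x < 0"
    proof -
      have "v \<bullet> nrm x = (v \<bullet> e) * (nrm x \<bullet> nrm x)" by (subst veq) simp
      then show ?thesis using neg nrm_nonzero[of x] by (simp add: mult_neg_pos)
    qed
    ultimately obtain d where d: "d > 0" "\<And>t. 0 < t \<Longrightarrow> t < d \<Longrightarrow> height (x - 0 *\<^sub>R v) < height (x - (0 + t) *\<^sub>R v)"
      using DERIV_pos_inc_right[of "\<lambda>t. height (x - t *\<^sub>R v)" "- (v \<bullet> nrm x)" 0] by auto
    have "\<forall>\<^sub>F t in at_right (0::real). x - t *\<^sub>R v \<in> U"
    proof (rule topological_tendstoD[OF _ open_U x(1)])
      have "((\<lambda>t. x - t *\<^sub>R v) \<longlongrightarrow> x - 0 *\<^sub>R v) (at_right 0)" by (intro tendsto_intros)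
      then show "((\<lambda>t. x - t *\<^sub>R v) \<longlongrightarrow> x) (at_right 0)" by simp
    qed
    moreover have "\<forall>\<^sub>F t in at_right (0::real). t < d"
      using d(1) by (simp add: eventually_at_right_field) (metis dense)
    ultimately have "\<forall>\<^sub>F t in at_right (0::real). False"
      using out eventually_at_right_less[of 0]
    proof eventually_elim
      case (elim t)
      then show ?case using d(2)[of t] in_\<Omega>_iff[of "x - t *\<^sub>R v"] hx by simp
    qed
    then show False by simp
  qed
  moreover have "norm v = (v \<bullet> e) * norm (nrm x)" using calculation by (subst veq) simp
  ultimately have "v \<bullet> e = 1 / norm (nrm x)" using n1 by (simp add: field_simps)
  with veq show ?thesis by (simp add: inverse_eq_divide)
qed

end

section \<open>Jump points of an indicator function\<close>

text \<open>The first-order expansion of \<open>G\<close> at \<open>x\<close> decides its sign even uniformly on balls whose radius is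
  comparable with their distance from \<open>x\<close>.\<close>

lemma halfspace_ball_negative:
  fixes G :: "'a::euclidean_space \<Rightarrow> real"
  assumes G: "GDERIV G x :> N" "G x = 0" and w: "w \<bullet> N < 0"
  shows "\<exists>\<kappa>>0. \<exists>r0>0. \<forall>r. 0 < r \<and> r < r0 \<longrightarrow> (\<forall>y\<in>ball (x + r *\<^sub>R w) (\<kappa> * r). G y < 0)"
proof -
  define m where "m = - (w \<bullet> N)"
  have m: "m > 0" using w by (simp add: m_def)
  define \<kappa> where "\<kappa> = m / (2 * (norm N + 1))"
  have nn: "norm N + 1 > 0" using norm_ge_zero[of N] by linarith
  have \<kappa>: "\<kappa> > 0" using m nn by (simp add: \<kappa>_def)
  have \<kappa>N: "\<kappa> * norm N \<le> m / 2"
  proof -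
    have "\<kappa> * norm N \<le> \<kappa> * (norm N + 1)" using \<kappa> by (intro mult_left_mono) auto
    also have "\<dots> = m / 2" using nn by (simp add: \<kappa>_def field_simps)
    finally show ?thesis .
  qed
  define \<eta> where "\<eta> = m / (4 * (norm w + \<kappa>))"
  have wk: "norm w + \<kappa> > 0" using \<kappa> by (simp add: add_nonneg_pos)
  have \<eta>: "\<eta> > 0" using m wk by (simp add: \<eta>_def)
  have "(G has_derivative (\<lambda>h. h \<bullet> N)) (at x)" using G by (simp add: gderiv_def)
  then obtain d where d: "d > 0" "\<And>y. norm (y - x) < d \<Longrightarrow> norm (G y - G x - (y - x) \<bullet> N) \<le> \<eta> * norm (y - x)"
    unfolding has_derivative_at_alt using \<eta> by blast
  have "G y < 0" if r: "0 < r" "r < d / (norm w + \<kappa>)" and y: "y \<in> ball (x + r *\<^sub>R w) (\<kappa> * r)" for r y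
  proof -
    define z where "z = y - x - r *\<^sub>R w"
    have z: "norm z < \<kappa> * r" using y by (simp add: z_def dist_norm norm_minus_commute algebra_simps)
    have yx: "y - x = r *\<^sub>R w + z" by (simp add: z_def)
    have "norm (y - x) \<le> r * norm w + norm z" unfolding yx using r norm_triangle_ineq[of "r *\<^sub>R w" z] by simp
    then have n: "norm (y - x) \<le> r * (norm w + \<kappa>)" using z by (simp add: algebra_simps)
    also have "\<dots> < d" using r wk by (simp add: field_simps)
    finally have "norm (G y - G x - (y - x) \<bullet> N) \<le> \<eta> * norm (y - x)" by (rule d(2))
    also have "\<dots> \<le> \<eta> * (r * (norm w + \<kappa>))" using n \<eta> by (intro mult_left_mono) auto
    also have "\<dots> = r * m / 4" using wk by (simp add: \<eta>_def field_simps)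
    finally have a: "G y \<le> (y - x) \<bullet> N + r * m / 4" using G(2) unfolding real_norm_def by linarith
    have "(y - x) \<bullet> N = - r * m + z \<bullet> N" by (simp add: yx inner_add_left m_def)
    moreover have "z \<bullet> N \<le> norm z * norm N" by (rule norm_cauchy_schwarz)
    moreover have "norm z * norm N \<le> \<kappa> * r * norm N" using z by (intro mult_right_mono) auto
    moreover have "\<kappa> * r * norm N \<le> r * (m / 2)"
      using mult_left_mono[OF \<kappa>N, of r] r by (simp add: algebra_simps)
    moreover have "r * m > 0" using r m by simp
    ultimately show "G y < 0" using a by linarith
  qed
  moreover have "d / (norm w + \<kappa>) > 0" using d wk by simp
  ultimately show ?thesis using \<kappa> by blast
qed

lemma half_ball_borel: "half_ball x r v \<in> sets borel"
proof -
  have "half_ball x r v = ball x r \<inter> {y. (y - x) \<bullet> v > 0}" by (auto simp: half_ball_def)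
  also have "\<dots> \<in> sets borel"
    by (intro sets.Int borel_open open_ball open_Collect_less continuous_intros)
  finally show ?thesis .
qed

lemma half_ball_lmeasurable: "half_ball x r v \<in> lmeasurable"
  by (rule fmeasurableI2[OF lmeasurable_ball[of x r]])
    (auto simp: half_ball_def sets_completionI_sets[OF half_ball_borel[unfolded half_ball_def, folded sets_lborel]] half_ball_def)

lemma measure_ball_scale:
  "r \<ge> 0 \<Longrightarrow> measure lebesgue (ball (x::'a::euclidean_space) r) = r ^ DIM('a) * measure lebesgue (ball (0::'a) 1)"
  by (simp add: content_ball)

lemma ball_subset_half_ball:
  fixes x v w :: "'a::euclidean_space"
  assumes v: "norm v = 1" and r: "r > 0" and k: "\<kappa> \<le> w \<bullet> v"
  shows "ball (x + r *\<^sub>R w) (\<kappa> * r) \<subseteq> half_ball x ((norm w + \<kappa>) * r) v"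
proof
  fix y assume "y \<in> ball (x + r *\<^sub>R w) (\<kappa> * r)"
  define z where "z = y - x - r *\<^sub>R w"
  have z: "norm z < \<kappa> * r" using \<open>y \<in> _\<close> by (simp add: z_def dist_norm norm_minus_commute algebra_simps)
  have yx: "y - x = r *\<^sub>R w + z" by (simp add: z_def)
  have "norm (y - x) < (norm w + \<kappa>) * r" unfolding yx
    using norm_triangle_ineq[of "r *\<^sub>R w" z] r z by (simp add: algebra_simps)
  moreover have "(y - x) \<bullet> v > 0"
  proof -
    have "\<bar>z \<bullet> v\<bar> \<le> norm z * norm v" by (rule Cauchy_Schwarz_ineq2)
    then have "\<bar>z \<bullet> v\<bar> < \<kappa> * r" using z v by simp
    moreover have "\<kappa> * r \<le> (w \<bullet> v) * r" using k r by (intro mult_right_mono) auto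
    ultimately show ?thesis by (simp add: yx inner_add_left mult.commute)
  qed
  ultimately show "y \<in> half_ball x ((norm w + \<kappa>) * r) v"
    by (simp add: half_ball_def dist_norm norm_minus_commute)
qed

lemma measure_half_ball_bounds:
  fixes x v :: "'a::euclidean_space"
  assumes "norm v = 1" "r > 0"
  shows "measure lebesgue (ball x r) / 2 ^ DIM('a) \<le> measure lebesgue (half_ball x r v)"
    "measure lebesgue (half_ball x r v) \<le> measure lebesgue (ball x r)"
    "measure lebesgue (half_ball x r v) > 0"
proof -
  have sub: "ball (x + (r/2) *\<^sub>R v) (r/2) \<subseteq> half_ball x r v"
    using ball_subset_half_ball[of v "r/2" 1 v x] assms by (simp add: norm_eq_1)
  have "measure lebesgue (ball (x + (r/2) *\<^sub>R v) (r/2)) \<le> measure lebesgue (half_ball x r v)"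
    by (rule measure_mono_fmeasurable[OF sub _ half_ball_lmeasurable]) auto
  moreover have "measure lebesgue (ball (x + (r/2) *\<^sub>R v) (r/2)) = measure lebesgue (ball x r) / 2 ^ DIM('a)"
    using assms measure_ball_scale[of "r/2" "x + (r/2) *\<^sub>R v"] measure_ball_scale[of r x]
    by (simp only: power_divide) simp
  ultimately show "measure lebesgue (ball x r) / 2 ^ DIM('a) \<le> measure lebesgue (half_ball x r v)" by simp
  moreover have "measure lebesgue (ball x r) / 2 ^ DIM('a) > 0" using assms by (simp add: content_ball_pos)
  ultimately show "measure lebesgue (half_ball x r v) > 0" by linarith
  show "measure lebesgue (half_ball x r v) \<le> measure lebesgue (ball x r)"
    by (rule measure_mono_fmeasurable) (auto simp: half_ball_def fmeasurableD[OF half_ball_lmeasurable, unfolded half_ball_def])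
qed

lemma tendsto_zero_ratioI:
  fixes f g :: "real \<Rightarrow> real"
  assumes "\<And>e. e > 0 \<Longrightarrow> \<forall>\<^sub>F r in at_right 0. 0 \<le> f r \<and> f r \<le> e * g r \<and> g r > 0"
  shows "((\<lambda>r. f r / g r) \<longlongrightarrow> 0) (at_right 0)"
proof (rule tendstoI)
  fix e :: real assume e: "e > 0"
  then have "e / 2 > 0" by simp
  from assms[OF this] show "\<forall>\<^sub>F r in at_right 0. dist (f r / g r) 0 < e"
  proof eventually_elim
    case (elim r)
    then have "f r / g r \<le> e / 2" "0 \<le> f r / g r" by (auto simp: pos_divide_le_eq)
    then show ?case using e unfolding dist_real_def by linarith
  qed
qed

text \<open>The balls on which \<open>u = k\<close> fill a fixed fraction of the half-balls, so the mean of \<open>|u - c|\<close> stays above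
  a fixed multiple of \<open>|k - c|\<close>.\<close>

lemma one_sided_limit_unique:
  fixes u :: "'a::euclidean_space \<Rightarrow> real"
  assumes u: "u \<in> borel_measurable lebesgue" "\<And>y. \<bar>u y\<bar> \<le> 1"
    and lim: "one_sided_limit u x v c" and v: "norm v = 1"
    and w: "w \<bullet> v > 0" and \<kappa>: "\<kappa> > 0" and r0: "r0 > 0"
    and eq: "\<And>r y. 0 < r \<Longrightarrow> r < r0 \<Longrightarrow> y \<in> ball (x + r *\<^sub>R w) (\<kappa> * r) \<Longrightarrow> u y = k"
  shows "c = k"
proof (rule ccontr)
  assume "c \<noteq> k"
  define \<kappa>' where "\<kappa>' = min \<kappa> (w \<bullet> v)"
  have \<kappa>': "\<kappa>' > 0" "\<kappa>' \<le> \<kappa>" "\<kappa>' \<le> w \<bullet> v" using \<kappa> w by (auto simp: \<kappa>'_def)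
  define R where "R = norm w + \<kappa>'"
  have R: "R > 0" using \<kappa>' by (simp add: R_def add_nonneg_pos)
  let ?V = "measure lebesgue (ball (0::'a) 1)"
  have V: "?V > 0" by (simp add: content_ball_pos)
  define a where "a = \<bar>k - c\<bar> * (\<kappa>' / R) ^ DIM('a)"
  have a: "a > 0" using \<open>c \<noteq> k\<close> \<kappa>' R by (simp add: a_def)
  let ?q = "\<lambda>\<rho>. (LINT y:half_ball x \<rho> v|lebesgue. \<bar>u y - c\<bar>) / measure lebesgue (half_ball x \<rho> v)"
  have lower: "a \<le> ?q \<rho>" if \<rho>: "0 < \<rho>" "\<rho> < R * r0" for \<rho>
  proof -
    define r where "r = \<rho> / R"
    have r: "0 < r" "r < r0" "\<rho> = R * r" using \<rho> R by (auto simp: r_def field_simps)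
    let ?B = "ball (x + r *\<^sub>R w) (\<kappa>' * r)"
    have sub: "?B \<subseteq> half_ball x \<rho> v"
      using ball_subset_half_ball[OF v r(1) \<kappa>'(3), of x] by (simp add: r(3) R_def)
    have ueq: "u y = k" if "y \<in> ?B" for y
    proof (rule eq[OF r(1,2)])
      have "\<kappa>' * r \<le> \<kappa> * r" using \<kappa>' r by (intro mult_right_mono) auto
      then show "y \<in> ball (x + r *\<^sub>R w) (\<kappa> * r)" using that by auto
    qed
    have int: "set_integrable lebesgue (half_ball x \<rho> v) (\<lambda>y. \<bar>u y - c\<bar>)"
      unfolding set_integrable_def
    proof (rule integrableI_bounded_set[where A="half_ball x \<rho> v" and B="1 + \<bar>c\<bar>"])
      show "half_ball x \<rho> v \<in> sets lebesgue" using half_ball_lmeasurable by auto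
      then show "(\<lambda>y. indicat_real (half_ball x \<rho> v) y *\<^sub>R \<bar>u y - c\<bar>) \<in> borel_measurable lebesgue"
        using u(1) by measurable
      show "emeasure lebesgue (half_ball x \<rho> v) < \<infinity>"
        using fmeasurableD2[OF half_ball_lmeasurable] by (simp add: less_top)
      have "\<bar>u y - c\<bar> \<le> 1 + \<bar>c\<bar>" for y using u(2)[of y] by linarith
      then show "AE y in lebesgue. y \<in> half_ball x \<rho> v \<longrightarrow> norm (indicat_real (half_ball x \<rho> v) y *\<^sub>R \<bar>u y - c\<bar>) \<le> 1 + \<bar>c\<bar>"
        by (auto simp: indicator_def)
    qed (auto simp: indicator_def)
    have intB: "set_integrable lebesgue ?B (\<lambda>y. \<bar>k - c\<bar>)"
      unfolding set_integrable_def by (intro integrable_scaleR_left lmeasurable_iff_integrable[THEN iffD1] lmeasurable_ball)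
    have "\<bar>k - c\<bar> * measure lebesgue ?B = (LINT y:?B|lebesgue. \<bar>k - c\<bar>)"
      by (simp add: set_lebesgue_integral_def)
    also have "\<dots> \<le> (LINT y:half_ball x \<rho> v|lebesgue. \<bar>u y - c\<bar>)"
      unfolding set_lebesgue_integral_def
    proof (rule integral_mono)
      show "integrable lebesgue (\<lambda>y. indicat_real ?B y *\<^sub>R \<bar>k - c\<bar>)" using intB by (simp add: set_integrable_def)
      show "integrable lebesgue (\<lambda>y. indicat_real (half_ball x \<rho> v) y *\<^sub>R \<bar>u y - c\<bar>)" using int by (simp add: set_integrable_def)
      fix y show "indicat_real ?B y *\<^sub>R \<bar>k - c\<bar> \<le> indicat_real (half_ball x \<rho> v) y *\<^sub>R \<bar>u y - c\<bar>"
        using sub ueq by (auto simp: indicator_def)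
    qed
    finally have num: "\<bar>k - c\<bar> * measure lebesgue ?B \<le> (LINT y:half_ball x \<rho> v|lebesgue. \<bar>u y - c\<bar>)" .
    have hb: "measure lebesgue (half_ball x \<rho> v) \<le> \<rho> ^ DIM('a) * ?V" "measure lebesgue (half_ball x \<rho> v) > 0"
      using measure_half_ball_bounds[OF v \<rho>(1), of x] measure_ball_scale[of \<rho> x] \<rho>(1) by linarith+
    have "a * measure lebesgue (half_ball x \<rho> v) \<le> a * (\<rho> ^ DIM('a) * ?V)"
      using hb a by (intro mult_left_mono) auto
    also have "\<dots> = \<bar>k - c\<bar> * ((\<kappa>' * r) ^ DIM('a) * ?V)"
      using R by (simp add: a_def r(3) power_mult_distrib power_divide)
    also have "\<dots> = \<bar>k - c\<bar> * measure lebesgue ?B"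
      using \<kappa>' r by (subst measure_ball_scale) auto
    finally show ?thesis using num hb by (simp add: pos_le_divide_eq)
  qed
  have "\<forall>\<^sub>F \<rho> in at_right 0. ?q \<rho> < a"
    using lim a unfolding one_sided_limit_def by (rule order_tendstoD(2))
  moreover have "\<forall>\<^sub>F \<rho> in at_right 0. \<rho> < R * r0"
    using R r0 by (auto simp: eventually_at_right_field intro!: exI[of _ "R * r0"])
  ultimately have "\<forall>\<^sub>F \<rho> in at_right (0::real). False"
    using eventually_at_right_less[of 0] by eventually_elim (use lower in \<open>meson not_less\<close>)
  then show False by simp
qed

lemma jump_set_indicator_subset_frontier:
  fixes \<Omega> :: "'a::euclidean_space set"
  assumes "open \<Omega>"
  shows "jump_set (indicator \<Omega>) \<subseteq> frontier \<Omega>"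
proof
  fix x assume "x \<in> jump_set (indicator \<Omega> :: 'a \<Rightarrow> real)"
  then obtain a b v where j: "a < b" "norm v = 1"
    "one_sided_limit (indicator \<Omega>) x v b" "one_sided_limit (indicator \<Omega>) x (-v) a"
    unfolding jump_set_def jump_triple_def by blast
  have um: "(indicator \<Omega> :: 'a \<Rightarrow> real) \<in> borel_measurable lebesgue"
    using assms by (intro borel_measurable_indicator) auto
  show "x \<in> frontier \<Omega>"
  proof (rule ccontr)
    assume "x \<notin> frontier \<Omega>"
    then have "\<exists>d>0. \<exists>k. \<forall>y\<in>ball x d. (indicator \<Omega> y :: real) = k"
    proof (cases "x \<in> \<Omega>")
      case True
      then obtain d where "d > 0" "ball x d \<subseteq> \<Omega>" using assms openE by blast
      then show ?thesis by (intro exI[of _ d] conjI exI[of _ 1]) auto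
    next
      case False
      then have "x \<notin> closure \<Omega>" using \<open>x \<notin> frontier \<Omega>\<close> assms by (simp add: frontier_def interior_open)
      then obtain d where "d > 0" "ball x d \<subseteq> - closure \<Omega>" using openE[of "- closure \<Omega>" x] by auto
      moreover have "\<Omega> \<subseteq> closure \<Omega>" by (rule closure_subset)
      ultimately show ?thesis by (intro exI[of _ d] conjI exI[of _ 0]) (auto simp: indicator_def)
    qed
    then obtain d k where d: "d > 0" "\<And>y. y \<in> ball x d \<Longrightarrow> (indicator \<Omega> y :: real) = k" by blast
    have "c = k" if "one_sided_limit (indicator \<Omega>) x v' c" "norm v' = 1" for v' c
    proof (rule one_sided_limit_unique[OF um _ that, of v' 1 "d/2"])
      show "v' \<bullet> v' > 0" using that by (auto simp: norm_eq_1)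
      fix r y assume r: "0 < r" "r < d/2" and y: "y \<in> ball (x + r *\<^sub>R v') (1 * r)"
      have "dist x (x + r *\<^sub>R v') = r" using r that by (simp add: dist_norm)
      then have "dist x y < r + r" using y dist_triangle[of x y "x + r *\<^sub>R v'"] by simp
      then show "indicator \<Omega> y = k" using d(2)[of y] r by auto
    qed (use d in \<open>auto simp: indicator_def\<close>)
    from this[OF j(3)] this[OF j(4)] j(1,2) show False by simp
  qed
qed

context C1_chart begin

text \<open>Let \<open>n\<close> be the outward normal. If a unit vector \<open>v'\<close> differs from \<open>n\<close>, then \<open>w = v' - n\<close> points into the half-ball of \<open>v'\<close> and into
  \<open>\<Omega>\<close>, so the trace on the side of \<open>v'\<close> can only be \<open>1\<close>; if \<open>v' \<noteq> - n\<close>, then \<open>w = v' + n\<close> shows in the same way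
  that it can only be \<open>0\<close>. Since the two traces at a jump differ and \<open>v\<close> points to the larger one, \<open>v = - n\<close>.\<close>

lemma jump_triple_indicator:
  assumes op: "open \<Omega>" and x: "x \<in> U" "x \<in> frontier \<Omega>" and j: "jump_triple (indicator \<Omega>) x a b v"
  shows "a = 0" "b = 1" "v = - (nrm x /\<^sub>R norm (nrm x))"
proof -
  define n where "n = nrm x /\<^sub>R norm (nrm x)"
  have nn: "norm n = 1" by (simp add: n_def)
  have hx: "height x = 0" using in_frontier_iff[OF x(1) op] x(2) by simp
  from j have ab: "a < b" and v: "norm v = 1" and l1: "one_sided_limit (indicator \<Omega>) x v b"
    and l2: "one_sided_limit (indicator \<Omega>) x (- v) a" unfolding jump_triple_def by auto
  have um: "(indicator \<Omega> :: 'a \<Rightarrow> real) \<in> borel_measurable lebesgue"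
    using op by (intro borel_measurable_indicator) auto
  obtain \<rho> where \<rho>: "\<rho> > 0" "ball x \<rho> \<subseteq> U" using open_U x(1) openE by blast
  have near: "y \<in> U" if "0 < r" "r < \<rho> / (norm w + \<kappa>)" "\<kappa> > 0" "y \<in> ball (x + r *\<^sub>R w) (\<kappa> * r)" for y w r \<kappa>
  proof -
    have "dist x y \<le> dist x (x + r *\<^sub>R w) + dist (x + r *\<^sub>R w) y" by (rule dist_triangle)
    also have "\<dots> < r * norm w + \<kappa> * r" using that by (simp add: dist_norm)
    also have "\<dots> = r * (norm w + \<kappa>)" by (simp add: algebra_simps)
    also have "\<dots> < \<rho>" using that by (simp add: pos_less_divide_eq add_nonneg_pos)
    finally show ?thesis using \<rho> by auto
  qed
  have one: "c = 1" if lim: "one_sided_limit (indicator \<Omega>) x v' c" and v': "norm v' = 1" "v' \<noteq> n" for v' c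
  proof -
    define w where "w = v' - n"
    have lt: "v' \<bullet> n < 1"
    proof -
      have "0 < (v' - n) \<bullet> (v' - n)" using v'(2) by simp
      also have "\<dots> = v' \<bullet> v' + n \<bullet> n - 2 * (v' \<bullet> n)" by (simp add: inner_diff_left inner_diff_right inner_commute[of n v'])
      finally show ?thesis using v'(1) nn unfolding norm_eq_1 by linarith
    qed
    have wv: "w \<bullet> v' > 0" using lt v'(1) unfolding w_def inner_diff_left norm_eq_1 by (simp add: inner_commute[of n v'])
    have "w \<bullet> n < 0" using lt nn by (simp add: w_def inner_diff_left norm_eq_1)
    then have "w \<bullet> nrm x < 0" by (simp add: n_def divide_less_0_iff mult_less_0_iff zero_less_mult_iff)
    from halfspace_ball_negative[OF height_gderiv hx this]
    obtain \<kappa> r0 where k: "\<kappa> > 0" "r0 > 0"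
      "\<And>r y. 0 < r \<Longrightarrow> r < r0 \<Longrightarrow> y \<in> ball (x + r *\<^sub>R w) (\<kappa> * r) \<Longrightarrow> height y < 0" by blast
    show ?thesis
    proof (rule one_sided_limit_unique[OF um _ lim v'(1) wv k(1), of "min r0 (\<rho> / (norm w + \<kappa>))"])
      fix r y assume r: "0 < r" "r < min r0 (\<rho> / (norm w + \<kappa>))" "y \<in> ball (x + r *\<^sub>R w) (\<kappa> * r)"
      then have "y \<in> U" "height y < 0" using near[of r w \<kappa> y] k by auto
      then show "indicator \<Omega> y = (1::real)" using in_\<Omega>_iff by simp
    qed (use k \<rho> in \<open>auto simp: indicator_def add_nonneg_pos\<close>)
  qed
  have zero: "c = 0" if lim: "one_sided_limit (indicator \<Omega>) x v' c" and v': "norm v' = 1" "v' \<noteq> - n" for v' c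
  proof -
    define w where "w = v' + n"
    have lt: "v' \<bullet> (- n) < 1"
    proof -
      have "v' + n \<noteq> 0" using v'(2) by (simp add: eq_neg_iff_add_eq_0)
      then have "0 < (v' + n) \<bullet> (v' + n)" by simp
      also have "\<dots> = v' \<bullet> v' + n \<bullet> n + 2 * (v' \<bullet> n)" by (simp add: inner_add_left inner_add_right inner_commute[of n v'])
      finally show ?thesis using v'(1) nn unfolding norm_eq_1 inner_minus_right by linarith
    qed
    have wv: "w \<bullet> v' > 0" using lt v'(1) unfolding w_def inner_add_left norm_eq_1 by (simp add: inner_commute[of n v'])
    have "w \<bullet> n > 0" using lt nn by (simp add: w_def inner_add_left norm_eq_1)
    then have "w \<bullet> - nrm x < 0" by (simp add: n_def zero_less_divide_iff zero_less_mult_iff)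
    moreover have "GDERIV (\<lambda>y. - height y) x :> - nrm x" using height_gderiv by (rule GDERIV_minus)
    ultimately obtain \<kappa> r0 where k: "\<kappa> > 0" "r0 > 0"
      "\<And>r y. 0 < r \<Longrightarrow> r < r0 \<Longrightarrow> y \<in> ball (x + r *\<^sub>R w) (\<kappa> * r) \<Longrightarrow> - height y < 0"
      using halfspace_ball_negative[of "\<lambda>y. - height y" x "- nrm x" w] hx by auto
    show ?thesis
    proof (rule one_sided_limit_unique[OF um _ lim v'(1) wv k(1), of "min r0 (\<rho> / (norm w + \<kappa>))"])
      fix r y assume r: "0 < r" "r < min r0 (\<rho> / (norm w + \<kappa>))" "y \<in> ball (x + r *\<^sub>R w) (\<kappa> * r)"
      then have "y \<in> U" "height y > 0" using near[of r w \<kappa> y] k by auto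
      then show "indicator \<Omega> y = (0::real)" using in_\<Omega>_iff by simp
    qed (use k \<rho> in \<open>auto simp: indicator_def add_nonneg_pos\<close>)
  qed
  have nmn: "n \<noteq> - n"
  proof
    assume "n = - n"
    then have "n \<bullet> n = - n \<bullet> n" by (rule arg_cong)
    then show False using nn by (simp add: norm_eq_1)
  qed
  have vn: "v = - n"
  proof (rule ccontr)
    assume v2: "v \<noteq> - n"
    have b0: "b = 0" using zero[OF l1 v v2] .
    have "v = n" using one[OF l1 v] b0 by auto
    then have "a = 1" using one[OF l2] v nmn by auto
    then show False using ab b0 by simp
  qed
  then show "v = - (nrm x /\<^sub>R norm (nrm x))" by (simp add: n_def)
  show "b = 1" using one[OF l1 v] vn nmn by auto
  show "a = 0" using zero[OF l2] v vn nmn by auto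
qed

text \<open>In the half-ball on one side of the tangent hyperplane, the points on the wrong side of the boundary
  lie in a slab around that hyperplane whose relative width tends to \<open>0\<close>, by differentiability of \<open>height\<close>.
  The sign \<open>s\<close> selects the side.\<close>

lemma measure_half_ball_wrong_side:
  assumes hx: "height x = 0" and s: "s = 1 \<or> s = - 1" and e: "\<epsilon> > 0"
  shows "\<forall>\<^sub>F r in at_right 0. measure lebesgue {y\<in>half_ball x r (s *\<^sub>R (nrm x /\<^sub>R norm (nrm x))). s * height y \<le> 0}
     \<le> \<epsilon> * measure lebesgue (half_ball x r (s *\<^sub>R (nrm x /\<^sub>R norm (nrm x))))"
proof -
  let ?n = "s *\<^sub>R (nrm x /\<^sub>R norm (nrm x))"
  have n1: "norm ?n = 1" using s by auto
  have "\<epsilon> / 2 ^ DIM('a) > 0" using e by simp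
  from slab_small_measure[OF nrm_nonzero[of x] this] obtain \<eta> where \<eta>: "\<eta> > 0"
    and slab: "\<And>r. r > 0 \<Longrightarrow> {y\<in>ball x r. \<bar>(y - x) \<bullet> nrm x\<bar> \<le> \<eta> * r} \<in> lmeasurable"
     "\<And>r. r > 0 \<Longrightarrow> measure lebesgue {y\<in>ball x r. \<bar>(y - x) \<bullet> nrm x\<bar> \<le> \<eta> * r} < \<epsilon> / 2 ^ DIM('a) * measure lebesgue (ball x r)"
    by blast
  have "(height has_derivative (\<lambda>h. h \<bullet> nrm x)) (at x)" using height_gderiv by (simp add: gderiv_def)
  then obtain d where d: "d > 0"
    "\<And>y. norm (y - x) < d \<Longrightarrow> norm (height y - height x - (y - x) \<bullet> nrm x) \<le> \<eta> * norm (y - x)"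
    unfolding has_derivative_at_alt using \<eta> by blast
  have main: "measure lebesgue {y\<in>half_ball x r ?n. s * height y \<le> 0} \<le> \<epsilon> * measure lebesgue (half_ball x r ?n)"
    if r: "0 < r" "r < d" for r
  proof -
    have sub: "{y\<in>half_ball x r ?n. s * height y \<le> 0} \<subseteq> {y\<in>ball x r. \<bar>(y - x) \<bullet> nrm x\<bar> \<le> \<eta> * r}"
    proof clarify
      fix y assume y: "y \<in> half_ball x r ?n" "s * height y \<le> 0"
      then have yr: "norm (y - x) < r" by (simp add: half_ball_def dist_norm norm_minus_commute)
      have "(y - x) \<bullet> ?n > 0" using y by (simp add: half_ball_def)
      then have pos: "s * ((y - x) \<bullet> nrm x) > 0"
        by (simp add: zero_less_mult_iff zero_less_divide_iff mult_less_0_iff divide_less_0_iff)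
      have "norm (height y - height x - (y - x) \<bullet> nrm x) \<le> \<eta> * norm (y - x)" using d(2) yr r by auto
      also have "\<dots> \<le> \<eta> * r" using yr \<eta> by (intro mult_left_mono) auto
      finally have "\<bar>height y - (y - x) \<bullet> nrm x\<bar> \<le> \<eta> * r" using hx by simp
      then have "\<bar>(y - x) \<bullet> nrm x\<bar> \<le> \<eta> * r" using s pos y(2) by auto
      with yr show "y \<in> ball x r \<and> \<bar>(y - x) \<bullet> nrm x\<bar> \<le> \<eta> * r" by (simp add: dist_norm norm_minus_commute)
    qed
    have meas: "{y\<in>half_ball x r ?n. s * height y \<le> 0} \<in> sets lebesgue"
    proof -
      have "closed {y. s * height y \<le> 0}" by (intro closed_Collect_le continuous_intros height_cont)
      then have "half_ball x r ?n \<inter> {y. s * height y \<le> 0} \<in> sets borel"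
        by (intro sets.Int half_ball_borel borel_closed)
      moreover have "half_ball x r ?n \<inter> {y. s * height y \<le> 0} = {y\<in>half_ball x r ?n. s * height y \<le> 0}" by blast
      ultimately show ?thesis by (simp add: sets_completionI_sets)
    qed
    have "measure lebesgue {y\<in>half_ball x r ?n. s * height y \<le> 0} \<le> measure lebesgue {y\<in>ball x r. \<bar>(y - x) \<bullet> nrm x\<bar> \<le> \<eta> * r}"
      by (rule measure_mono_fmeasurable[OF sub meas slab(1)[OF r(1)]])
    also have "\<dots> \<le> \<epsilon> * (measure lebesgue (ball x r) / 2 ^ DIM('a))" using slab(2)[OF r(1)] by simp
    also have "\<dots> \<le> \<epsilon> * measure lebesgue (half_ball x r ?n)"
      using measure_half_ball_bounds(1)[OF n1 r(1)] e by (intro mult_left_mono) auto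
    finally show ?thesis .
  qed
  have "\<forall>\<^sub>F r in at_right 0. r < d" using d(1) by (auto simp: eventually_at_right_field)
  then show ?thesis using eventually_at_right_less[of 0] by eventually_elim (rule main)
qed

lemma jump_triple_indicator_exists:
  assumes op: "open \<Omega>" and x: "x \<in> U" "x \<in> frontier \<Omega>"
  shows "jump_triple (indicator \<Omega>) x 0 1 (- (nrm x /\<^sub>R norm (nrm x)))"
proof -
  let ?n = "nrm x /\<^sub>R norm (nrm x)"
  have hx: "height x = 0" using in_frontier_iff[OF x(1) op] x(2) by simp
  obtain \<rho> where \<rho>: "\<rho> > 0" "ball x \<rho> \<subseteq> U" using open_U x(1) openE by blast
  have ev\<rho>: "\<forall>\<^sub>F r in at_right 0. r < \<rho>" using \<rho>(1) by (auto simp: eventually_at_right_field)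
  have \<Omega>m: "\<Omega> \<in> sets lebesgue" using op by auto
  have lim: "one_sided_limit (indicator \<Omega>) x (s *\<^sub>R ?n) c"
    if s: "s = 1 \<or> s = -1" and c: "c = (1 - s) / 2" for s c
    unfolding one_sided_limit_def
  proof (rule tendsto_zero_ratioI)
    fix \<epsilon> :: real assume "\<epsilon> > 0"
    let ?h = "\<lambda>r. half_ball x r (s *\<^sub>R ?n)"
    have n1: "norm (s *\<^sub>R ?n) = 1" using s by (elim disjE) simp_all
    have main: "0 \<le> (LINT y:?h r|lebesgue. \<bar>indicat_real \<Omega> y - c\<bar>) \<and>
       (LINT y:?h r|lebesgue. \<bar>indicat_real \<Omega> y - c\<bar>) \<le> \<epsilon> * measure lebesgue (?h r) \<and> 0 < measure lebesgue (?h r)"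
      if elim: "measure lebesgue {y\<in>?h r. s * height y \<le> 0} \<le> \<epsilon> * measure lebesgue (?h r)" "0 < r" "r < \<rho>" for r
    proof -
      let ?bad = "{y\<in>?h r. s * height y \<le> 0}"
      let ?B = "if s = 1 then ?h r \<inter> \<Omega> else ?h r - \<Omega>"
      have "?h r \<subseteq> ball x r" by (auto simp: half_ball_def)
      also have "\<dots> \<subseteq> ball x \<rho>" using elim(3) by (intro subset_ball) simp
      also have "\<dots> \<subseteq> U" by (rule \<rho>(2))
      finally have hU: "?h r \<subseteq> U" .
      have "(LINT y:?h r|lebesgue. \<bar>indicat_real \<Omega> y - c\<bar>) = (LINT y|lebesgue. indicat_real ?B y)"
        unfolding set_lebesgue_integral_def
        by (rule Bochner_Integration.integral_cong[OF refl]) (use s c in \<open>elim disjE; simp add: indicator_def\<close>)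
      also have "\<dots> = measure lebesgue ?B" by simp
      finally have eq: "(LINT y:?h r|lebesgue. \<bar>indicat_real \<Omega> y - c\<bar>) = measure lebesgue ?B" .
      have hm: "?h r \<in> sets lebesgue" using half_ball_lmeasurable by auto
      have badm: "?bad \<in> lmeasurable"
      proof (rule fmeasurableI2[OF half_ball_lmeasurable[of x r "s *\<^sub>R ?n"]])
        have "closed {y. s * height y \<le> 0}" by (intro closed_Collect_le continuous_intros height_cont)
        then have "?h r \<inter> {y. s * height y \<le> 0} \<in> sets borel"
          by (intro sets.Int half_ball_borel borel_closed)
        moreover have "?h r \<inter> {y. s * height y \<le> 0} = ?bad" by blast
        ultimately show "?bad \<in> sets lebesgue" by (simp add: sets_completionI_sets)
      qed auto
      have "?B \<subseteq> ?bad"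
      proof
        fix y assume y: "y \<in> ?B"
        then have "y \<in> ?h r" by (auto split: if_splits)
        moreover from this hU have "y \<in> \<Omega> \<longleftrightarrow> height y < 0" using in_\<Omega>_iff by blast
        ultimately show "y \<in> ?bad" using y s by (auto split: if_splits)
      qed
      moreover have "?B \<in> sets lebesgue" using hm \<Omega>m by auto
      ultimately have "measure lebesgue ?B \<le> measure lebesgue ?bad"
        using badm by (intro measure_mono_fmeasurable)
      then have "measure lebesgue ?B \<le> \<epsilon> * measure lebesgue (?h r)" using elim(1) by linarith
      then show ?thesis unfolding eq
        using measure_half_ball_bounds(3)[OF n1 elim(2)] measure_nonneg by blast
    qed
    show "\<forall>\<^sub>F r in at_right 0. 0 \<le> (LINT y:?h r|lebesgue. \<bar>indicat_real \<Omega> y - c\<bar>) \<and>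
       (LINT y:?h r|lebesgue. \<bar>indicat_real \<Omega> y - c\<bar>) \<le> \<epsilon> * measure lebesgue (?h r) \<and> 0 < measure lebesgue (?h r)"
      using measure_half_ball_wrong_side[OF hx s \<open>\<epsilon> > 0\<close>] eventually_at_right_less[of 0] ev\<rho>
      by eventually_elim (rule main)
  qed
  show ?thesis
    unfolding jump_triple_def using lim[of "-1" 1] lim[of 1 0] by auto
qed

end

section \<open>Lipschitz boundaries and tangential sets\<close>

text \<open>The chart function is Lipschitz on balls. Composing it with the nearest-point retraction to a ball,
  which is \<open>1\<close>-Lipschitz, makes it Lipschitz on the whole hyperplane without changing it near \<open>x\<close>.\<close>

lemma C2_boundary_imp_lipschitz_boundary:
  fixes \<Omega> :: "'a::euclidean_space set"
  assumes "C2_boundary \<Omega>"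
  shows "lipschitz_boundary \<Omega>"
  unfolding lipschitz_boundary_def
proof
  fix x assume "x \<in> frontier \<Omega>"
  from C2_boundary_chart[OF assms this] obtain e F gF U
    where ch: "C1_chart e F gF \<Omega> U" and xU: "x \<in> U" by blast
  interpret C1_chart e F gF \<Omega> U by fact
  define p where "p = prp x"
  define f where "f = (\<lambda>y. F (closest_point (cball p 1) y))"
  obtain L where L: "L-lipschitz_on (cball p 1) F" using F_lipschitz_cball by blast
  have cl: "dist (closest_point (cball p 1) y) (closest_point (cball p 1) z) \<le> dist y z" for y z
    by (rule closest_point_lipschitz) auto
  have cin: "closest_point (cball p 1) y \<in> cball p 1" for y
    by (rule closest_point_in_set) auto
  have "L-lipschitz_on {y. y \<bullet> e = 0} f"
  proof (rule lipschitz_onI)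
    show "0 \<le> L" using L by (rule lipschitz_on_nonneg)
    fix y z
    have "dist (f y) (f z) \<le> L * dist (closest_point (cball p 1) y) (closest_point (cball p 1) z)"
      unfolding f_def using L cin by (intro lipschitz_onD)
    also have "\<dots> \<le> L * dist y z" using cl lipschitz_on_nonneg[OF L] by (intro mult_left_mono)
    finally show "dist (f y) (f z) \<le> L * dist y z" .
  qed
  moreover have "open (U \<inter> prp -` ball p 1)"
    using open_U by (intro continuous_open_preimage continuous_prp continuous_on_id) auto
  moreover have "x \<in> U \<inter> prp -` ball p 1" using xU by (simp add: p_def)
  moreover have "\<Omega> \<inter> (U \<inter> prp -` ball p 1) = {y \<in> U \<inter> prp -` ball p 1. y \<bullet> e < f (prp y)}"
  proof -
    have "f (prp y) = F y" if "prp y \<in> ball p 1" for y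
      using that unfolding f_def by (subst closest_point_self) auto
    then show ?thesis using \<Omega>_U by auto
  qed
  ultimately show "\<exists>U e f L. open U \<and> x \<in> U \<and> norm e = 1 \<and>
        L-lipschitz_on {y. y \<bullet> e = 0} (f :: 'a \<Rightarrow> real) \<and>
        \<Omega> \<inter> U = {y\<in>U. y \<bullet> e < f (perp_part e y)}"
    using norm_e by blast
qed

context C1_graph begin

text \<open>The cylinder over the graph is parametrised by \<open>e\<^sup>\<bottom> \<times> \<real>\<close>, which is isometric to the space \<open>'a\<close> itself:
  the height \<open>t\<close> becomes the coordinate along \<open>e\<close>. On the cylinder, \<open>lift\<close> is the inverse of \<open>flat\<close>.\<close>

definition flat :: "'a \<times> real \<Rightarrow> 'a" where "flat z = prp (fst z) + snd z *\<^sub>R e"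

definition lift :: "'a \<Rightarrow> 'a \<times> real" where "lift q = (prp q + F q *\<^sub>R e, q \<bullet> e)"

lemma lift_flat: "height (fst z) = 0 \<Longrightarrow> lift (flat z) = z"
proof -
  assume h: "height (fst z) = 0"
  have "prp (flat z) = prp (fst z)" by (simp add: flat_def)
  moreover have "F (flat z) = F (fst z)" by (simp add: flat_def F_shift)
  moreover have "flat z \<bullet> e = snd z" by (simp add: flat_def inner_add_left)
  moreover have "fst z = prp (fst z) + (fst z \<bullet> e) *\<^sub>R e" by (rule prp_split)
  ultimately show ?thesis using h by (simp add: lift_def height_def prod_eq_iff)
qed

lemma norm_flat_le: "norm (flat z) \<le> 2 * norm z"
proof -
  have "norm (flat z) \<le> norm (prp (fst z)) + norm (snd z *\<^sub>R e)" unfolding flat_def by (rule norm_triangle_ineq)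
  also have "\<dots> \<le> norm (fst z) + \<bar>snd z\<bar>" using norm_prp_le[of "fst z"] by (simp add: norm_e)
  also have "\<dots> \<le> norm z + norm z"
    using norm_fst_le[of "fst z" "snd z"] norm_snd_le[of "snd z" "fst z"] by simp
  finally show ?thesis by simp
qed

lemma lift_lipschitz:
  assumes "L-lipschitz_on S F"
  shows "(L + 2)-lipschitz_on S lift"
proof (rule lipschitz_onI)
  have L0: "0 \<le> L" using assms by (rule lipschitz_on_nonneg)
  then show "0 \<le> L + 2" by simp
  fix y z assume yz: "y \<in> S" "z \<in> S"
  have "dist (lift y) (lift z) = norm (prp (y - z) + (F y - F z) *\<^sub>R e, (y - z) \<bullet> e)"
    by (simp add: lift_def dist_norm prp_diff algebra_simps inner_diff_left)
  also have "\<dots> \<le> norm (prp (y - z) + (F y - F z) *\<^sub>R e) + norm ((y - z) \<bullet> e)"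
    by (rule norm_Pair_le)
  also have "\<dots> \<le> (norm (prp (y - z)) + norm ((F y - F z) *\<^sub>R e)) + norm ((y - z) \<bullet> e)"
    by (intro add_right_mono norm_triangle_ineq)
  also have "norm ((y - z) \<bullet> e) \<le> norm (y - z)"
    using Cauchy_Schwarz_ineq2[of "y - z" e] norm_e by simp
  also have "norm (prp (y - z)) \<le> norm (y - z)" by (rule norm_prp_le)
  also have "norm ((F y - F z) *\<^sub>R e) \<le> L * norm (y - z)"
    using lipschitz_onD[OF assms yz] norm_e by (simp add: dist_norm)
  finally show "dist (lift y) (lift z) \<le> (L + 2) * dist y z"
    by (simp add: dist_norm algebra_simps)
qed

text \<open>Note that \<open>w q \<bullet> e = snd v\<close>: a normal \<open>v\<close> that is not horizontal pulls back to a non-zero vector.\<close>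

lemma lift_inner_derivative:
  fixes v :: "'a \<times> real"
  defines "w \<equiv> \<lambda>q. prp (fst v) + (e \<bullet> fst v) *\<^sub>R gF q + snd v *\<^sub>R e"
  assumes "\<epsilon> > 0"
  shows "\<exists>d>0. \<forall>y. norm (y - q) < d \<longrightarrow> \<bar>(lift y - lift q) \<bullet> v - (y - q) \<bullet> w q\<bar> \<le> \<epsilon> * norm (y - q)"
proof -
  have "((\<lambda>y. lift y \<bullet> v) has_derivative (\<lambda>h. (prp h + (h \<bullet> gF q) *\<^sub>R e) \<bullet> fst v + (h \<bullet> e) * snd v)) (at q)"
    unfolding lift_def inner_prod_def fst_conv snd_conv perp_part_def
    by (auto intro!: derivative_eq_intros F_has_derivative simp: inner_diff_left)
  moreover have "(prp h + (h \<bullet> gF q) *\<^sub>R e) \<bullet> fst v + (h \<bullet> e) * snd v = h \<bullet> w q" for h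
    by (simp add: w_def perp_part_def inner_diff_left inner_diff_right inner_add_left inner_add_right inner_commute)
  ultimately have "((\<lambda>y. lift y \<bullet> v) has_derivative (\<lambda>h. h \<bullet> w q)) (at q)" by simp
  then show ?thesis using assms(2) unfolding has_derivative_at_alt by (simp add: inner_diff_left)
qed

end

context C1_chart begin

text \<open>At each of its points, \<open>E\<close> is tangent to the boundary cylinder, which contains the vertical direction,
  and to a hyperplane that does not. Hence the flattened set \<open>N\<close> is tangent to some hyperplane of \<open>'a\<close> at
  each of its points. So it lies in thin slabs near every point and has density \<open>0\<close> there, and a set of
  density \<open>0\<close> at all of its own points is null. The Lipschitz map \<open>lift\<close> carries \<open>N\<close> back to \<open>E\<close>.\<close>

lemma hausdorff_null_transversal_chart:
  fixes E :: "('a \<times> real) set"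
  assumes op: "open \<Omega>" and EU: "fst ` E \<subseteq> U \<inter> frontier \<Omega>" and bE: "bounded E"
    and tang: "\<And>z. z \<in> E \<Longrightarrow> \<exists>v. snd v \<noteq> 0 \<and> ((\<lambda>y. ((y - z) \<bullet> v) / norm (y - z)) \<longlongrightarrow> 0) (at z within E)"
  shows "hausdorff_outer DIM('a) E = 0"
proof -
  have ht: "height (fst z) = 0" if "z \<in> E" for z
    using that EU in_frontier_iff[OF _ op] by blast
  define N where "N = flat ` E"
  have E_lift: "lift ` N = E"
    unfolding N_def image_image using ht lift_flat by simp
  obtain B where B: "\<And>z. z \<in> E \<Longrightarrow> norm z \<le> B" using bE bounded_iff by blast
  have NB: "N \<subseteq> cball 0 (2 * B)"
  proof
    fix q assume "q \<in> N"
    then obtain z where z: "z \<in> E" "q = flat z" by (auto simp: N_def)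
    then show "q \<in> cball 0 (2 * B)" using norm_flat_le[of z] B[OF z(1)] by simp
  qed
  obtain L where L: "L-lipschitz_on (cball 0 (2 * B)) F" using F_lipschitz_cball by blast
  then have lipN: "(L + 2)-lipschitz_on N lift"
    by (intro lift_lipschitz lipschitz_on_subset[OF L NB])
  have L2: "L + 2 > 0" using lipschitz_on_nonneg[OF L] by simp
  have "negligible N"
    unfolding negligible_eq_zero_density
  proof (intro ballI allI impI)
    fix q and r \<epsilon> :: real assume q: "q \<in> N" and r: "r > 0" and \<epsilon>: "\<epsilon> > 0"
    then obtain z where z: "z \<in> E" "q = flat z" by (auto simp: N_def)
    have lq: "lift q = z" using z lift_flat ht by simp
    from tang[OF z(1)] obtain v where v: "snd v \<noteq> 0"
      and lim: "((\<lambda>y. ((y - z) \<bullet> v) / norm (y - z)) \<longlongrightarrow> 0) (at z within E)" by blast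
    define w where "w = prp (fst v) + (e \<bullet> fst v) *\<^sub>R gF q + snd v *\<^sub>R e"
    have "w \<bullet> e = snd v" by (simp add: w_def inner_add_left)
    then have "w \<noteq> 0" using v by auto
    from slab_small_measure[OF this \<epsilon>] obtain \<eta> where \<eta>: "\<eta> > 0"
      and slab: "\<And>x r. r > 0 \<Longrightarrow> {y\<in>ball x r. \<bar>(y - x) \<bullet> w\<bar> \<le> \<eta> * r} \<in> lmeasurable"
       "\<And>x r. r > 0 \<Longrightarrow> measure lebesgue {y\<in>ball x r. \<bar>(y - x) \<bullet> w\<bar> \<le> \<eta> * r} < \<epsilon> * measure lebesgue (ball x r)"
      by blast
    define \<eta>1 where "\<eta>1 = \<eta> / (2 * (L + 2))"
    have \<eta>1: "\<eta>1 > 0" using \<eta> L2 by (simp add: \<eta>1_def)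
    have "\<forall>\<^sub>F y in at z within E. \<bar>((y - z) \<bullet> v) / norm (y - z)\<bar> < \<eta>1"
      using tendstoD[OF lim \<eta>1] by (simp add: dist_real_def)
    then obtain d1 where d1: "d1 > 0"
      "\<And>y. y \<in> E \<Longrightarrow> y \<noteq> z \<Longrightarrow> dist y z < d1 \<Longrightarrow> \<bar>((y - z) \<bullet> v) / norm (y - z)\<bar> < \<eta>1"
      unfolding eventually_at by blast
    have "\<eta> / 2 > 0" using \<eta> by simp
    from lift_inner_derivative[OF this, of q v] obtain d2 where d2: "d2 > 0"
      "\<And>y. norm (y - q) < d2 \<Longrightarrow> \<bar>(lift y - lift q) \<bullet> v - (y - q) \<bullet> w\<bar> \<le> \<eta> / 2 * norm (y - q)"
      unfolding w_def by blast
    define d where "d = min r (min d2 (d1 / (L + 2)))"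
    have d: "d > 0" "d \<le> r" "d \<le> d2" "d \<le> d1 / (L + 2)" using r d1 d2 L2 by (auto simp: d_def)
    have "N \<inter> ball q d \<subseteq> {y\<in>ball q d. \<bar>(y - q) \<bullet> w\<bar> \<le> \<eta> * d}"
    proof
      fix y assume "y \<in> N \<inter> ball q d"
      then have y: "y \<in> N" "y \<in> ball q d" by auto
      have yq: "norm (y - q) < d" using y by (simp add: dist_norm norm_minus_commute)
      have ly: "lift y \<in> E" using y E_lift by blast
      have dl: "norm (lift y - z) \<le> (L + 2) * norm (y - q)"
        using lipschitz_onD[OF lipN y(1) q] lq by (simp add: dist_norm)
      have "\<bar>(lift y - z) \<bullet> v\<bar> \<le> \<eta> / 2 * norm (y - q)"
      proof (cases "lift y = z")
        case False
        have "(L + 2) * norm (y - q) < (L + 2) * (d1 / (L + 2))" using yq d L2 by (intro mult_strict_left_mono) auto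
        also have "\<dots> = d1" using L2 by simp
        finally have "dist (lift y) z < d1" using dl by (simp add: dist_norm)
        from d1(2)[OF ly False this] have "\<bar>(lift y - z) \<bullet> v\<bar> < \<eta>1 * norm (lift y - z)"
          using False by (simp add: abs_divide pos_divide_less_eq)
        also have "\<dots> \<le> \<eta>1 * ((L + 2) * norm (y - q))" using dl \<eta>1 by (intro mult_left_mono) auto
        also have "\<dots> = \<eta> / 2 * norm (y - q)"
        proof -
          have "\<eta> / (2 * K) * (K * m) = \<eta> / 2 * m" if "K > 0" for K m :: real using that by simp
          then show ?thesis unfolding \<eta>1_def using L2 .
        qed
        finally show ?thesis by simp
      qed (use \<eta> in auto)
      moreover have "\<bar>(lift y - z) \<bullet> v - (y - q) \<bullet> w\<bar> \<le> \<eta> / 2 * norm (y - q)"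
        using d2(2)[of y] yq d lq by simp
      ultimately have "\<bar>(y - q) \<bullet> w\<bar> \<le> \<eta> * norm (y - q)" by linarith
      also have "\<dots> \<le> \<eta> * d" using yq \<eta> by (intro mult_left_mono) auto
      finally show "y \<in> {y\<in>ball q d. \<bar>(y - q) \<bullet> w\<bar> \<le> \<eta> * d}" using y by simp
    qed
    then show "\<exists>d>0. d \<le> r \<and> (\<exists>U. N \<inter> ball q d \<subseteq> U \<and> U \<in> lmeasurable \<and> measure lebesgue U < \<epsilon> * measure lebesgue (ball q d))"
      using d(1,2) slab[OF d(1)] by blast
  qed
  then have "hausdorff_outer DIM('a) (lift ` N) = 0"
    using NB bounded_subset bounded_cball lipN by (intro hausdorff_outer_lipschitz_image_negligible) blast+
  then show ?thesis by (simp add: E_lift)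
qed

end

lemma hausdorff_null_transversal:
  fixes \<Omega> :: "'a::euclidean_space set" and E :: "('a \<times> real) set"
  assumes op: "open \<Omega>" and bd: "bounded \<Omega>" and C2: "C2_boundary \<Omega>"
    and E: "E \<subseteq> frontier \<Omega> \<times> {0..1}"
    and tang: "\<And>z. z \<in> E \<Longrightarrow> \<exists>v. snd v \<noteq> 0 \<and> ((\<lambda>y. ((y - z) \<bullet> v) / norm (y - z)) \<longlongrightarrow> 0) (at z within E)"
  shows "hausdorff_outer DIM('a) E = 0"
proof -
  have cf: "compact (frontier \<Omega>)" using bd by (simp add: compact_frontier_bounded)
  have bE: "bounded E"
    by (rule bounded_subset[OF bounded_Times E]) (use cf compact_imp_bounded in auto)
  have "\<exists>e F gF U. C1_chart e F gF \<Omega> U \<and> x \<in> U" if "x \<in> frontier \<Omega>" for x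
    using C2_boundary_chart[OF C2 that] .
  then obtain U where U: "\<And>x. x \<in> frontier \<Omega> \<Longrightarrow> x \<in> U x" "\<And>x. x \<in> frontier \<Omega> \<Longrightarrow> \<exists>e F gF. C1_chart e F gF \<Omega> (U x)"
    by metis
  have "\<And>x. x \<in> frontier \<Omega> \<Longrightarrow> open (U x)" using U(2) C1_chart.open_U by blast
  then obtain D where D: "D \<subseteq> frontier \<Omega>" "finite D" "frontier \<Omega> \<subseteq> (\<Union>x\<in>D. U x)"
    using compactE_image[OF cf, of "frontier \<Omega>" U] U(1) by blast
  have "hausdorff_outer DIM('a) (E \<inter> fst -` U x) = 0" if x: "x \<in> D" for x
  proof -
    obtain e F gF where "C1_chart e F gF \<Omega> (U x)" using U(2) D x by blast
    then show ?thesis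
    proof (rule C1_chart.hausdorff_null_transversal_chart[OF _ op])
      show "fst ` (E \<inter> fst -` U x) \<subseteq> U x \<inter> frontier \<Omega>" using E by auto
      show "bounded (E \<inter> fst -` U x)" using bE by (rule bounded_subset) auto
      fix z assume "z \<in> E \<inter> fst -` U x"
      with tang obtain v where "snd v \<noteq> 0" "((\<lambda>y. ((y - z) \<bullet> v) / norm (y - z)) \<longlongrightarrow> 0) (at z within E)" by blast
      then show "\<exists>v. snd v \<noteq> 0 \<and> ((\<lambda>y. ((y - z) \<bullet> v) / norm (y - z)) \<longlongrightarrow> 0) (at z within E \<inter> fst -` U x)"
        by (meson tendsto_within_subset inf_le1)
    qed
  qed
  then have "hausdorff_outer DIM('a) (\<Union>x\<in>D. E \<inter> fst -` U x) = 0"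
    using D(2) by (intro hausdorff_outer_zero_UN)
  moreover have "E \<subseteq> (\<Union>x\<in>D. E \<inter> fst -` U x)" using E D(3) by force
  ultimately show ?thesis by (rule hausdorff_outer_zero_subset)
qed

section \<open>Integrating directional derivatives\<close>

text \<open>All divergence theorems below are reduced to one fact: the integral of the difference quotients of a
  function with bounded support vanishes.\<close>

lemma integral_lborel_translate:
  fixes f :: "'a::euclidean_space \<Rightarrow> real"
  assumes [measurable]: "f \<in> borel_measurable borel"
  shows "(LINT y|lborel. f (y + c)) = (LINT y|lborel. f y)"
proof -
  have "(LINT y|lborel. f y) = (LINT y|distr lborel borel ((+) c). f y)" by (simp add: lborel_distr_plus)
  also have "\<dots> = (LINT y|lborel. f (c + y))" by (rule integral_distr) auto
  finally show ?thesis by (simp add: add.commute)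
qed

lemma integrable_lborel_bounded_support:
  fixes f :: "'a::euclidean_space \<Rightarrow> 'b::{banach,second_countable_topology}"
  assumes "f \<in> borel_measurable borel" and "\<And>y. norm (f y) \<le> B" and "\<And>y. norm y > R \<Longrightarrow> f y = 0"
  shows "integrable lborel f"
proof (rule integrableI_bounded_set[where A="cball 0 R" and B=B])
  show "emeasure lborel (cball (0::'a) R) < \<infinity>"
    using emeasure_bounded_finite[OF bounded_cball] by (simp add: top.not_eq_extremum)
qed (use assms in \<open>auto simp: not_le\<close>)

lemma bounded_support_imp_bounded:
  fixes f :: "'a::euclidean_space \<Rightarrow> 'b::real_normed_vector"
  assumes "continuous_on UNIV f" "\<And>y. norm y > R \<Longrightarrow> f y = 0"
  obtains B where "B \<ge> 0" "\<And>y. norm (f y) \<le> B"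
proof -
  have "compact (f ` cball 0 R)"
    by (intro compact_continuous_image continuous_on_subset[OF assms(1)]) auto
  then obtain B where B: "B > 0" "\<And>y. y \<in> cball 0 R \<Longrightarrow> norm (f y) \<le> B"
    using compact_imp_bounded bounded_pos by (metis imageI)
  have "norm (f y) \<le> B" for y
    using B assms(2)[of y] by (cases "norm y \<le> R") auto
  then show ?thesis using that B by (metis less_imp_le)
qed

text \<open>The difference quotients \<open>f m\<close> have integral \<open>0\<close> by translation invariance; the Lipschitz bound along
  \<open>v\<close> allows dominated convergence. The derivative is taken almost everywhere because \<open>G\<close> will have
  kinks or jumps along hyperplanes.\<close>

lemma integral_directional_derivative_eq_0:
  fixes G D :: "'a::euclidean_space \<Rightarrow> real"
  assumes G[measurable]: "G \<in> borel_measurable borel" and D[measurable]: "D \<in> borel_measurable borel"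
    and bound: "\<And>y. \<bar>G y\<bar> \<le> B" and supp: "\<And>y. norm y > R \<Longrightarrow> G y = 0"
    and lip: "\<And>y s. \<bar>G (y + s *\<^sub>R v) - G y\<bar> \<le> L * \<bar>s\<bar>"
    and der: "AE y in lborel. ((\<lambda>s. G (y + s *\<^sub>R v)) has_real_derivative D y) (at 0)"
  shows "(LINT y|lborel. D y) = 0"
proof -
  define f where "f m y = real (Suc m) * (G (y + (1 / real (Suc m)) *\<^sub>R v) - G y)" for m y
  have fm[measurable]: "f m \<in> borel_measurable borel" for m unfolding f_def by measurable
  have "(\<lambda>m. LINT y|lborel. f m y) \<longlonglongrightarrow> (LINT y|lborel. D y)"
  proof (rule integral_dominated_convergence[where w="\<lambda>y. L * indicator (cball 0 (R + norm v)) y"])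
    show "integrable lborel (\<lambda>y::'a. L * indicator (cball 0 (R + norm v)) y :: real)"
      by (intro integrable_mult_right integrable_real_indicator)
        (use emeasure_bounded_finite[OF bounded_cball, of "0::'a" "R + norm v"] in simp_all)
    show "AE y in lborel. (\<lambda>m. f m y) \<longlonglongrightarrow> D y"
      using der
    proof eventually_elim
      case (elim y)
      then have "((\<lambda>s. (G (y + s *\<^sub>R v) - G y) / s) \<longlongrightarrow> D y) (at 0)"
        by (simp add: has_field_derivative_iff)
      moreover have "filterlim (\<lambda>m. 1 / real (Suc m)) (at 0) sequentially"
        by (intro filterlim_atI LIMSEQ_Suc[OF lim_1_over_n]) auto
      ultimately have "(\<lambda>m. (G (y + (1 / real (Suc m)) *\<^sub>R v) - G y) / (1 / real (Suc m))) \<longlonglongrightarrow> D y"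
        by (rule filterlim_compose)
      then show ?case by (simp add: f_def mult.commute)
    qed
    show "AE y in lborel. norm (f m y) \<le> L * indicator (cball 0 (R + norm v)) y" for m
    proof (rule AE_I2)
      fix y :: 'a
      show "norm (f m y) \<le> L * indicator (cball 0 (R + norm v)) y"
      proof (cases "norm y \<le> R + norm v")
        case True
        have "\<bar>f m y\<bar> = real (Suc m) * \<bar>G (y + (1 / real (Suc m)) *\<^sub>R v) - G y\<bar>"
          by (simp add: f_def abs_mult)
        also have "\<dots> \<le> real (Suc m) * (L * \<bar>1 / real (Suc m)\<bar>)" by (intro mult_left_mono lip) auto
        also have "\<dots> = L" by simp
        finally show ?thesis using True by simp
      next
        case False
        have "norm ((1 / real (Suc m)) *\<^sub>R v) = norm v / real (Suc m)" by simp
        also have "\<dots> \<le> norm v / 1" by (intro divide_left_mono) auto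
        finally have "norm ((1 / real (Suc m)) *\<^sub>R v) \<le> norm v" by simp
        then have "norm (y + (1 / real (Suc m)) *\<^sub>R v) > R"
          using False norm_triangle_ineq4[of "y + (1 / real (Suc m)) *\<^sub>R v" "(1 / real (Suc m)) *\<^sub>R v"] by simp
        moreover have "norm y > R" using False norm_ge_zero[of v] by linarith
        ultimately have "f m y = 0" by (simp add: f_def supp)
        then show ?thesis using False by simp
      qed
    qed
  qed auto
  moreover have "(LINT y|lborel. f m y) = 0" for m
  proof -
    have i1: "integrable lborel G" by (rule integrable_lborel_bounded_support) (use bound supp in auto)
    have "integrable lborel (\<lambda>y. G (y + (1 / real (Suc m)) *\<^sub>R v))"
    proof (rule integrable_lborel_bounded_support[where B=B and R="R + norm ((1 / real (Suc m)) *\<^sub>R v)"])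
      fix y :: 'a assume "norm y > R + norm ((1 / real (Suc m)) *\<^sub>R v)"
      then have "norm (y + (1 / real (Suc m)) *\<^sub>R v) > R"
        using norm_triangle_ineq4[of "y + (1 / real (Suc m)) *\<^sub>R v" "(1 / real (Suc m)) *\<^sub>R v"] by simp
      then show "G (y + (1 / real (Suc m)) *\<^sub>R v) = 0" by (rule supp)
    qed (use bound in auto)
    with i1 show ?thesis unfolding f_def
      by (simp only: Bochner_Integration.integral_mult_right_zero Bochner_Integration.integral_diff integral_lborel_translate[OF G]) simp
  qed
  ultimately have "(\<lambda>m. 0) \<longlonglongrightarrow> (LINT y|lborel. D y)" by simp
  then show ?thesis using LIMSEQ_unique tendsto_const by blast
qed

lemma directional_lipschitz:
  fixes G D :: "'a::euclidean_space \<Rightarrow> real"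
  assumes der: "\<And>y. ((\<lambda>s. G (y + s *\<^sub>R v)) has_real_derivative D y) (at 0)" and L: "\<And>y. \<bar>D y\<bar> \<le> L"
  shows "\<bar>G (y + s *\<^sub>R v) - G (y + t *\<^sub>R v)\<bar> \<le> L * \<bar>s - t\<bar>"
proof -
  have d: "((\<lambda>s. G (y + s *\<^sub>R v)) has_real_derivative D (y + r *\<^sub>R v)) (at r)" for r
  proof -
    have "((\<lambda>s. G ((y + r *\<^sub>R v) + (s - r) *\<^sub>R v)) has_real_derivative D (y + r *\<^sub>R v)) (at r)"
      using DERIV_shift[of "\<lambda>s. G ((y + r *\<^sub>R v) + s *\<^sub>R v)" "D (y + r *\<^sub>R v)" r "- r"] der[of "y + r *\<^sub>R v"] by simp
    then show ?thesis by (simp add: algebra_simps)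
  qed
  have "norm (G (y + s *\<^sub>R v) - G (y + t *\<^sub>R v)) \<le> L * norm (s - t)"
    by (rule field_differentiable_bound[of UNIV "\<lambda>s. G (y + s *\<^sub>R v)" "\<lambda>r. D (y + r *\<^sub>R v)"])
      (use d L in auto)
  then show ?thesis by simp
qed

lemma integral_directional_derivative_eq_0':
  fixes G D :: "'a::euclidean_space \<Rightarrow> real"
  assumes G: "continuous_on UNIV G" and D: "continuous_on UNIV D"
    and supp: "\<And>y. norm y > R \<Longrightarrow> G y = 0" "\<And>y. norm y > R \<Longrightarrow> D y = 0"
    and der: "\<And>y. ((\<lambda>s. G (y + s *\<^sub>R v)) has_real_derivative D y) (at 0)"
  shows "(LINT y|lborel. D y) = 0"
proof -
  obtain L where L: "\<And>y. norm (D y) \<le> L" using bounded_support_imp_bounded[OF D supp(2)] by blast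
  obtain B where B: "\<And>y. norm (G y) \<le> B" using bounded_support_imp_bounded[OF G supp(1)] by blast
  show ?thesis
  proof (rule integral_directional_derivative_eq_0[where G=G and v=v and L=L and B=B and R=R])
    show "\<bar>G (y + s *\<^sub>R v) - G y\<bar> \<le> L * \<bar>s\<bar>" for y s
      using directional_lipschitz[of G v D L y s 0] der L by simp
  qed (use G D B supp der borel_measurable_continuous_onI in auto)
qed

lemma mixed_difference_mean_value:
  fixes f :: "'a::real_normed_vector \<Rightarrow> real"
  assumes 1: "\<And>y. ((\<lambda>s. f (y + s *\<^sub>R b)) has_real_derivative fb y) (at 0)"
    and 2: "\<And>y. ((\<lambda>s. fb (y + s *\<^sub>R c)) has_real_derivative fbc y) (at 0)" and h: "h > 0"
  shows "\<exists>r s. 0 < r \<and> r < h \<and> 0 < s \<and> s < h \<and>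
     f (x + h *\<^sub>R b + h *\<^sub>R c) - f (x + h *\<^sub>R b) - f (x + h *\<^sub>R c) + f x = h * h * fbc (x + r *\<^sub>R b + s *\<^sub>R c)"
proof -
  have d1: "((\<lambda>s. f (y + s *\<^sub>R b)) has_real_derivative fb (y + r *\<^sub>R b)) (at r)" for y r
    using DERIV_shift[of "\<lambda>s. f ((y + r *\<^sub>R b) + s *\<^sub>R b)" "fb (y + r *\<^sub>R b)" r "- r"] 1[of "y + r *\<^sub>R b"]
    by (simp add: algebra_simps)
  have d2: "((\<lambda>s. fb (y + s *\<^sub>R c)) has_real_derivative fbc (y + r *\<^sub>R c)) (at r)" for y r
    using DERIV_shift[of "\<lambda>s. fb ((y + r *\<^sub>R c) + s *\<^sub>R c)" "fbc (y + r *\<^sub>R c)" r "- r"] 2[of "y + r *\<^sub>R c"]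
    by (simp add: algebra_simps)
  let ?g = "\<lambda>s. f (x + h *\<^sub>R c + s *\<^sub>R b) - f (x + s *\<^sub>R b)"
  have "\<exists>r>0. r < h \<and> ?g h - ?g 0 = (h - 0) * (fb (x + h *\<^sub>R c + r *\<^sub>R b) - fb (x + r *\<^sub>R b))"
    using h by (intro MVT2) (auto intro!: derivative_eq_intros d1)
  then obtain r where r: "0 < r" "r < h" "?g h - ?g 0 = h * (fb (x + h *\<^sub>R c + r *\<^sub>R b) - fb (x + r *\<^sub>R b))" by auto
  let ?k = "\<lambda>s. fb (x + r *\<^sub>R b + s *\<^sub>R c)"
  have "\<exists>s>0. s < h \<and> ?k h - ?k 0 = (h - 0) * fbc (x + r *\<^sub>R b + s *\<^sub>R c)"
    using h by (intro MVT2) (auto intro!: derivative_eq_intros d2)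
  then obtain s where s: "0 < s" "s < h" "?k h - ?k 0 = h * fbc (x + r *\<^sub>R b + s *\<^sub>R c)" by auto
  have "?g h - ?g 0 = h * (?k h - ?k 0)" using r(3) by (simp add: algebra_simps)
  with s(3) have "?g h - ?g 0 = h * h * fbc (x + r *\<^sub>R b + s *\<^sub>R c)" by simp
  then show ?thesis using r(1,2) s(1,2) by (intro exI[of _ r] exI[of _ s]) (simp add: algebra_simps)
qed

text \<open>Clairaut's theorem: the second mixed difference is symmetric in \<open>b\<close> and \<open>c\<close>, and by the mean value
  theorem both mixed derivatives approximate it.\<close>

lemma mixed_derivatives_commute:
  fixes f :: "'a::real_normed_vector \<Rightarrow> real"
  assumes 1: "\<And>y. ((\<lambda>s. f (y + s *\<^sub>R b)) has_real_derivative fb y) (at 0)"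
    and 2: "\<And>y. ((\<lambda>s. fb (y + s *\<^sub>R c)) has_real_derivative fbc y) (at 0)"
    and 3: "\<And>y. ((\<lambda>s. f (y + s *\<^sub>R c)) has_real_derivative fc y) (at 0)"
    and 4: "\<And>y. ((\<lambda>s. fc (y + s *\<^sub>R b)) has_real_derivative fcb y) (at 0)"
    and cont: "isCont fbc x" "isCont fcb x"
  shows "fbc x = fcb x"
proof (rule ccontr)
  assume "fbc x \<noteq> fcb x"
  define \<epsilon> where "\<epsilon> = \<bar>fbc x - fcb x\<bar> / 2"
  have \<epsilon>: "\<epsilon> > 0" using \<open>fbc x \<noteq> fcb x\<close> by (simp add: \<epsilon>_def)
  obtain d1 where d1: "d1 > 0" "\<And>y. dist y x < d1 \<Longrightarrow> dist (fbc y) (fbc x) < \<epsilon>"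
    using cont(1) \<epsilon> unfolding continuous_at_eps_delta by metis
  obtain d2 where d2: "d2 > 0" "\<And>y. dist y x < d2 \<Longrightarrow> dist (fcb y) (fcb x) < \<epsilon>"
    using cont(2) \<epsilon> unfolding continuous_at_eps_delta by metis
  define h where "h = min d1 d2 / (norm b + norm c + 1)"
  have den: "norm b + norm c + 1 > 0" by (simp add: add_nonneg_pos)
  have h: "h > 0" using d1 d2 den by (simp add: h_def)
  have near: "dist (x + r *\<^sub>R b' + s *\<^sub>R c') x < min d1 d2"
    if "0 < r" "r < h" "0 < s" "s < h" "norm b' + norm c' = norm b + norm c" for r s b' c'
  proof -
    have "dist (x + r *\<^sub>R b' + s *\<^sub>R c') x = norm (r *\<^sub>R b' + s *\<^sub>R c')" by (simp add: dist_norm)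
    also have "\<dots> \<le> r * norm b' + s * norm c'" using norm_triangle_ineq[of "r *\<^sub>R b'" "s *\<^sub>R c'"] that by simp
    also have "\<dots> \<le> h * norm b' + h * norm c'" using that by (intro add_mono mult_right_mono) auto
    also have "\<dots> = h * (norm b + norm c)" using that(5) by (simp add: distrib_left[symmetric])
    also have "\<dots> < h * (norm b + norm c + 1)" using h by simp
    also have "\<dots> = min d1 d2" using den by (simp add: h_def)
    finally show ?thesis .
  qed
  obtain r s where rs: "0 < r" "r < h" "0 < s" "s < h" and
    e1: "f (x + h *\<^sub>R b + h *\<^sub>R c) - f (x + h *\<^sub>R b) - f (x + h *\<^sub>R c) + f x = h * h * fbc (x + r *\<^sub>R b + s *\<^sub>R c)"
    using mixed_difference_mean_value[OF 1 2 h, of x] by blast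
  obtain r' s' where rs': "0 < r'" "r' < h" "0 < s'" "s' < h" and
    e2: "f (x + h *\<^sub>R c + h *\<^sub>R b) - f (x + h *\<^sub>R c) - f (x + h *\<^sub>R b) + f x = h * h * fcb (x + r' *\<^sub>R c + s' *\<^sub>R b)"
    using mixed_difference_mean_value[OF 3 4 h, of x] by blast
  have "x + h *\<^sub>R c + h *\<^sub>R b = x + h *\<^sub>R b + h *\<^sub>R c" by (simp add: algebra_simps)
  then have "f (x + h *\<^sub>R c + h *\<^sub>R b) = f (x + h *\<^sub>R b + h *\<^sub>R c)" by (rule arg_cong)
  with e1 e2 have "h * h * fbc (x + r *\<^sub>R b + s *\<^sub>R c) = h * h * fcb (x + r' *\<^sub>R c + s' *\<^sub>R b)"
    by linarith
  then have "fbc (x + r *\<^sub>R b + s *\<^sub>R c) = fcb (x + r' *\<^sub>R c + s' *\<^sub>R b)" using h by simp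
  moreover have "dist (fbc (x + r *\<^sub>R b + s *\<^sub>R c)) (fbc x) < \<epsilon>" using near[OF rs, of b c] d1 by simp
  moreover have "dist (fcb (x + r' *\<^sub>R c + s' *\<^sub>R b)) (fcb x) < \<epsilon>" using near[OF rs', of c b] d2 by simp
  ultimately have "\<bar>fbc x - fcb x\<bar> < 2 * \<epsilon>" unfolding dist_real_def by linarith
  then show False by (simp add: \<epsilon>_def)
qed

section \<open>The divergence theorem below a graph\<close>

lemma GDERIV_directional:
  "GDERIV g y :> D \<Longrightarrow> ((\<lambda>s. g (y + s *\<^sub>R v)) has_real_derivative D \<bullet> v) (at 0)"
proof -
  assume "GDERIV g y :> D"
  then have "(g has_derivative (\<lambda>h. h \<bullet> D)) (at (y + 0 *\<^sub>R v))" by (simp add: gderiv_def)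
  moreover have "((\<lambda>s. y + s *\<^sub>R v) has_derivative (\<lambda>s. s *\<^sub>R v)) (at 0)"
    by (auto intro!: derivative_eq_intros)
  ultimately have "((\<lambda>s. g (y + s *\<^sub>R v)) has_derivative (\<lambda>s. (s *\<^sub>R v) \<bullet> D)) (at 0)"
    using diff_chain_at[of "\<lambda>s. y + s *\<^sub>R v" "\<lambda>s. s *\<^sub>R v" 0 g "\<lambda>h. h \<bullet> D"] by (simp add: o_def)
  then show ?thesis unfolding has_field_derivative_def
    by (rule has_derivative_eq_rhs) (auto simp: fun_eq_iff inner_commute)
qed

lemma AE_lborel_hyperplane: "e \<noteq> 0 \<Longrightarrow> AE y in lborel. y \<bullet> e \<noteq> (c::real)" for e :: "'a::euclidean_space"
proof -
  assume "e \<noteq> 0"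
  then have "negligible {y. e \<bullet> y = c}" by (intro negligible_hyperplane) auto
  then have "{y. e \<bullet> y = c} \<in> null_sets lebesgue" by (simp add: negligible_iff_null_sets)
  moreover have "{y. e \<bullet> y = c} \<in> sets lborel"
    unfolding sets_lborel by (intro borel_closed closed_hyperplane)
  ultimately have "{y. e \<bullet> y = c} \<in> null_sets lborel"
    by (simp add: null_sets_def)
  then show ?thesis by (rule AE_I') (auto simp: inner_commute)
qed

context C1_graph begin

text \<open>The slab \<open>{0 < y \<bullet> e < 1}\<close> has thickness \<open>1\<close>, so integrating a function of \<open>prp y\<close> over it amounts to
  integrating over the hyperplane \<open>e\<^sup>\<bottom>\<close>.\<close>

definition strip :: "'a set" where "strip = {y. 0 < y \<bullet> e \<and> y \<bullet> e < 1}"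

lemma strip_borel [measurable]: "strip \<in> sets borel"
  unfolding strip_def by (intro borel_open open_Collect_conj open_Collect_less continuous_intros)

lemma lower_borel [measurable]: "{y. y \<bullet> e < 0} \<in> sets borel"
  by (intro borel_open open_Collect_less continuous_intros)

lemma prp_borel [measurable]: "prp \<in> borel_measurable borel"
  by (intro borel_measurable_continuous_onI continuous_prp continuous_on_id)

lemma norm_le_prp: "norm y \<le> norm (prp y) + \<bar>y \<bullet> e\<bar>"
  using norm_triangle_ineq[of "prp y" "(y \<bullet> e) *\<^sub>R e"] norm_e by (simp add: prp_split[symmetric])

text \<open>Beyond the hyperplane, \<open>G\<close> is replaced by the linear interpolation between its boundary values and \<open>0\<close>.
  The result \<open>H\<close> is Lipschitz along \<open>e\<close>, with derivative \<open>D\<close> below the hyperplane and \<open>- G (prp y)\<close> in the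
  strip, and the integral of this derivative vanishes.\<close>

lemma integral_lower_halfspace_normal:
  fixes G D :: "'a \<Rightarrow> real"
  assumes G: "continuous_on UNIV G" and D: "continuous_on UNIV D"
    and supp: "\<And>y. norm y > R \<Longrightarrow> G y = 0" "\<And>y. norm y > R \<Longrightarrow> D y = 0"
    and der: "\<And>y. ((\<lambda>s. G (y + s *\<^sub>R e)) has_real_derivative D y) (at 0)"
  shows "(LINT y|lborel. indicator {y. y \<bullet> e < 0} y * D y) = (LINT y|lborel. indicator strip y * G (prp y))"
proof -
  obtain L where L: "L \<ge> 0" "\<And>y. norm (D y) \<le> L" using bounded_support_imp_bounded[OF D supp(2)] by blast
  obtain B where B: "B \<ge> 0" "\<And>y. norm (G y) \<le> B" using bounded_support_imp_bounded[OF G supp(1)] by blast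
  have Gm[measurable]: "G \<in> borel_measurable borel" "D \<in> borel_measurable borel"
    using G D by (auto intro: borel_measurable_continuous_onI)
  define H where "H y = G (prp y + min (y \<bullet> e) 0 *\<^sub>R e) - G (prp y) * max 0 (min 1 (y \<bullet> e))" for y
  define DH where "DH y = indicator {y. y \<bullet> e < 0} y * D y - indicator strip y * G (prp y)" for y
  have "(LINT y|lborel. DH y) = 0"
  proof (rule integral_directional_derivative_eq_0[where G=H and v=e and L="L + B" and B="B + B" and R="R + 1"])
    show "H \<in> borel_measurable borel"
      unfolding H_def
      by (intro borel_measurable_continuous_onI continuous_intros continuous_on_compose2[OF G]) auto
    show "DH \<in> borel_measurable borel" unfolding DH_def by measurable
    show "\<bar>H y\<bar> \<le> B + B" for y
    proof -
      have "\<bar>G (prp y) * max 0 (min 1 (y \<bullet> e))\<bar> \<le> B * 1"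
        unfolding abs_mult using B by (intro mult_mono) auto
      then show ?thesis unfolding H_def using B(2)[of "prp y + min (y \<bullet> e) 0 *\<^sub>R e"] unfolding real_norm_def by linarith
    qed
    show "H y = 0" if y: "norm y > R + 1" for y
    proof (cases "y \<bullet> e < 0")
      case True
      then have "H y = G y" using prp_split[of y] by (simp add: H_def)
      then show ?thesis using supp(1)[of y] y by simp
    next
      case False
      show ?thesis
      proof (cases "y \<bullet> e < 1")
        case True
        then have "norm (prp y) > R" using norm_le_prp[of y] y False by simp
        then show ?thesis using False by (simp add: H_def supp(1))
      next
        case F: False
        then show ?thesis using False by (simp add: H_def)
      qed
    qed
    show "\<bar>H (y + s *\<^sub>R e) - H y\<bar> \<le> (L + B) * \<bar>s\<bar>" for y s
    proof -
      have "\<bar>G (prp y + min (y \<bullet> e + s) 0 *\<^sub>R e) - G (prp y + min (y \<bullet> e) 0 *\<^sub>R e)\<bar> \<le> L * \<bar>min (y \<bullet> e + s) 0 - min (y \<bullet> e) 0\<bar>"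
        using directional_lipschitz[of G e D L] der L by simp
      also have "\<dots> \<le> L * \<bar>s\<bar>" using L by (intro mult_left_mono) auto
      finally have 1: "\<bar>G (prp y + min (y \<bullet> e + s) 0 *\<^sub>R e) - G (prp y + min (y \<bullet> e) 0 *\<^sub>R e)\<bar> \<le> L * \<bar>s\<bar>" .
      have "\<bar>G (prp y) * (max 0 (min 1 (y \<bullet> e + s)) - max 0 (min 1 (y \<bullet> e)))\<bar> \<le> B * \<bar>s\<bar>"
        unfolding abs_mult using B by (intro mult_mono) auto
      then have 2: "\<bar>G (prp y) * max 0 (min 1 (y \<bullet> e + s)) - G (prp y) * max 0 (min 1 (y \<bullet> e))\<bar> \<le> B * \<bar>s\<bar>"
        by (simp add: right_diff_distrib)
      have "H (y + s *\<^sub>R e) - H y = (G (prp y + min (y \<bullet> e + s) 0 *\<^sub>R e) - G (prp y + min (y \<bullet> e) 0 *\<^sub>R e))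
          - (G (prp y) * max 0 (min 1 (y \<bullet> e + s)) - G (prp y) * max 0 (min 1 (y \<bullet> e)))"
        by (simp add: H_def inner_add_left)
      then show ?thesis using 1 2 unfolding distrib_right by linarith
    qed
    have ne: "e \<noteq> 0" using norm_e by auto
    show "AE y in lborel. ((\<lambda>s. H (y + s *\<^sub>R e)) has_real_derivative DH y) (at 0)"
      using AE_lborel_hyperplane[OF ne, of 0] AE_lborel_hyperplane[OF ne, of 1]
    proof eventually_elim
      case (elim y)
      define a where "a = y \<bullet> e"
      have Hs: "H (y + s *\<^sub>R e) = G (prp y + min (a + s) 0 *\<^sub>R e) - G (prp y) * max 0 (min 1 (a + s))" for s
        by (simp add: H_def a_def inner_add_left)
      consider "a < 0" | "0 < a" "a < 1" | "1 < a" using elim unfolding a_def by linarith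
      then show ?case
      proof cases
        case 1
        have "((\<lambda>s. G (y + s *\<^sub>R e)) has_real_derivative D y) (at 0)" by (rule der)
        moreover have "open {s. a + s < 0}" by (intro open_Collect_less continuous_intros)
        moreover have "G (y + s *\<^sub>R e) = H (y + s *\<^sub>R e)" if "s \<in> {s. a + s < 0}" for s
        proof -
          have "y + s *\<^sub>R e = prp y + (a + s) *\<^sub>R e" using prp_split[of y] by (simp add: a_def algebra_simps)
          then show ?thesis using that unfolding Hs by simp
        qed
        ultimately have "((\<lambda>s. H (y + s *\<^sub>R e)) has_real_derivative D y) (at 0)"
          using 1 DERIV_cong_ev[of 0 0 _ _ "D y" "D y"]
          by (elim has_field_derivative_transform_within_open) auto
        then show ?thesis using 1 by (simp add: DH_def strip_def a_def)
      next
        case 2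
        have "((\<lambda>s. G (prp y) - G (prp y) * (a + s)) has_real_derivative - G (prp y)) (at 0)"
          by (auto intro!: derivative_eq_intros)
        moreover have "open {s. 0 < a + s \<and> a + s < 1}"
          by (intro open_Collect_conj open_Collect_less continuous_intros)
        ultimately have "((\<lambda>s. H (y + s *\<^sub>R e)) has_real_derivative - G (prp y)) (at 0)"
          by (rule has_field_derivative_transform_within_open) (use 2 in \<open>auto simp: Hs\<close>)
        then show ?thesis using 2 by (simp add: DH_def strip_def a_def)
      next
        case 3
        have "((\<lambda>s. 0) has_real_derivative 0) (at 0)" by simp
        moreover have "open {s. 1 < a + s}"
          by (intro open_Collect_less continuous_intros)
        ultimately have "((\<lambda>s. H (y + s *\<^sub>R e)) has_real_derivative 0) (at 0)"
          by (rule has_field_derivative_transform_within_open) (use 3 in \<open>auto simp: Hs\<close>)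
        then show ?thesis using 3 by (simp add: DH_def strip_def a_def)
      qed
    qed
  qed
  moreover have "integrable lborel (\<lambda>y. indicator {y. y \<bullet> e < 0} y * D y)"
    by (rule integrable_lborel_bounded_support[where B=L and R=R])
      (use L supp in \<open>auto simp: indicator_def\<close>)
  moreover have "integrable lborel (\<lambda>y. indicator strip y * G (prp y))"
  proof (rule integrable_lborel_bounded_support[where B=B and R="R + 1"])
    fix y :: 'a assume y: "norm y > R + 1"
    show "indicator strip y * G (prp y) = 0"
    proof (cases "y \<in> strip")
      case True
      then have "norm (prp y) > R" using norm_le_prp[of y] y by (simp add: strip_def)
      then show ?thesis by (simp add: supp)
    qed simp
  qed (use B in \<open>auto simp: indicator_def\<close>)
  ultimately show ?thesis by (simp add: DH_def)
qed

lemma integral_lower_halfspace_tangential: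
  fixes G D :: "'a \<Rightarrow> real"
  assumes G: "continuous_on UNIV G" and D: "continuous_on UNIV D"
    and supp: "\<And>y. norm y > R \<Longrightarrow> G y = 0" "\<And>y. norm y > R \<Longrightarrow> D y = 0"
    and c: "c \<bullet> e = 0"
    and der: "\<And>y. ((\<lambda>s. G (y + s *\<^sub>R c)) has_real_derivative D y) (at 0)"
  shows "(LINT y|lborel. indicator {y. y \<bullet> e < 0} y * D y) = 0"
proof -
  obtain L where L: "L \<ge> 0" "\<And>y. norm (D y) \<le> L" using bounded_support_imp_bounded[OF D supp(2)] by blast
  obtain B where B: "B \<ge> 0" "\<And>y. norm (G y) \<le> B" using bounded_support_imp_bounded[OF G supp(1)] by blast
  have Gm[measurable]: "G \<in> borel_measurable borel" "D \<in> borel_measurable borel"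
    using G D by (auto intro: borel_measurable_continuous_onI)
  have shift: "indicator {y. y \<bullet> e < 0} (y + s *\<^sub>R c) = (indicator {y. y \<bullet> e < 0} y :: real)" for y s
    using c by (simp add: indicator_def inner_add_left)
  show ?thesis
  proof (rule integral_directional_derivative_eq_0[where G="\<lambda>y. indicator {y. y \<bullet> e < 0} y * G y" and v=c and L=L and B=B and R=R])
    show "\<bar>indicator {y. y \<bullet> e < 0} (y + s *\<^sub>R c) * G (y + s *\<^sub>R c) - indicator {y. y \<bullet> e < 0} y * G y\<bar> \<le> L * \<bar>s\<bar>" for y s
      unfolding shift using directional_lipschitz[of G c D L y s 0] der L by (auto simp: indicator_def)
    show "AE y in lborel. ((\<lambda>s. indicator {y. y \<bullet> e < 0} (y + s *\<^sub>R c) * G (y + s *\<^sub>R c)) has_real_derivative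
        indicator {y. y \<bullet> e < 0} y * D y) (at 0)"
      unfolding shift by (intro AE_I2 DERIV_cmult der)
  qed (use B supp in \<open>auto simp: indicator_def\<close>)
qed

end

context C1_graph begin

text \<open>A vertical displacement with countably many values is a translation on each of countably many sets
  that are invariant under vertical translations.\<close>

lemma shear_step_measure_preserving:
  fixes J :: "'a \<Rightarrow> int" and t :: "int \<Rightarrow> real"
  assumes [measurable]: "J \<in> measurable borel (count_space UNIV)"
    and inv: "\<And>y s. J (y + s *\<^sub>R e) = J y"
  shows "distr lborel borel (\<lambda>y. y + t (J y) *\<^sub>R e) = lborel"
proof (rule measure_eqI)
  have tJ[measurable]: "(\<lambda>y. t (J y)) \<in> borel_measurable borel"
    by (rule measurable_compose[OF assms(1)]) simp
  have T[measurable]: "(\<lambda>y. y + t (J y) *\<^sub>R e) \<in> borel_measurable borel" by measurable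
  fix A assume "A \<in> sets (distr lborel borel (\<lambda>y. y + t (J y) *\<^sub>R e))"
  then have A[measurable]: "A \<in> sets borel" by simp
  let ?X = "\<lambda>j. {y. J y = j \<and> y + t j *\<^sub>R e \<in> A}" and ?Y = "\<lambda>j. {y. J y = j \<and> y \<in> A}"
  have Y[measurable]: "?Y j \<in> sets borel" for j by measurable
  have X: "?X j \<in> sets borel" for j by measurable
  have tr: "emeasure lborel (?X j) = emeasure lborel (?Y j)" for j
  proof -
    have "emeasure lborel (?Y j) = emeasure (distr lborel borel ((+) (t j *\<^sub>R e))) (?Y j)"
      by (simp add: lborel_distr_plus)
    also have "\<dots> = emeasure lborel ((+) (t j *\<^sub>R e) -` ?Y j \<inter> space lborel)"
      by (rule emeasure_distr) auto
    also have "(+) (t j *\<^sub>R e) -` ?Y j \<inter> space lborel = ?X j"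
      using inv by (auto simp: add.commute)
    finally show ?thesis by simp
  qed
  have "emeasure (distr lborel borel (\<lambda>y. y + t (J y) *\<^sub>R e)) A
      = emeasure lborel ((\<lambda>y. y + t (J y) *\<^sub>R e) -` A \<inter> space lborel)"
    by (rule emeasure_distr) auto
  also have "(\<lambda>y. y + t (J y) *\<^sub>R e) -` A \<inter> space lborel = (\<Union>j. ?X j)" by auto
  also have "emeasure lborel \<dots> = (\<integral>\<^sup>+j. emeasure lborel (?X j) \<partial>count_space UNIV)"
    using X by (intro emeasure_UN_countable) (auto simp: disjoint_family_on_def)
  also have "\<dots> = (\<integral>\<^sup>+j. emeasure lborel (?Y j) \<partial>count_space UNIV)" by (simp add: tr)
  also have "\<dots> = emeasure lborel (\<Union>j. ?Y j)"
    using Y by (intro emeasure_UN_countable[symmetric]) (auto simp: disjoint_family_on_def)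
  also have "(\<Union>j. ?Y j) = A" by auto
  finally show "emeasure (distr lborel borel (\<lambda>y. y + t (J y) *\<^sub>R e)) A = emeasure lborel A" .
qed simp

definition shear :: "'a \<Rightarrow> 'a" where "shear y = y + F y *\<^sub>R e"

lemma shear_cont: "continuous_on A shear"
  unfolding shear_def by (intro continuous_intros F_cont)

lemma height_shear [simp]: "height (shear y) = y \<bullet> e"
  by (simp add: height_def shear_def inner_add_left F_shift)

lemma F_borel [measurable]: "F \<in> borel_measurable borel"
  using F_cont by (rule borel_measurable_continuous_onI)

lemma F_bounded_cball: "\<exists>C\<ge>0. \<forall>y. norm (prp y) \<le> R \<longrightarrow> \<bar>F y\<bar> \<le> C"
proof -
  have "compact (F ` cball 0 R)" by (intro compact_continuous_image F_cont) auto
  then obtain C where C: "C > 0" "\<And>y. y \<in> cball 0 R \<Longrightarrow> \<bar>F y\<bar> \<le> C"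
    using compact_imp_bounded bounded_pos by (metis imageI real_norm_def)
  have "\<bar>F y\<bar> \<le> C" if "norm (prp y) \<le> R" for y using C(2)[of "prp y"] that by simp
  with C show ?thesis by (intro exI[of _ C]) auto
qed

text \<open>The shear by \<open>F\<close> is the limit of shears by values of \<open>F\<close> rounded down to multiples of \<open>1 / (m + 1)\<close>,
  which preserve Lebesgue measure by the previous lemma.\<close>

lemma integral_shear:
  fixes k :: "'a \<Rightarrow> real"
  assumes [measurable]: "k \<in> borel_measurable borel" and B: "\<And>y. \<bar>k y\<bar> \<le> B"
    and supp: "\<And>y. norm y > R \<Longrightarrow> k y = 0" and cont: "AE y in lborel. isCont k (shear y)"
  shows "(LINT y|lborel. k (shear y)) = (LINT y|lborel. k y)"
proof -
  have B0: "B \<ge> 0" using B[of 0] by linarith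
  define J where "J m y = \<lfloor>real (Suc m) * F y\<rfloor>" for m y
  define T where "T m y = y + (real_of_int (J m y) / real (Suc m)) *\<^sub>R e" for m y
  have J[measurable]: "J m \<in> measurable borel (count_space UNIV)" for m unfolding J_def by measurable
  have T[measurable]: "T m \<in> borel_measurable borel" for m unfolding T_def by measurable
  have sh[measurable]: "shear \<in> borel_measurable borel" using shear_cont by (rule borel_measurable_continuous_onI)
  have Jinv: "J m (y + s *\<^sub>R e) = J m y" for m y s by (simp add: J_def F_shift)
  have close: "\<bar>real_of_int (J m y) / real (Suc m) - F y\<bar> \<le> 1 / real (Suc m)" for m y
  proof -
    have "\<bar>real_of_int (J m y) - real (Suc m) * F y\<bar> \<le> 1" unfolding J_def by linarith
    then have "\<bar>real_of_int (J m y) - real (Suc m) * F y\<bar> / real (Suc m) \<le> 1 / real (Suc m)"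
      by (intro divide_right_mono) auto
    moreover have "\<bar>real_of_int (J m y) - real (Suc m) * F y\<bar> / real (Suc m) = \<bar>real_of_int (J m y) / real (Suc m) - F y\<bar>"
    proof -
      have "\<bar>a - K * b\<bar> / K = \<bar>a / K - b\<bar>" if "K > 0" for a b K :: real
        using that by (simp add: abs_div_pos diff_divide_distrib)
      then show ?thesis by simp
    qed
    ultimately show ?thesis by simp
  qed
  obtain C where C: "C \<ge> 0" "\<And>y. norm (prp y) \<le> R \<Longrightarrow> \<bar>F y\<bar> \<le> C" using F_bounded_cball by blast
  define R' where "R' = R + (R + C + 1)"
  have eq: "(LINT y|lborel. k (T m y)) = (LINT y|lborel. k y)" for m
  proof -
    have "(LINT y|lborel. k (T m y)) = (LINT y|distr lborel borel (T m). k y)"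
      by (rule integral_distr[symmetric]) auto
    also have "distr lborel borel (T m) = lborel"
      unfolding T_def using shear_step_measure_preserving[OF J Jinv, of "\<lambda>j. real_of_int j / real (Suc m)" m] by simp
    finally show ?thesis .
  qed
  have "(\<lambda>m. LINT y|lborel. k (T m y)) \<longlonglongrightarrow> (LINT y|lborel. k (shear y))"
  proof (rule integral_dominated_convergence[where w="\<lambda>y. B * indicator (cball 0 R') y"])
    show "integrable lborel (\<lambda>y::'a. B * indicator (cball 0 R') y :: real)"
      by (intro integrable_mult_right integrable_real_indicator)
        (use emeasure_bounded_finite[OF bounded_cball, of "0::'a" R'] in simp_all)
    show "AE y in lborel. (\<lambda>m. k (T m y)) \<longlonglongrightarrow> k (shear y)"
      using cont
    proof eventually_elim
      case (elim y)
      have "(\<lambda>m. real_of_int (J m y) / real (Suc m) - F y) \<longlonglongrightarrow> 0"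
        by (rule Lim_null_comparison[OF _ LIMSEQ_Suc[OF lim_1_over_n]]) (use close in auto)
      then have "(\<lambda>m. real_of_int (J m y) / real (Suc m)) \<longlonglongrightarrow> F y" by (rule LIM_zero_cancel)
      then have "(\<lambda>m. T m y) \<longlonglongrightarrow> shear y" unfolding T_def shear_def by (intro tendsto_intros)
      with elim show ?case by (rule isCont_tendsto_compose)
    qed
    show "AE y in lborel. norm (k (T m y)) \<le> B * indicator (cball 0 R') y" for m
    proof (rule AE_I2)
      fix y :: 'a
      show "norm (k (T m y)) \<le> B * indicator (cball 0 R') y"
      proof (cases "norm (T m y) > R")
        case True
        then show ?thesis using supp B0 by simp
      next
        case False
        have "prp (T m y) = prp y" by (simp add: T_def)
        then have p: "norm (prp y) \<le> R" using norm_prp_le[of "T m y"] False by simp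
        have "\<bar>T m y \<bullet> e\<bar> \<le> R" using Cauchy_Schwarz_ineq2[of "T m y" e] norm_e False by simp
        moreover have "T m y \<bullet> e = y \<bullet> e + real_of_int (J m y) / real (Suc m)" by (simp add: T_def inner_add_left)
        moreover have "1 / real (Suc m) \<le> 1" by simp
        ultimately have "\<bar>y \<bullet> e\<bar> \<le> R + C + 1" using close[of m y] C(2)[OF p] by linarith
        then have "norm y \<le> R'" using norm_le_prp[of y] p by (simp add: R'_def)
        then show ?thesis using B by simp
      qed
    qed
  qed auto
  then show ?thesis unfolding eq using LIMSEQ_unique tendsto_const by blast
qed

lemma shear_bounded_preimage: "\<exists>R'. \<forall>y. norm y > R' \<longrightarrow> norm (shear y) > R"
proof -
  obtain C where C: "C \<ge> 0" "\<And>y. norm (prp y) \<le> R \<Longrightarrow> \<bar>F y\<bar> \<le> C" using F_bounded_cball by blast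
  have "norm (shear y) > R" if "norm y > R + (R + C)" for y
  proof (rule ccontr)
    assume "\<not> norm (shear y) > R"
    moreover have "prp (shear y) = prp y" by (simp add: shear_def)
    ultimately have p: "norm (prp y) \<le> R" using norm_prp_le[of "shear y"] by simp
    have "\<bar>shear y \<bullet> e\<bar> \<le> R" using Cauchy_Schwarz_ineq2[of "shear y" e] norm_e \<open>\<not> _\<close> by simp
    moreover have "shear y \<bullet> e = y \<bullet> e + F y" by (simp add: shear_def inner_add_left)
    ultimately have "\<bar>y \<bullet> e\<bar> \<le> R + C" using C(2)[OF p] by linarith
    then show False using norm_le_prp[of y] p that by simp
  qed
  then show ?thesis by blast
qed

lemma integrable_strip:
  fixes f :: "'a \<Rightarrow> real"
  assumes f: "continuous_on UNIV f" "\<And>y. norm y > R \<Longrightarrow> f y = 0"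
  shows "integrable lborel (\<lambda>y. indicator strip y * f (prp y))"
proof -
  obtain K where K: "\<And>y. norm (f y) \<le> K" "K \<ge> 0" using bounded_support_imp_bounded[OF f] by blast
  have [measurable]: "f \<in> borel_measurable borel" using f(1) by (rule borel_measurable_continuous_onI)
  show ?thesis
  proof (rule integrable_lborel_bounded_support[where B=K and R="R + 1"])
    fix y :: 'a assume y: "norm y > R + 1"
    show "indicator strip y * f (prp y) = 0"
    proof (cases "y \<in> strip")
      case True
      then have "norm (prp y) > R" using norm_le_prp[of y] y by (simp add: strip_def)
      then show ?thesis by (simp add: f(2))
    qed simp
  qed (use K in \<open>auto simp: indicator_def\<close>)
qed

text \<open>The shear flattens the graph to the hyperplane. With \<open>H = g \<circ> shear\<close>, the chain rule gives
  \<open>(\<partial>\<^sub>b g) \<circ> shear = \<partial>\<^sub>b H - (\<partial>\<^sub>b F) \<partial>\<^sub>e H\<close>. The tangential part of \<open>b\<close> contributes nothing in the half-space, and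
  \<open>\<partial>\<^sub>b F\<close> is constant along \<open>e\<close>, so both normal derivatives integrate to boundary terms, which combine to the
  factor \<open>b \<bullet> e - \<partial>\<^sub>b F = nrm \<bullet> b\<close>.\<close>

lemma integral_below_graph:
  fixes g :: "'a \<Rightarrow> real" and g' :: "'a \<Rightarrow> 'a"
  assumes g: "\<And>y. GDERIV g y :> g' y" and g': "continuous_on UNIV g'"
    and supp: "\<And>y. norm y > R \<Longrightarrow> g y = 0"
  shows "(LINT y|lborel. indicator {y. height y < 0} y * (g' y \<bullet> b)) =
    (LINT y|lborel. indicator strip y * (g (shear (prp y)) * (nrm y \<bullet> b)))"
proof -
  have gc: "continuous_on UNIV g"
    using g by (meson continuous_at_imp_continuous_on gderiv_def has_derivative_continuous)
  have supp': "g' y = 0" if "norm y > R" for y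
  proof -
    have "open {y::'a. norm y > R}" by (intro open_Collect_less continuous_intros)
    then have "gradient g y = 0" by (rule gradient_zero_open) (use that supp in auto)
    then show ?thesis using gradient_eqI[OF g] by simp
  qed
  obtain B where B: "B \<ge> 0" "\<And>y. norm (g' y) \<le> B" using bounded_support_imp_bounded[OF g' supp'] by blast
  obtain Bg where Bg: "Bg \<ge> 0" "\<And>y. norm (g y) \<le> Bg" using bounded_support_imp_bounded[OF gc supp] by blast
  obtain R' where big: "\<And>y. norm y > R' \<Longrightarrow> norm (shear y) > R" using shear_bounded_preimage by blast
  define k where "k y = indicator {y. height y < 0} y * (g' y \<bullet> b)" for y
  have lowm: "{y. height y < 0} \<in> sets borel"
    by (intro borel_open open_Collect_less continuous_intros height_cont)
  have [measurable]: "g' \<in> borel_measurable borel" using g' by (rule borel_measurable_continuous_onI)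
  have "(LINT y|lborel. k y) = (LINT y|lborel. k (shear y))"
  proof (rule integral_shear[symmetric, where B="B * norm b" and R=R])
    show "k \<in> borel_measurable borel" unfolding k_def using lowm by measurable
    show "\<bar>k y\<bar> \<le> B * norm b" for y
    proof -
      have "\<bar>g' y \<bullet> b\<bar> \<le> norm (g' y) * norm b" by (rule Cauchy_Schwarz_ineq2)
      also have "\<dots> \<le> B * norm b" using B by (intro mult_right_mono) auto
      finally show ?thesis using B by (auto simp: k_def indicator_def)
    qed
    show "k y = 0" if "norm y > R" for y using supp'[OF that] by (simp add: k_def)
    have ne: "e \<noteq> 0" using norm_e by auto
    \<comment> \<open>The only discontinuities of \<open>k\<close> are on the graph, the image of the null set \<open>y \<bullet> e = 0\<close>.\<close>
    show "AE y in lborel. isCont k (shear y)"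
      using AE_lborel_hyperplane[OF ne, of 0]
    proof eventually_elim
      case (elim y)
      have gb: "isCont (\<lambda>z. g' z \<bullet> b) (shear y)"
        using g' by (auto intro!: continuous_intros simp: continuous_on_eq_continuous_at)
      show ?case
      proof (cases "y \<bullet> e < 0")
        case True
        have "open {z. height z < 0}" by (intro open_Collect_less continuous_intros height_cont)
        then have "\<forall>\<^sub>F z in nhds (shear y). z \<in> {z. height z < 0}" using True by (intro eventually_nhds_in_open) auto
        then have "\<forall>\<^sub>F z in nhds (shear y). k z = g' z \<bullet> b" by eventually_elim (simp add: k_def)
        from isCont_cong[OF this] gb show ?thesis by simp
      next
        case False
        have "open {z. 0 < height z}" by (intro open_Collect_less continuous_intros height_cont)
        then have "\<forall>\<^sub>F z in nhds (shear y). z \<in> {z. 0 < height z}" using False elim by (intro eventually_nhds_in_open) auto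
        then have "\<forall>\<^sub>F z in nhds (shear y). k z = 0" by eventually_elim (simp add: k_def)
        from isCont_cong[OF this] show ?thesis by simp
      qed
    qed
  qed
  also have "(\<lambda>y. k (shear y)) = (\<lambda>y. indicator {y. y \<bullet> e < 0} y * (g' (shear y) \<bullet> b))"
    by (simp add: k_def indicator_def fun_eq_iff)
  finally have step1: "(LINT y|lborel. k y) = (LINT y|lborel. indicator {y. y \<bullet> e < 0} y * (g' (shear y) \<bullet> b))" .
  define H where "H y = g (shear y)" for y
  define H' where "H' y = g' (shear y) + (g' (shear y) \<bullet> e) *\<^sub>R gF y" for y
  have H: "GDERIV H y :> H' y" for y
  proof -
    have "(shear has_derivative (\<lambda>h. h + (h \<bullet> gF y) *\<^sub>R e)) (at y)"
      unfolding shear_def by (auto intro!: derivative_eq_intros F_has_derivative)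
    moreover have "(g has_derivative (\<lambda>h. h \<bullet> g' (shear y))) (at (shear y))" using g by (simp add: gderiv_def)
    ultimately have "((\<lambda>y. g (shear y)) has_derivative (\<lambda>h. (h + (h \<bullet> gF y) *\<^sub>R e) \<bullet> g' (shear y))) (at y)"
      using diff_chain_at by (fastforce simp: o_def)
    then show ?thesis unfolding gderiv_def H_def
      by (rule has_derivative_eq_rhs) (auto simp: H'_def fun_eq_iff inner_add_left inner_add_right inner_commute)
  qed
  have Hc: "continuous_on UNIV H" unfolding H_def by (rule continuous_on_compose2[OF gc shear_cont]) auto
  have H'c: "continuous_on UNIV H'"
    unfolding H'_def by (intro continuous_intros gF_cont continuous_on_compose2[OF g' shear_cont]) auto
  have g'sc: "continuous_on UNIV (\<lambda>y. g' (shear y))" by (rule continuous_on_compose2[OF g' shear_cont]) auto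
  have Hs: "H y = 0" "H' y = 0" if "norm y > R'" for y
    using supp[OF big[OF that]] supp'[OF big[OF that]] by (auto simp: H_def H'_def)
  have T: "(LINT y|lborel. indicator {y. y \<bullet> e < 0} y * (H' y \<bullet> prp b)) = 0"
    by (rule integral_lower_halfspace_tangential[OF Hc _ Hs(1), where c="prp b"])
      (use H'c Hs GDERIV_directional[OF H] in \<open>auto intro!: continuous_intros\<close>)
  have Nn: "(LINT y|lborel. indicator {y. y \<bullet> e < 0} y * (H' y \<bullet> e)) = (LINT y|lborel. indicator strip y * H (prp y))"
    by (rule integral_lower_halfspace_normal[OF Hc _ Hs(1)])
      (use H'c Hs GDERIV_directional[OF H] in \<open>auto intro!: continuous_intros\<close>)
  define G where "G y = H y * (gF y \<bullet> b)" for y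
  have Gd: "((\<lambda>s. G (y + s *\<^sub>R e)) has_real_derivative (H' y \<bullet> e) * (gF y \<bullet> b)) (at 0)" for y
    unfolding G_def gF_shift by (intro DERIV_cmult_right GDERIV_directional[OF H])
  have Gn: "(LINT y|lborel. indicator {y. y \<bullet> e < 0} y * ((H' y \<bullet> e) * (gF y \<bullet> b))) = (LINT y|lborel. indicator strip y * G (prp y))"
  proof (rule integral_lower_halfspace_normal[where R=R'])
    show "continuous_on UNIV G" unfolding G_def by (intro continuous_intros Hc gF_cont)
    show "continuous_on UNIV (\<lambda>y. (H' y \<bullet> e) * (gF y \<bullet> b))" by (intro continuous_intros H'c gF_cont)
  qed (use Hs Gd in \<open>auto simp: G_def\<close>)
  have split: "indicator {y. y \<bullet> e < 0} y * (g' (shear y) \<bullet> b) =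
      indicator {y. y \<bullet> e < 0} y * (H' y \<bullet> prp b) + (b \<bullet> e) * (indicator {y. y \<bullet> e < 0} y * (H' y \<bullet> e))
      - indicator {y. y \<bullet> e < 0} y * ((H' y \<bullet> e) * (gF y \<bullet> b))" for y
  proof -
    have he: "H' y \<bullet> e = g' (shear y) \<bullet> e" by (simp add: H'_def inner_add_left)
    have "H' y \<bullet> b = H' y \<bullet> prp b + (b \<bullet> e) * (H' y \<bullet> e)"
      by (subst prp_split[of b]) (simp add: inner_add_right del: prp_split)
    moreover have "H' y \<bullet> b = g' (shear y) \<bullet> b + (g' (shear y) \<bullet> e) * (gF y \<bullet> b)"
      by (simp add: H'_def inner_add_left)
    ultimately have "g' (shear y) \<bullet> b = H' y \<bullet> prp b + (b \<bullet> e) * (H' y \<bullet> e) - (H' y \<bullet> e) * (gF y \<bullet> b)"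
      using he by simp
    then show ?thesis by (simp only: right_diff_distrib distrib_left mult.left_commute)
  qed
  have int: "integrable lborel (\<lambda>y. indicator {y. y \<bullet> e < 0} y * f y :: real)"
    if f: "continuous_on UNIV f" "\<And>y. norm y > R' \<Longrightarrow> f y = 0" for f
  proof -
    obtain K where "\<And>y. norm (f y) \<le> K" "K \<ge> 0" using bounded_support_imp_bounded[OF f] by blast
    moreover have [measurable]: "f \<in> borel_measurable borel" using f(1) by (rule borel_measurable_continuous_onI)
    ultimately show ?thesis
      by (intro integrable_lborel_bounded_support[where B=K and R=R']) (auto simp: indicator_def f(2))
  qed
  have i1: "integrable lborel (\<lambda>y. indicator {y. y \<bullet> e < 0} y * (H' y \<bullet> prp b))"
    by (rule int) (use H'c Hs in \<open>auto intro!: continuous_intros\<close>)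
  have i2: "integrable lborel (\<lambda>y. indicator {y. y \<bullet> e < 0} y * (H' y \<bullet> e))"
    by (rule int) (use H'c Hs in \<open>auto intro!: continuous_intros\<close>)
  have i3: "integrable lborel (\<lambda>y. indicator {y. y \<bullet> e < 0} y * ((H' y \<bullet> e) * (gF y \<bullet> b)))"
    by (rule int) (use H'c Hs gF_cont in \<open>auto intro!: continuous_intros\<close>)
  have i4: "integrable lborel (\<lambda>y. indicator strip y * H (prp y))"
    by (rule integrable_strip) (use Hc Hs in auto)
  have i5: "integrable lborel (\<lambda>y. indicator strip y * G (prp y))"
    by (rule integrable_strip) (use Hc Hs gF_cont in \<open>auto simp: G_def intro!: continuous_intros\<close>)
  have "(LINT y|lborel. k y) = 0 + (b \<bullet> e) * (LINT y|lborel. indicator strip y * H (prp y)) - (LINT y|lborel. indicator strip y * G (prp y))"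
    unfolding step1 split using i1 i2 i3 by (simp add: T Nn Gn)
  also have "\<dots> = (LINT y|lborel. (b \<bullet> e) * (indicator strip y * H (prp y)) - indicator strip y * G (prp y))"
    using i4 i5 by simp
  also have "(\<lambda>y. (b \<bullet> e) * (indicator strip y * H (prp y)) - indicator strip y * G (prp y)) =
     (\<lambda>y. indicator strip y * (g (shear (prp y)) * (nrm y \<bullet> b)))"
    by (simp add: fun_eq_iff G_def H_def nrm_def inner_diff_left algebra_simps inner_commute)
  finally show ?thesis by (simp add: k_def)
qed

end

section \<open>Continuously differentiable functions and partitions of unity\<close>

definition C1_fun :: "('a::euclidean_space \<Rightarrow> real) \<Rightarrow> bool" where
  "C1_fun g \<longleftrightarrow> (\<forall>x. GDERIV g x :> gradient g x) \<and> continuous_on UNIV (gradient g)"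

lemma C1_funI:
  assumes "\<And>x. GDERIV g x :> g' x" "continuous_on UNIV g'"
  shows "C1_fun g"
proof -
  have "gradient g = g'" using assms(1) by (auto intro: gradient_eqI)
  with assms show ?thesis by (simp add: C1_fun_def)
qed

lemma C1_fun_continuous: "C1_fun g \<Longrightarrow> continuous_on UNIV g"
  unfolding C1_fun_def gderiv_def by (meson continuous_at_imp_continuous_on has_derivative_continuous)

lemma C1_fun_const: "C1_fun (\<lambda>_. c)"
  by (rule C1_funI[of _ "\<lambda>_. 0"]) (auto intro: GDERIV_const)

lemma C1_fun_mult: "C1_fun f \<Longrightarrow> C1_fun g \<Longrightarrow> C1_fun (\<lambda>x. f x * g x)"
  by (rule C1_funI[of _ "\<lambda>x. f x *\<^sub>R gradient g x + g x *\<^sub>R gradient f x"])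
    (auto simp: C1_fun_def intro!: GDERIV_mult continuous_intros C1_fun_continuous)

lemma C1_fun_diff: "C1_fun f \<Longrightarrow> C1_fun g \<Longrightarrow> C1_fun (\<lambda>x. f x - g x)"
  by (rule C1_funI[of _ "\<lambda>x. gradient f x - gradient g x"])
    (auto simp: C1_fun_def intro!: GDERIV_diff continuous_intros)

lemma C1_fun_sum: "finite I \<Longrightarrow> (\<And>i. i \<in> I \<Longrightarrow> C1_fun (f i)) \<Longrightarrow> C1_fun (\<lambda>x. \<Sum>i\<in>I. f i x)"
proof (induction I rule: finite_induct)
  case (insert i I)
  then have "C1_fun (\<lambda>x. f i x - (0 - (\<Sum>i\<in>I. f i x)))" by (intro C1_fun_diff C1_fun_const) auto
  then show ?case using insert by simp
qed (simp add: C1_fun_const)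

lemma C1_fun_compose:
  assumes "C1_fun f" "\<And>t. (h has_real_derivative h' t) (at t)" "continuous_on UNIV h'"
  shows "C1_fun (\<lambda>x. h (f x))"
proof (rule C1_funI)
  show "GDERIV (\<lambda>x. h (f x)) x :> h' (f x) *\<^sub>R gradient f x" for x
    using assms(1,2) by (intro GDERIV_DERIV_compose) (auto simp: C1_fun_def)
  show "continuous_on UNIV (\<lambda>x. h' (f x) *\<^sub>R gradient f x)"
    using assms(1) continuous_on_compose2[OF assms(3) C1_fun_continuous[OF assms(1)]]
    by (intro continuous_intros) (auto simp: C1_fun_def)
qed

lemma DERIV_positive_part_square: "((\<lambda>t::real. (max 0 t)\<^sup>2) has_real_derivative 2 * max 0 t) (at t)"
proof -
  consider "t > 0" | "t < 0" | "t = 0" by linarith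
  then show ?thesis
  proof cases
    case 1
    have "((\<lambda>t. t\<^sup>2) has_real_derivative 2 * t) (at t)" by (auto intro!: derivative_eq_intros)
    then have "((\<lambda>t. (max 0 t)\<^sup>2) has_real_derivative 2 * t) (at t)"
      by (rule has_field_derivative_transform_within_open[OF _ open_greaterThan[of 0]]) (use 1 in auto)
    then show ?thesis using 1 by simp
  next
    case 2
    have "((\<lambda>t. 0) has_real_derivative 0) (at t)" by simp
    then have "((\<lambda>t. (max 0 t)\<^sup>2) has_real_derivative 0) (at t)"
      by (rule has_field_derivative_transform_within_open[OF _ open_lessThan[of 0]]) (use 2 in auto)
    then show ?thesis using 2 by simp
  next
    case 3
    have "((\<lambda>s. ((max 0 (0 + s))\<^sup>2 - (max 0 0)\<^sup>2) / s) \<longlongrightarrow> (0::real)) (at 0)"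
    proof (rule Lim_null_comparison)
      show "\<forall>\<^sub>F s in at (0::real). norm (((max 0 (0 + s))\<^sup>2 - (max 0 0)\<^sup>2) / s) \<le> \<bar>s\<bar>"
        by (rule always_eventually) (auto simp: max_def power2_eq_square)
      show "((\<lambda>s::real. \<bar>s\<bar>) \<longlongrightarrow> 0) (at 0)" by (intro tendsto_rabs_zero tendsto_ident_at)
    qed
    then have "((\<lambda>t::real. (max 0 t)\<^sup>2) has_real_derivative 0) (at 0)" unfolding DERIV_def by simp
    then show ?thesis using 3 by simp
  qed
qed

text \<open>With \<open>P t = (max 0 t)\<^sup>2\<close>, the function \<open>1 - P (1 - P t)\<close> is \<open>C\<^sup>1\<close>, vanishes for \<open>t \<le> 0\<close> and equals \<open>1\<close> for
  \<open>t \<ge> 1\<close>. It is composed with a quadratic polynomial that is \<open>\<ge> 1\<close> on the small and \<open>\<le> 0\<close> outside the large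
  ball.\<close>

lemma C1_cutoff:
  fixes c :: "'a::euclidean_space"
  assumes \<rho>: "\<rho> > 0"
  shows "\<exists>\<zeta>. C1_fun \<zeta> \<and> (\<forall>y. 0 \<le> \<zeta> y \<and> \<zeta> y \<le> 1) \<and> (\<forall>y\<in>ball c \<rho>. \<zeta> y = 1) \<and> (\<forall>y. y \<notin> cball c (2 * \<rho>) \<longrightarrow> \<zeta> y = 0)"
proof -
  define P where "P t = (max 0 t)\<^sup>2" for t :: real
  define q where "q y = (4 * \<rho>\<^sup>2 - (y - c) \<bullet> (y - c)) * (1 / (3 * \<rho>\<^sup>2))" for y :: 'a
  have P: "(P has_real_derivative 2 * max 0 t) (at t)" for t unfolding P_def by (rule DERIV_positive_part_square)
  have Pc: "continuous_on UNIV (\<lambda>t::real. 2 * max 0 t)" by (intro continuous_intros)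
  have "C1_fun (\<lambda>y. (y - c) \<bullet> (y - c))"
    by (rule C1_funI[of _ "\<lambda>y. 2 *\<^sub>R (y - c)"])
      (auto simp: gderiv_def inner_commute algebra_simps intro!: derivative_eq_intros continuous_intros)
  then have q: "C1_fun q" unfolding q_def by (intro C1_fun_mult C1_fun_diff C1_fun_const)
  have "C1_fun (\<lambda>y. 1 - P (1 - P (q y)))"
    by (intro C1_fun_diff C1_fun_const C1_fun_compose[OF _ P Pc] q)
  moreover have "0 \<le> P t" "t \<le> 1 \<Longrightarrow> P t \<le> 1" "t \<le> 0 \<Longrightarrow> P t = 0" "1 \<le> t \<Longrightarrow> 1 \<le> P t" for t
  proof -
    show "0 \<le> P t" "t \<le> 0 \<Longrightarrow> P t = 0" by (auto simp: P_def max_def)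
    show "P t \<le> 1" if "t \<le> 1" unfolding P_def using that by (auto simp: max_def power_le_one)
    show "1 \<le> P t" if "1 \<le> t" unfolding P_def using that by (auto simp: max_def one_le_power)
  qed
  moreover have "q y \<ge> 1" if "y \<in> ball c \<rho>" for y
  proof -
    have "norm (y - c) \<le> \<rho>" using that by (simp add: dist_norm norm_minus_commute)
    then have "(norm (y - c))\<^sup>2 \<le> \<rho>\<^sup>2" by (intro power_mono) auto
    then show ?thesis using \<rho> by (simp add: q_def power2_norm_eq_inner[symmetric] field_simps)
  qed
  moreover have "q y \<le> 0" if "y \<notin> cball c (2 * \<rho>)" for y
  proof -
    have "2 * \<rho> \<le> norm (y - c)" using that by (simp add: dist_norm norm_minus_commute)
    then have "(2 * \<rho>)\<^sup>2 \<le> (norm (y - c))\<^sup>2" using \<rho> by (intro power_mono) auto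
    then show ?thesis using \<rho> unfolding q_def power2_norm_eq_inner
      by (intro mult_nonpos_nonneg) (auto simp: power_mult_distrib)
  qed
  moreover have "P 1 = 1" by (simp add: P_def)
  ultimately show ?thesis
    by (intro exI[of _ "\<lambda>y. 1 - P (1 - P (q y))"]) simp
qed

text \<open>A new ball receives its cut-off function \<open>\<zeta>\<close>, and the functions found before are multiplied by \<open>1 - \<zeta>\<close>;
  the sum \<open>\<zeta> + (1 - \<zeta>) \<Sum> \<eta>\<close> is \<open>1\<close> wherever \<open>\<zeta>\<close> or the old sum is.\<close>

lemma C1_partition_of_unity:
  fixes \<rho> :: "'a::euclidean_space \<Rightarrow> real"
  assumes "finite D" "\<And>x. x \<in> D \<Longrightarrow> \<rho> x > 0"
  shows "\<exists>\<eta>. (\<forall>x\<in>D. C1_fun (\<eta> x) \<and> (\<forall>y. 0 \<le> \<eta> x y \<and> \<eta> x y \<le> 1) \<and> (\<forall>y. y \<notin> cball x (2 * \<rho> x) \<longrightarrow> \<eta> x y = 0)) \<and>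
     (\<forall>y\<in>(\<Union>x\<in>D. ball x (\<rho> x)). (\<Sum>x\<in>D. \<eta> x y) = 1)"
  using assms
proof (induction D rule: finite_induct)
  case (insert c D)
  then have "\<exists>\<eta>. (\<forall>x\<in>D. C1_fun (\<eta> x) \<and> (\<forall>y. 0 \<le> \<eta> x y \<and> \<eta> x y \<le> 1) \<and> (\<forall>y. y \<notin> cball x (2 * \<rho> x) \<longrightarrow> \<eta> x y = 0)) \<and>
     (\<forall>y\<in>(\<Union>x\<in>D. ball x (\<rho> x)). (\<Sum>x\<in>D. \<eta> x y) = 1)"
    by simp
  then obtain \<eta> where \<eta>: "\<And>x. x \<in> D \<Longrightarrow> C1_fun (\<eta> x)" "\<And>x y. x \<in> D \<Longrightarrow> 0 \<le> \<eta> x y \<and> \<eta> x y \<le> 1"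
     "\<And>x y. x \<in> D \<Longrightarrow> y \<notin> cball x (2 * \<rho> x) \<Longrightarrow> \<eta> x y = 0"
     and sum: "\<And>y. y \<in> (\<Union>x\<in>D. ball x (\<rho> x)) \<Longrightarrow> (\<Sum>x\<in>D. \<eta> x y) = 1"
    by (elim exE conjE) blast
  obtain \<zeta> where \<zeta>: "C1_fun \<zeta>" "\<And>y. 0 \<le> \<zeta> y \<and> \<zeta> y \<le> 1" "\<And>y. y \<in> ball c (\<rho> c) \<Longrightarrow> \<zeta> y = 1"
     "\<And>y. y \<notin> cball c (2 * \<rho> c) \<Longrightarrow> \<zeta> y = 0"
    using C1_cutoff[of "\<rho> c" c] insert.prems by blast
  define \<eta>' where "\<eta>' x y = (if x = c then \<zeta> y else (1 - \<zeta> y) * \<eta> x y)" for x y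
  have s: "(\<Sum>x\<in>insert c D. \<eta>' x y) = \<zeta> y + (1 - \<zeta> y) * (\<Sum>x\<in>D. \<eta> x y)" for y
  proof -
    have "(\<Sum>x\<in>D. \<eta>' x y) = (\<Sum>x\<in>D. (1 - \<zeta> y) * \<eta> x y)"
      by (rule sum.cong) (use insert.hyps in \<open>auto simp: \<eta>'_def\<close>)
    then show ?thesis using insert.hyps by (simp add: \<eta>'_def sum_distrib_left)
  qed
  show ?case
  proof (intro exI[of _ \<eta>'] conjI ballI allI impI)
    fix x assume x: "x \<in> insert c D"
    show "C1_fun (\<eta>' x)"
    proof (cases "x = c")
      case False
      then have "C1_fun (\<lambda>y. (1 - \<zeta> y) * \<eta> x y)" using x \<eta>(1) \<zeta>(1) by (intro C1_fun_mult C1_fun_diff C1_fun_const) auto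
      then show ?thesis using False by (simp add: \<eta>'_def[abs_def])
    next
      case True then show ?thesis using \<zeta>(1) by (simp add: \<eta>'_def[abs_def])
    qed
    fix y
    show "0 \<le> \<eta>' x y" using \<zeta>(2)[of y] \<eta>(2)[of x y] x by (auto simp: \<eta>'_def)
    show "\<eta>' x y \<le> 1" using \<zeta>(2)[of y] \<eta>(2)[of x y] x by (auto simp: \<eta>'_def intro: mult_le_one)
    assume "y \<notin> cball x (2 * \<rho> x)"
    then show "\<eta>' x y = 0" using \<zeta>(4) \<eta>(3) x by (auto simp: \<eta>'_def)
  next
    fix y assume y: "y \<in> (\<Union>x\<in>insert c D. ball x (\<rho> x))"
    show "(\<Sum>x\<in>insert c D. \<eta>' x y) = 1"
    proof (cases "y \<in> ball c (\<rho> c)")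
      case True then show ?thesis unfolding s using \<zeta>(3) by simp
    next
      case False then show ?thesis unfolding s using sum[of y] y by auto
    qed
  qed
qed auto

section \<open>The indicator of a \<open>C\<^sup>2\<close> domain is a special function of bounded variation\<close>

text \<open>Cutting \<open>k\<close> off outside \<open>\<Omega>\<close> creates no jump, since \<open>k\<close> vanishes near the boundary: locally the
  truncated function is either \<open>k\<close> or \<open>0\<close>.\<close>

lemma integral_gradient_interior:
  fixes \<Omega> :: "'a::euclidean_space set"
  assumes op: "open \<Omega>" and k: "C1_fun k" and supp: "\<And>y. norm y > R \<Longrightarrow> k y = 0"
    and V: "open V" "frontier \<Omega> \<subseteq> V" "\<And>y. y \<in> V \<Longrightarrow> k y = 0"
  shows "(LINT y|lborel. indicator \<Omega> y * (gradient k y \<bullet> b)) = 0"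
proof -
  let ?G = "\<lambda>y. indicator \<Omega> y * k y" and ?D = "\<lambda>y. indicator \<Omega> y * (gradient k y \<bullet> b)"
  have loc: "\<exists>W. open W \<and> y \<in> W \<and> ((\<forall>z\<in>W. ?G z = k z \<and> ?D z = gradient k z \<bullet> b) \<or> (\<forall>z\<in>W. ?G z = 0 \<and> ?D z = 0))" for y
  proof -
    consider "y \<in> \<Omega>" | "y \<in> V" | "y \<in> - closure \<Omega>"
      using V(2) op by (auto simp: frontier_def interior_open)
    then show ?thesis
    proof cases
      case 1 then show ?thesis using op by (intro exI[of _ \<Omega>]) auto
    next
      case 2 then show ?thesis using V gradient_zero_open[OF V(1)] by (intro exI[of _ V]) auto
    next
      case 3 then show ?thesis using closure_subset[of \<Omega>] by (intro exI[of _ "- closure \<Omega>"]) (auto simp: indicator_def)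
    qed
  qed
  have kc: "continuous_on UNIV k" using k by (rule C1_fun_continuous)
  have kD: "continuous_on UNIV (\<lambda>z. gradient k z \<bullet> b)" using k by (auto simp: C1_fun_def intro!: continuous_intros)
  show ?thesis
  proof (rule integral_directional_derivative_eq_0'[where G="?G" and v=b and R=R])
    have "isCont ?G y \<and> isCont ?D y" for y
    proof -
      obtain W where W: "open W" "y \<in> W" and or: "(\<forall>z\<in>W. ?G z = k z \<and> ?D z = gradient k z \<bullet> b) \<or> (\<forall>z\<in>W. ?G z = 0 \<and> ?D z = 0)"
        using loc by blast
      from or show ?thesis
      proof
        assume a: "\<forall>z\<in>W. ?G z = k z \<and> ?D z = gradient k z \<bullet> b"
        have "continuous_on W ?G"
          using a by (intro continuous_on_eq[OF continuous_on_subset[OF kc]]) auto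
        moreover have "continuous_on W ?D"
          using a by (intro continuous_on_eq[OF continuous_on_subset[OF kD]]) auto
        ultimately show ?thesis using W by (simp add: continuous_on_eq_continuous_at)
      next
        assume a: "\<forall>z\<in>W. ?G z = 0 \<and> ?D z = 0"
        have "continuous_on W ?G"
          using a by (intro continuous_on_eq[OF continuous_on_const[of W 0]]) auto
        moreover have "continuous_on W ?D"
          using a by (intro continuous_on_eq[OF continuous_on_const[of W 0]]) auto
        ultimately show ?thesis using W by (simp add: continuous_on_eq_continuous_at)
      qed
    qed
    then show "continuous_on UNIV ?G" "continuous_on UNIV ?D" by (auto intro: continuous_at_imp_continuous_on)
    show "?G y = 0" if "norm y > R" for y using supp that by simp
    show "?D y = 0" if "norm y > R" for y
    proof -
      have "open {y::'a. norm y > R}" by (intro open_Collect_less continuous_intros)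
      then show ?thesis using gradient_zero_open[of "{y. norm y > R}" y k] that supp by simp
    qed
    fix y
    obtain W where W: "open W" "y \<in> W" and or: "(\<forall>z\<in>W. ?G z = k z \<and> ?D z = gradient k z \<bullet> b) \<or> (\<forall>z\<in>W. ?G z = 0 \<and> ?D z = 0)"
      using loc by blast
    have oW: "open ((\<lambda>s. y + s *\<^sub>R b) -` W)" using W(1) by (intro continuous_open_vimage continuous_intros) auto
    from or show "((\<lambda>s. ?G (y + s *\<^sub>R b)) has_real_derivative ?D y) (at 0)"
    proof
      assume a: "\<forall>z\<in>W. ?G z = k z \<and> ?D z = gradient k z \<bullet> b"
      have "((\<lambda>s. k (y + s *\<^sub>R b)) has_real_derivative gradient k y \<bullet> b) (at 0)"
        using k by (intro GDERIV_directional) (simp add: C1_fun_def)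
      then have "((\<lambda>s. ?G (y + s *\<^sub>R b)) has_real_derivative gradient k y \<bullet> b) (at 0)"
        by (rule has_field_derivative_transform_within_open[OF _ oW]) (use W a in auto)
      moreover have "?D y = gradient k y \<bullet> b" using a W by blast
      ultimately show ?thesis by (simp only:)
    next
      assume a: "\<forall>z\<in>W. ?G z = 0 \<and> ?D z = 0"
      have "((\<lambda>s. 0) has_real_derivative 0) (at 0)" by simp
      then have "((\<lambda>s. ?G (y + s *\<^sub>R b)) has_real_derivative 0) (at 0)"
        by (rule has_field_derivative_transform_within_open[OF _ oW]) (use W a in auto)
      moreover have "?D y = 0" using a W by blast
      ultimately show ?thesis by (simp only:)
    qed
  qed
qed

lemma test_function_C1_fun:
  assumes "test_function_on W \<psi>" shows "C1_fun \<psi>"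
  using assms Ck_on_2_GDERIV[of UNIV \<psi>] Ck_on_2_continuous_gradient[of UNIV \<psi>]
  by (auto simp: test_function_on_def C1_fun_def)

lemma test_function_bounded_support:
  assumes "test_function_on W (\<psi> :: 'a::euclidean_space \<Rightarrow> real)"
  obtains R where "\<And>y. norm y > R \<Longrightarrow> \<psi> y = 0"
proof -
  have "bounded (closure {x. \<psi> x \<noteq> 0})" using assms by (auto simp: test_function_on_def compact_imp_bounded)
  then obtain R where R: "\<And>x. x \<in> closure {x. \<psi> x \<noteq> 0} \<Longrightarrow> norm x \<le> R" by (auto simp: bounded_iff)
  have "\<psi> y = 0" if "norm y > R" for y
    using R[of y] closure_subset[of "{x. \<psi> x \<noteq> 0}"] that by (auto simp: not_le[symmetric])
  then show ?thesis using that by blast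
qed

context C1_chart begin

lemma integral_gradient_chart:
  assumes g: "C1_fun g" and K: "closed K" "K \<subseteq> U" "\<And>y. y \<notin> K \<Longrightarrow> g y = 0"
    and supp: "\<And>y. norm y > R \<Longrightarrow> g y = 0"
  shows "(LINT y|lborel. indicator \<Omega> y * (gradient g y \<bullet> b)) =
    (LINT y|lborel. indicator strip y * (g (shear (prp y)) * (nrm y \<bullet> b)))"
proof -
  have zero: "gradient g y = 0" if "y \<notin> K" for y
    by (rule gradient_zero_open[of "- K"]) (use K that in auto)
  have "indicator \<Omega> y * (gradient g y \<bullet> b) = indicator {y. height y < 0} y * (gradient g y \<bullet> b)" for y
    using zero[of y] in_\<Omega>_iff[of y] K(2) by (cases "y \<in> K") (auto simp: indicator_def)
  then have "(LINT y|lborel. indicator \<Omega> y * (gradient g y \<bullet> b)) = (LINT y|lborel. indicator {y. height y < 0} y * (gradient g y \<bullet> b))"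
    by (intro Bochner_Integration.integral_cong refl)
  also have "\<dots> = (LINT y|lborel. indicator strip y * (g (shear (prp y)) * (nrm y \<bullet> b)))"
    by (rule integral_below_graph[where R=R]) (use g supp in \<open>auto simp: C1_fun_def\<close>)
  finally show ?thesis .
qed

end

text \<open>The sum of the image measures of \<open>w i \<cdot> lborel\<close> under \<open>p i\<close> is obtained in one stroke as the image of a
  measure on the disjoint union \<open>D \<times> 'a\<close> of the charts.\<close>

lemma finite_union_surface_measure:
  fixes p :: "'i \<Rightarrow> 'a::euclidean_space \<Rightarrow> 'a" and w :: "'i \<Rightarrow> 'a \<Rightarrow> real"
  assumes D: "finite D" and p: "\<And>i. i \<in> D \<Longrightarrow> p i \<in> borel_measurable borel"
    and w: "\<And>i. i \<in> D \<Longrightarrow> integrable lborel (w i)" "\<And>i. i \<in> D \<Longrightarrow> w i \<in> borel_measurable borel"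
      "\<And>i y. i \<in> D \<Longrightarrow> 0 \<le> w i y"
    and S: "S \<in> sets borel" "\<And>i y. i \<in> D \<Longrightarrow> w i y \<noteq> 0 \<Longrightarrow> p i y \<in> S"
  shows "\<exists>\<mu>. sets \<mu> = sets borel \<and> finite_measure \<mu> \<and> (AE x in \<mu>. x \<in> S) \<and>
    (\<forall>f :: 'a \<Rightarrow> real. f \<in> borel_measurable borel \<longrightarrow> (\<exists>B. \<forall>x. \<bar>f x\<bar> \<le> B) \<longrightarrow>
      integrable \<mu> f \<and> (LINT x|\<mu>. f x) = (\<Sum>i\<in>D. LINT y|lborel. w i y * f (p i y)))"
proof -
  let ?M = "count_space D \<Otimes>\<^sub>M (lborel :: 'a measure)"
  have meas: "(\<lambda>(i, y). h i y) \<in> borel_measurable ?M" if "\<And>i. i \<in> D \<Longrightarrow> h i \<in> borel_measurable borel"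
    for h :: "'i \<Rightarrow> 'a \<Rightarrow> 'b::topological_space"
    by (rule measurable_pair_measure_countable1) (use D that in \<open>auto simp: countable_finite\<close>)
  define q where "q = (\<lambda>(i, y). p i y)"
  define W where "W = (\<lambda>(i, y). w i y)"
  have q[measurable]: "q \<in> borel_measurable ?M" unfolding q_def by (rule meas) (rule p)
  have W[measurable]: "W \<in> borel_measurable ?M" unfolding W_def by (rule meas) (rule w(2))
  have W0: "0 \<le> W z" if "z \<in> space ?M" for z using that w(3) by (auto simp: W_def space_pair_measure)
  define \<mu> where "\<mu> = distr (density ?M (\<lambda>z. ennreal (W z))) borel q"
  have sets: "sets \<mu> = sets borel" by (simp add: \<mu>_def)
  have "(\<integral>\<^sup>+z. ennreal (W z) \<partial>?M) = (\<integral>\<^sup>+i. (\<integral>\<^sup>+y. ennreal (W (i, y)) \<partial>lborel) \<partial>count_space D)"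
    by (rule lborel.nn_integral_fst[symmetric]) measurable
  also have "\<dots> = (\<Sum>i\<in>D. \<integral>\<^sup>+y. ennreal (w i y) \<partial>lborel)"
    using D by (simp add: nn_integral_count_space_finite W_def)
  also have "\<dots> < \<infinity>"
  proof -
    have "(\<integral>\<^sup>+y. ennreal (w i y) \<partial>lborel) \<noteq> \<infinity>" if "i \<in> D" for i
      using w(1,3)[OF that] by (subst nn_integral_eq_integral) auto
    then show ?thesis using D by (simp add: less_top)
  qed
  finally have fin: "(\<integral>\<^sup>+z. ennreal (W z) \<partial>?M) < \<infinity>" .
  have fm: "finite_measure \<mu>"
  proof
    have "emeasure \<mu> (space \<mu>) = (\<integral>\<^sup>+z. ennreal (W z) \<partial>?M)"
    proof -
      have "emeasure \<mu> (space \<mu>) = emeasure (density ?M (\<lambda>z. ennreal (W z))) (space ?M)"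
        unfolding \<mu>_def by (subst emeasure_distr) auto
      also have "\<dots> = (\<integral>\<^sup>+z. ennreal (W z) * indicator (space ?M) z \<partial>?M)"
        by (rule emeasure_density) auto
      also have "\<dots> = (\<integral>\<^sup>+z. ennreal (W z) \<partial>?M)"
        by (rule nn_integral_cong) simp
      finally show ?thesis .
    qed
    then show "emeasure \<mu> (space \<mu>) \<noteq> \<infinity>" using fin by simp
  qed
  have ae: "AE x in \<mu>. x \<in> S"
  proof -
    have "AE z in ?M. 0 < ennreal (W z) \<longrightarrow> q z \<in> S"
      by (rule AE_I2) (use S(2) in \<open>auto simp: W_def q_def space_pair_measure\<close>)
    then have "AE z in density ?M (\<lambda>z. ennreal (W z)). q z \<in> S" by (simp add: AE_density)
    then show ?thesis unfolding \<mu>_def using S(1) by (simp add: AE_distr_iff)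
  qed
  have int: "integrable \<mu> f \<and> (LINT x|\<mu>. f x) = (\<Sum>i\<in>D. LINT y|lborel. w i y * f (p i y))"
    if f[measurable]: "f \<in> borel_measurable borel" and bnd: "\<exists>B. \<forall>x. \<bar>f x\<bar> \<le> B" for f :: "'a \<Rightarrow> real"
  proof
    interpret finite_measure \<mu> by (rule fm)
    obtain B where B: "\<And>x. \<bar>f x\<bar> \<le> B" using bnd by blast
    show i: "integrable \<mu> f"
      by (rule integrable_const_bound[where B=B]) (use B f sets in \<open>auto cong: measurable_cong_sets\<close>)
    have "integrable (density ?M (\<lambda>z. ennreal (W z))) (\<lambda>z. f (q z))"
      using i unfolding \<mu>_def by (subst (asm) integrable_distr_eq) auto
    then have i2: "integrable ?M (\<lambda>z. W z *\<^sub>R f (q z))"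
      by (subst (asm) integrable_density) (auto intro!: AE_I2 W0)
    have "(LINT x|\<mu>. f x) = (LINT z|density ?M (\<lambda>z. ennreal (W z)). f (q z))"
      unfolding \<mu>_def by (rule integral_distr) auto
    also have "\<dots> = (LINT z|?M. W z *\<^sub>R f (q z))"
      by (rule integral_density) (auto intro!: AE_I2 W0)
    also have "\<dots> = (LINT i|count_space D. LINT y|lborel. W (i, y) *\<^sub>R f (q (i, y)))"
    proof -
      interpret pair_sigma_finite "count_space D" "lborel :: 'a measure"
        using D by (intro pair_sigma_finite.intro sigma_finite_measure_count_space_finite lborel.sigma_finite_measure_axioms)
      show ?thesis using integral_fst'[OF i2] by simp
    qed
    also have "\<dots> = (\<Sum>i\<in>D. LINT y|lborel. w i y * f (p i y))"
      using D by (simp add: lebesgue_integral_count_space_finite W_def q_def)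
    finally show "(LINT x|\<mu>. f x) = (\<Sum>i\<in>D. LINT y|lborel. w i y * f (p i y))" .
  qed
  show ?thesis using sets fm ae int by blast
qed

text \<open>On each chart, \<open>integral_gradient_chart\<close> expresses the integral of a gradient as a surface integral. The
  surface measure has density \<open>|nrm|\<close> in the chart and is weighted with a partition of unity; as
  \<open>nrm = |nrm| N\<close> with the same normal \<open>N\<close> in all charts, the local formulas add up.\<close>

theorem sbv_gradient_indicator:
  fixes \<Omega> :: "'a::euclidean_space set" and N :: "'a \<Rightarrow> 'a"
  assumes op: "open \<Omega>" and bd: "bounded \<Omega>" and C2: "C2_boundary \<Omega>"
    and N: "N \<in> borel_measurable borel" "\<And>x. norm (N x) = 1"
    and out: "\<And>x. x \<in> frontier \<Omega> \<Longrightarrow> outward_unit_normal \<Omega> x (N x)"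
  shows "sbv_gradient (indicator \<Omega>) (\<lambda>_. 0)"
proof -
  note N(1)[measurable]
  have cf: "compact (frontier \<Omega>)" using bd by (simp add: compact_frontier_bounded)
  have "\<forall>x\<in>frontier \<Omega>. \<exists>e F gF U. C1_chart e F gF \<Omega> U \<and> x \<in> U"
    using C2_boundary_chart[OF C2] by blast
  then obtain e F gF U where ch: "\<And>x. x \<in> frontier \<Omega> \<Longrightarrow> C1_chart (e x) (F x) (gF x) \<Omega> (U x)"
    and xU: "\<And>x. x \<in> frontier \<Omega> \<Longrightarrow> x \<in> U x" by metis
  have "\<exists>\<rho>>0. cball x (2 * \<rho>) \<subseteq> U x" if x: "x \<in> frontier \<Omega>" for x
  proof -
    have "open (U x)" using C1_chart.open_U[OF ch[OF x]] .
    then obtain r where "r > 0" "cball x r \<subseteq> U x" using xU[OF x] open_contains_cball by blast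
    then show ?thesis by (intro exI[of _ "r/2"]) auto
  qed
  then obtain \<rho> where \<rho>: "\<And>x. x \<in> frontier \<Omega> \<Longrightarrow> \<rho> x > 0" "\<And>x. x \<in> frontier \<Omega> \<Longrightarrow> cball x (2 * \<rho> x) \<subseteq> U x"
    by metis
  obtain D where D: "D \<subseteq> frontier \<Omega>" "finite D" "frontier \<Omega> \<subseteq> (\<Union>x\<in>D. ball x (\<rho> x))"
    using compactE_image[OF cf, of "frontier \<Omega>" "\<lambda>x. ball x (\<rho> x)"] \<rho>(1) by force
  define V where "V = (\<Union>x\<in>D. ball x (\<rho> x))"
  have V: "open V" "frontier \<Omega> \<subseteq> V" using D by (auto simp: V_def)
  have \<rho>D: "\<And>x. x \<in> D \<Longrightarrow> \<rho> x > 0" using \<rho> D by blast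
  obtain \<eta> where \<eta>: "\<And>x. x \<in> D \<Longrightarrow> C1_fun (\<eta> x)" "\<And>x y. x \<in> D \<Longrightarrow> 0 \<le> \<eta> x y"
     "\<And>x y. x \<in> D \<Longrightarrow> y \<notin> cball x (2 * \<rho> x) \<Longrightarrow> \<eta> x y = 0"
     "\<And>y. y \<in> V \<Longrightarrow> (\<Sum>x\<in>D. \<eta> x y) = 1"
    using C1_partition_of_unity[of D \<rho>, OF D(2) \<rho>D] unfolding V_def by blast
  define P where "P x y = C1_graph.shear (e x) (F x) (perp_part (e x) y)" for x y
  define w where "w x y = indicator (C1_graph.strip (e x)) y * (\<eta> x (P x y) * norm (C1_graph.nrm (e x) (gF x) y))" for x y
  have loc: "P x \<in> borel_measurable borel \<and> integrable lborel (w x) \<and> w x \<in> borel_measurable borel \<and> (\<forall>y. 0 \<le> w x y) \<and>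
      (\<forall>y. w x y \<noteq> 0 \<longrightarrow> P x y \<in> frontier \<Omega> \<and> C1_graph.nrm (e x) (gF x) y = norm (C1_graph.nrm (e x) (gF x) y) *\<^sub>R N (P x y))"
    if x: "x \<in> D" for x
  proof -
    have xf: "x \<in> frontier \<Omega>" using x D by blast
    interpret C1_chart "e x" "F x" "gF x" \<Omega> "U x" by (rule ch[OF xf])
    have P: "P x = (\<lambda>y. shear (prp y))" by (simp add: P_def fun_eq_iff)
    have [measurable]: "shear \<in> borel_measurable borel" using shear_cont by (rule borel_measurable_continuous_onI)
    have [measurable]: "\<eta> x \<in> borel_measurable borel" using C1_fun_continuous[OF \<eta>(1)[OF x]] by (rule borel_measurable_continuous_onI)
    have [measurable]: "nrm \<in> borel_measurable borel" using nrm_cont by (rule borel_measurable_continuous_onI)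
    have Pm: "P x \<in> borel_measurable borel" unfolding P by measurable
    have wm: "w x \<in> borel_measurable borel" unfolding w_def P by measurable
    have "\<eta> x y = 0" if "norm y > norm x + 2 * \<rho> x" for y
    proof (rule \<eta>(3)[OF x])
      have "norm y \<le> norm x + dist x y" using norm_triangle_sub[of y x] by (simp add: dist_norm norm_minus_commute)
      then show "y \<notin> cball x (2 * \<rho> x)" using that by auto
    qed
    then have "\<exists>R. \<forall>y. norm y > R \<longrightarrow> \<eta> x (shear y) = 0"
      using shear_bounded_preimage[of "norm x + 2 * \<rho> x"] by blast
    then obtain R where R: "\<And>y. norm y > R \<Longrightarrow> \<eta> x (shear y) = 0" by blast
    have "integrable lborel (\<lambda>y. indicator strip y * (\<lambda>y. \<eta> x (shear y) * norm (nrm y)) (prp y))"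
    proof (rule integrable_strip)
      show "continuous_on UNIV (\<lambda>y. \<eta> x (shear y) * norm (nrm y))"
        by (intro continuous_intros nrm_cont continuous_on_compose2[OF C1_fun_continuous[OF \<eta>(1)[OF x]] shear_cont]) auto
    qed (use R in auto)
    then have wi: "integrable lborel (w x)" by (simp add: w_def[abs_def] P)
    have "P x y \<in> frontier \<Omega> \<and> nrm y = norm (nrm y) *\<^sub>R N (P x y)" if "w x y \<noteq> 0" for y
    proof -
      have "\<eta> x (P x y) \<noteq> 0" using that by (auto simp: w_def)
      then have PU: "P x y \<in> U x" using \<eta>(3)[OF x] \<rho>(2)[OF xf] by blast
      have "height (P x y) = 0" by (simp add: P)
      then have fr: "P x y \<in> frontier \<Omega>" using in_frontier_iff[OF PU op] by simp
      have "N (P x y) = nrm (P x y) /\<^sub>R norm (nrm (P x y))"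
        by (rule outward_unit_normal_eq[OF PU fr op out[OF fr]])
      moreover have "nrm (P x y) = nrm y" by (simp add: P shear_def nrm_def gF_shift)
      ultimately show ?thesis using fr by simp
    qed
    then show ?thesis using Pm wi wm \<eta>(2)[OF x] by (auto simp: w_def)
  qed
  have frm: "frontier \<Omega> \<in> sets borel" by (intro borel_closed) simp
  have "\<exists>\<mu>. sets \<mu> = sets borel \<and> finite_measure \<mu> \<and> (AE x in \<mu>. x \<in> frontier \<Omega>) \<and>
    (\<forall>f :: 'a \<Rightarrow> real. f \<in> borel_measurable borel \<longrightarrow> (\<exists>B. \<forall>x. \<bar>f x\<bar> \<le> B) \<longrightarrow>
      integrable \<mu> f \<and> (LINT x|\<mu>. f x) = (\<Sum>i\<in>D. LINT y|lborel. w i y * f (P i y)))"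
    by (rule finite_union_surface_measure[OF D(2)]) (use loc frm in auto)
  then obtain \<mu> where \<mu>: "sets \<mu> = sets borel" "finite_measure \<mu>" "AE x in \<mu>. x \<in> frontier \<Omega>"
     and \<mu>int: "\<And>f :: 'a \<Rightarrow> real. f \<in> borel_measurable borel \<Longrightarrow> (\<exists>B. \<forall>x. \<bar>f x\<bar> \<le> B) \<Longrightarrow> integrable \<mu> f"
       "\<And>f :: 'a \<Rightarrow> real. f \<in> borel_measurable borel \<Longrightarrow> (\<exists>B. \<forall>x. \<bar>f x\<bar> \<le> B) \<Longrightarrow> (LINT x|\<mu>. f x) = (\<Sum>i\<in>D. LINT y|lborel. w i y * f (P i y))"
    by blast
  have \<Omega>m: "\<Omega> \<in> sets borel" using op by simp
  have \<Omega>fin: "emeasure lborel \<Omega> < \<infinity>" using emeasure_bounded_finite[OF bd] by simp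
  show ?thesis
    unfolding sbv_gradient_def
  proof (intro conjI exI[of _ \<mu>] exI[of _ "\<lambda>x. - N x"] allI impI)
    show "integrable lebesgue (indicator \<Omega> :: 'a \<Rightarrow> real)"
      using \<Omega>m \<Omega>fin by (intro integrable_real_indicator) auto
    show "integrable lborel (\<lambda>_::'a. 0 :: 'a)" by simp
    show "sets \<mu> = sets borel" "finite_measure \<mu>" by (fact \<mu>)+
    show "(\<lambda>x. - N x) \<in> borel_measurable borel" by measurable
    show "norm (- N x) = 1" for x using N(2) by simp
    show "AE x in \<mu>. x \<in> jump_set (indicator \<Omega>)"
      using \<mu>(3)
    proof eventually_elim
      case (elim x)
      interpret C1_chart "e x" "F x" "gF x" \<Omega> "U x" by (rule ch[OF elim])
      show ?case using jump_triple_indicator_exists[OF op xU[OF elim] elim] unfolding jump_set_def by blast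
    qed
    fix \<psi> :: "'a \<Rightarrow> real" assume \<psi>: "test_function_on UNIV \<psi>"
    have \<psi>1: "C1_fun \<psi>" using \<psi> by (rule test_function_C1_fun)
    obtain R where R: "\<And>y. norm y > R \<Longrightarrow> \<psi> y = 0" using test_function_bounded_support[OF \<psi>] by blast
    have \<psi>c: "continuous_on UNIV \<psi>" using \<psi>1 by (rule C1_fun_continuous)
    then have [measurable]: "\<psi> \<in> borel_measurable borel" by (rule borel_measurable_continuous_onI)
    have g\<psi>c: "continuous_on UNIV (gradient \<psi>)" using \<psi>1 by (simp add: C1_fun_def)
    have [measurable]: "gradient \<psi> \<in> borel_measurable borel" using g\<psi>c by (rule borel_measurable_continuous_onI)
    obtain B where B: "\<And>y. norm (\<psi> y) \<le> B" using bounded_support_imp_bounded[OF \<psi>c R] by blast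
    have vi: "integrable lborel (\<lambda>x. indicator \<Omega> x *\<^sub>R gradient h x)" if h: "C1_fun h" for h
    proof -
      have c: "continuous_on UNIV (gradient h)" using h by (simp add: C1_fun_def)
      have "compact (gradient h ` closure \<Omega>)"
        using bd by (intro compact_continuous_image continuous_on_subset[OF c]) simp_all
      then have "bounded (gradient h ` closure \<Omega>)" by (rule compact_imp_bounded)
      then obtain C where C: "\<And>x. x \<in> closure \<Omega> \<Longrightarrow> norm (gradient h x) \<le> C" by (auto simp: bounded_iff)
      have [measurable]: "gradient h \<in> borel_measurable borel" using c by (rule borel_measurable_continuous_onI)
      show ?thesis
      proof (rule integrableI_bounded_set[where A=\<Omega> and B=C])
        show "AE x in lborel. x \<in> \<Omega> \<longrightarrow> norm (indicator \<Omega> x *\<^sub>R gradient h x) \<le> C"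
          using C closure_subset[of \<Omega>] by (auto intro!: AE_I2)
      qed (use \<Omega>m \<Omega>fin in auto)
    qed
    have int1: "integrable lborel (\<lambda>x. indicator \<Omega> x * (gradient h x \<bullet> b))" if "C1_fun h" for h b
      using integrable_inner_left[OF vi[OF that], of b] by simp
    have comp: "(LINT x|lborel. indicator \<Omega> x * (gradient \<psi> x \<bullet> b)) = (LINT x|\<mu>. \<psi> x * (N x \<bullet> b))" for b
    proof -
      have \<eta>\<psi>: "C1_fun (\<lambda>y. \<eta> x y * \<psi> y)" if "x \<in> D" for x using \<eta>(1)[OF that] \<psi>1 by (rule C1_fun_mult)
      define k where "k y = \<psi> y - (\<Sum>x\<in>D. \<eta> x y * \<psi> y)" for y
      have k: "C1_fun k" unfolding k_def by (intro C1_fun_diff \<psi>1 C1_fun_sum D(2) \<eta>\<psi>)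
      have kV: "k y = 0" if "y \<in> V" for y
        using \<eta>(4)[OF that] by (simp add: k_def sum_distrib_right[symmetric])
      have k0: "(LINT y|lborel. indicator \<Omega> y * (gradient k y \<bullet> b)) = 0"
        by (rule integral_gradient_interior[where R=R, OF op k _ V kV]) (simp_all add: k_def R)
      have "gradient k y = gradient \<psi> y - (\<Sum>x\<in>D. gradient (\<lambda>y. \<eta> x y * \<psi> y) y)" for y
      proof (rule gradient_eqI)
        have "GDERIV (\<lambda>y. \<Sum>x\<in>D. \<eta> x y * \<psi> y) y :> (\<Sum>x\<in>D. gradient (\<lambda>y. \<eta> x y * \<psi> y) y)"
          unfolding gderiv_def inner_sum_right
          by (rule has_derivative_sum) (use \<eta>\<psi> in \<open>simp add: C1_fun_def gderiv_def\<close>)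
        then show "GDERIV k y :> gradient \<psi> y - (\<Sum>x\<in>D. gradient (\<lambda>y. \<eta> x y * \<psi> y) y)"
          unfolding k_def using \<psi>1 by (intro GDERIV_diff) (auto simp: C1_fun_def)
      qed
      then have "indicator \<Omega> y * (gradient k y \<bullet> b) = indicator \<Omega> y * (gradient \<psi> y \<bullet> b)
           - (\<Sum>x\<in>D. indicator \<Omega> y * (gradient (\<lambda>y. \<eta> x y * \<psi> y) y \<bullet> b))" for y
        by (simp add: inner_diff_left inner_sum_left right_diff_distrib sum_distrib_left)
      then have "0 = (LINT y|lborel. indicator \<Omega> y * (gradient \<psi> y \<bullet> b)
           - (\<Sum>x\<in>D. indicator \<Omega> y * (gradient (\<lambda>y. \<eta> x y * \<psi> y) y \<bullet> b)))" using k0 by simp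
      also have "\<dots> = (LINT y|lborel. indicator \<Omega> y * (gradient \<psi> y \<bullet> b))
           - (\<Sum>x\<in>D. LINT y|lborel. indicator \<Omega> y * (gradient (\<lambda>y. \<eta> x y * \<psi> y) y \<bullet> b))"
        using int1[OF \<psi>1] int1[OF \<eta>\<psi>] by (subst Bochner_Integration.integral_diff) (auto simp: Bochner_Integration.integral_sum)
      finally have "(LINT y|lborel. indicator \<Omega> y * (gradient \<psi> y \<bullet> b)) =
          (\<Sum>x\<in>D. LINT y|lborel. indicator \<Omega> y * (gradient (\<lambda>y. \<eta> x y * \<psi> y) y \<bullet> b))" by simp
      also have "\<dots> = (\<Sum>x\<in>D. LINT y|lborel. w x y * (\<psi> (P x y) * (N (P x y) \<bullet> b)))"
      proof (rule sum.cong[OF refl])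
        fix x assume x: "x \<in> D"
        then have xf: "x \<in> frontier \<Omega>" using D by blast
        interpret C1_chart "e x" "F x" "gF x" \<Omega> "U x" by (rule ch[OF xf])
        have "(LINT y|lborel. indicator \<Omega> y * (gradient (\<lambda>y. \<eta> x y * \<psi> y) y \<bullet> b)) =
            (LINT y|lborel. indicator strip y * (\<eta> x (shear (prp y)) * \<psi> (shear (prp y)) * (nrm y \<bullet> b)))"
          by (rule integral_gradient_chart[OF \<eta>\<psi>[OF x], where K="cball x (2 * \<rho> x)" and R=R])
            (use \<rho>(2)[OF xf] \<eta>(3)[OF x] R in auto)
        also have "\<dots> = (LINT y|lborel. w x y * (\<psi> (P x y) * (N (P x y) \<bullet> b)))"
        proof (rule Bochner_Integration.integral_cong[OF refl])
          fix y
          show "indicator strip y * (\<eta> x (shear (prp y)) * \<psi> (shear (prp y)) * (nrm y \<bullet> b)) = w x y * (\<psi> (P x y) * (N (P x y) \<bullet> b))"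
          proof (cases "w x y = 0")
            case True
            then have "indicator strip y * \<eta> x (shear (prp y)) = 0" by (auto simp: w_def P_def)
            then show ?thesis using True by auto
          next
            case False
            then have "nrm y = norm (nrm y) *\<^sub>R N (P x y)" using loc[OF x] by blast
            then have "nrm y \<bullet> b = norm (nrm y) * (N (P x y) \<bullet> b)" by (metis inner_scaleR_left)
            then show ?thesis by (simp add: w_def P_def)
          qed
        qed
        finally show "(LINT y|lborel. indicator \<Omega> y * (gradient (\<lambda>y. \<eta> x y * \<psi> y) y \<bullet> b)) =
           (LINT y|lborel. w x y * (\<psi> (P x y) * (N (P x y) \<bullet> b)))" .
      qed
      also have "\<dots> = (LINT x|\<mu>. \<psi> x * (N x \<bullet> b))"
      proof (rule \<mu>int(2)[symmetric])
        show "(\<lambda>x. \<psi> x * (N x \<bullet> b)) \<in> borel_measurable borel" by measurable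
        have "\<bar>\<psi> x * (N x \<bullet> b)\<bar> \<le> B * norm b" for x
          unfolding abs_mult using B[of x] Cauchy_Schwarz_ineq2[of "N x" b] N(2)[of x]
          by (intro mult_mono) auto
        then show "\<exists>B. \<forall>x. \<bar>\<psi> x * (N x \<bullet> b)\<bar> \<le> B" by blast
      qed
      finally show ?thesis .
    qed
    have "(LINT x|lebesgue. indicator \<Omega> x *\<^sub>R gradient \<psi> x) = (LINT x|lborel. indicator \<Omega> x *\<^sub>R gradient \<psi> x)"
      by (rule integral_completion) (use \<Omega>m in measurable)
    also have "\<dots> = - (LINT x|\<mu>. \<psi> x *\<^sub>R - N x)"
    proof (rule euclidean_eqI)
      fix b :: 'a assume b: "b \<in> Basis"
      have vm: "integrable \<mu> (\<lambda>x. \<psi> x *\<^sub>R - N x)"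
      proof -
        interpret finite_measure \<mu> by (rule \<mu>(2))
        show ?thesis
          by (rule integrable_const_bound[where B=B]) (use B N \<mu>(1) in \<open>auto cong: measurable_cong_sets\<close>)
      qed
      have "(LINT x|lborel. indicator \<Omega> x *\<^sub>R gradient \<psi> x) \<bullet> b = (LINT x|lborel. indicator \<Omega> x * (gradient \<psi> x \<bullet> b))"
        using vi[OF \<psi>1] by (simp flip: integral_inner_left)
      also have "\<dots> = (LINT x|\<mu>. \<psi> x * (N x \<bullet> b))" by (rule comp)
      also have "\<dots> = - (LINT x|\<mu>. \<psi> x *\<^sub>R - N x) \<bullet> b"
        using vm by (simp flip: integral_inner_left)
      finally show "(LINT x|lborel. indicator \<Omega> x *\<^sub>R gradient \<psi> x) \<bullet> b = - (LINT x|\<mu>. \<psi> x *\<^sub>R - N x) \<bullet> b" .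
    qed
    finally show "(LINT x|lebesgue. indicator \<Omega> x *\<^sub>R gradient \<psi> x) =
       - ((LINT x|lborel. \<psi> x *\<^sub>R (0::'a)) + (LINT x|\<mu>. \<psi> x *\<^sub>R - N x))" by simp
  qed
qed

section \<open>Distributional divergence of fields with a \<open>C\<^sup>1\<close> potential\<close>

lemma continuous_on_zero_extension:
  fixes f :: "'a::topological_space \<Rightarrow> 'b::{topological_space,zero}"
  assumes "continuous_on V f" "open V" "closed K" "K \<subseteq> V" "\<And>z. z \<notin> K \<Longrightarrow> f z = 0"
  shows "continuous_on UNIV f"
proof -
  have "continuous_on (- K) f"
    by (rule continuous_on_eq[OF continuous_on_const[of _ 0]]) (use assms(5) in auto)
  then have "continuous_on (V \<union> - K) f"
    using assms by (intro continuous_on_open_Un) auto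
  moreover have "V \<union> - K = UNIV" using assms(4) by auto
  ultimately show ?thesis by simp
qed

abbreviation partial_deriv :: "'a::euclidean_space \<Rightarrow> ('a \<Rightarrow> real) \<Rightarrow> 'a \<Rightarrow> real" where
  "partial_deriv b f z \<equiv> frechet_derivative f (at z) b"

lemma differentiable_directional:
  fixes f :: "'a::euclidean_space \<Rightarrow> real"
  assumes "f differentiable (at y)"
  shows "((\<lambda>s. f (y + s *\<^sub>R b)) has_real_derivative partial_deriv b f y) (at 0)"
  using GDERIV_directional[OF differentiable_imp_GDERIV_gradient(1)[OF assms], of b]
    differentiable_imp_GDERIV_gradient(2)[OF assms, of b] by simp

lemma partial_deriv_zero_open:
  fixes f :: "'a::euclidean_space \<Rightarrow> real"
  assumes "open W" "z \<in> W" "\<And>y. y \<in> W \<Longrightarrow> f y = 0"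
  shows "partial_deriv b f z = 0"
proof -
  have "((\<lambda>_. 0) has_derivative (\<lambda>h. 0)) (at z)" by simp
  then have "(f has_derivative (\<lambda>h. 0)) (at z)"
    by (rule has_derivative_transform_within_open[OF _ assms(1,2)]) (use assms(3) in auto)
  then have "frechet_derivative f (at z) = (\<lambda>h. 0)" by (rule frechet_derivative_at[symmetric])
  then show ?thesis by simp
qed

lemma Ck_on_2_differentiable: "Ck_on 2 S f \<Longrightarrow> x \<in> S \<Longrightarrow> f differentiable (at x)"
  by (simp add: numeral_2_eq_2)

lemma Ck_on_2_mixed_partials_commute:
  fixes f :: "'a::euclidean_space \<Rightarrow> real"
  assumes "Ck_on 2 UNIV f" "b \<in> Basis" "c \<in> Basis"
  shows "partial_deriv c (partial_deriv b f) z = partial_deriv b (partial_deriv c f) z"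
proof (rule mixed_derivatives_commute[where f=f and b=b and c=c and fb="partial_deriv b f" and fc="partial_deriv c f"
    and fbc="partial_deriv c (partial_deriv b f)" and fcb="partial_deriv b (partial_deriv c f)"])
  show "isCont (partial_deriv c (partial_deriv b f)) z" "isCont (partial_deriv b (partial_deriv c f)) z"
    using assms by (auto simp: numeral_2_eq_2 continuous_on_eq_continuous_at)
qed (use assms in \<open>auto simp: numeral_2_eq_2 intro!: differentiable_directional\<close>)

text \<open>The product with a derivative of \<open>\<psi>\<close>, extended by \<open>0\<close> off \<open>V\<close>, is differentiable along \<open>c\<close> and has compact
  support, so its derivative integrates to \<open>0\<close>.\<close>

lemma integration_by_parts_test_function:
  fixes \<psi> \<Psi> \<Psi>c :: "'a::euclidean_space \<Rightarrow> real"
  assumes V: "open V" and \<psi>: "test_function_on V \<psi>" and c: "c \<in> Basis" and d: "d \<in> Basis"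
    and \<Psi>: "continuous_on V \<Psi>" and \<Psi>c: "continuous_on V \<Psi>c"
    and der: "\<And>z. z \<in> V \<Longrightarrow> ((\<lambda>s. \<Psi> (z + s *\<^sub>R c)) has_real_derivative \<Psi>c z) (at 0)"
  shows "integrable lborel (\<lambda>z. \<Psi>c z * partial_deriv d \<psi> z)"
    and "(LINT z|lborel. \<Psi>c z * partial_deriv d \<psi> z) = - (LINT z|lborel. \<Psi> z * partial_deriv c (partial_deriv d \<psi>) z)"
proof -
  define K where "K = closure {x. \<psi> x \<noteq> 0}"
  have K: "compact K" "K \<subseteq> V" using \<psi> by (auto simp: test_function_on_def K_def)
  then have Kc: "closed K" by (simp add: compact_imp_closed)
  have C2: "Ck_on 2 UNIV \<psi>" using \<psi> by (auto simp: test_function_on_def)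
  have z0: "\<psi> z = 0" if "z \<notin> K" for z using that closure_subset[of "{x. \<psi> x \<noteq> 0}"] by (auto simp: K_def)
  have z1: "partial_deriv d \<psi> z = 0" if "z \<notin> K" for z
    by (rule partial_deriv_zero_open[of "- K"]) (use Kc z0 that in auto)
  have z2: "partial_deriv c (partial_deriv d \<psi>) z = 0" if "z \<notin> K" for z
    by (rule partial_deriv_zero_open[of "- K"]) (use Kc z1 that in auto)
  have d1: "partial_deriv d \<psi> differentiable (at z)" for z using C2 d by (simp add: numeral_2_eq_2)
  have c1: "continuous_on A (partial_deriv d \<psi>)" for A
    using d1 by (meson continuous_at_imp_continuous_on differentiable_imp_continuous_within)
  have c2: "continuous_on UNIV (partial_deriv c (partial_deriv d \<psi>))" using C2 c d by (simp add: numeral_2_eq_2)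
  then have c2: "continuous_on A (partial_deriv c (partial_deriv d \<psi>))" for A by (rule continuous_on_subset) simp
  let ?G = "\<lambda>z. \<Psi> z * partial_deriv d \<psi> z"
  let ?A = "\<lambda>z. \<Psi>c z * partial_deriv d \<psi> z" and ?B = "\<lambda>z. \<Psi> z * partial_deriv c (partial_deriv d \<psi>) z"
  have G: "continuous_on UNIV ?G"
    by (rule continuous_on_zero_extension[OF _ V Kc K(2)]) (simp_all add: continuous_on_mult[OF \<Psi> c1] z1)
  have A: "continuous_on UNIV ?A"
    by (rule continuous_on_zero_extension[OF _ V Kc K(2)]) (simp_all add: continuous_on_mult[OF \<Psi>c c1] z1)
  have B: "continuous_on UNIV ?B"
    by (rule continuous_on_zero_extension[OF _ V Kc K(2)]) (simp_all add: continuous_on_mult[OF \<Psi> c2] z2)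
  obtain R where R: "\<And>z. z \<in> K \<Longrightarrow> norm z \<le> R" using compact_imp_bounded[OF K(1)] unfolding bounded_iff by blast
  have out: "z \<notin> K" if "norm z > R" for z using R[of z] that by auto
  have int: "integrable lborel f" if f: "continuous_on UNIV f" "\<And>z. z \<notin> K \<Longrightarrow> f z = 0" for f :: "'a \<Rightarrow> real"
  proof -
    have s: "\<And>z. norm z > R \<Longrightarrow> f z = 0" using f(2) out by blast
    obtain M where "\<And>z. norm (f z) \<le> M" using bounded_support_imp_bounded[OF f(1) s] by blast
    then show ?thesis
      using borel_measurable_continuous_onI[OF f(1)] s by (intro integrable_lborel_bounded_support)
  qed
  have iA: "integrable lborel ?A" by (rule int[OF A]) (simp add: z1)
  have iB: "integrable lborel ?B" by (rule int[OF B]) (simp add: z2)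
  have "(LINT z|lborel. ?A z + ?B z) = 0"
  proof (rule integral_directional_derivative_eq_0'[OF G, where v=c and R=R])
    show "continuous_on UNIV (\<lambda>z. ?A z + ?B z)" by (intro continuous_on_add A B)
    show "?G z = 0" "?A z + ?B z = 0" if "norm z > R" for z using out[OF that] z1 z2 by auto
    fix z
    show "((\<lambda>s. ?G (z + s *\<^sub>R c)) has_real_derivative ?A z + ?B z) (at 0)"
    proof (cases "z \<in> K")
      case True
      then have "z \<in> V" using K by blast
      have "((\<lambda>s. \<Psi> (z + s *\<^sub>R c) * partial_deriv d \<psi> (z + s *\<^sub>R c)) has_real_derivative
          \<Psi>c z * partial_deriv d \<psi> (z + 0 *\<^sub>R c) + partial_deriv c (partial_deriv d \<psi>) z * \<Psi> (z + 0 *\<^sub>R c)) (at 0)"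
        by (rule DERIV_mult[OF der[OF \<open>z \<in> V\<close>] differentiable_directional[OF d1]])
      then show ?thesis by (simp add: mult.commute)
    next
      case False
      have o: "open ((\<lambda>s. z + s *\<^sub>R c) -` (- K))" using Kc by (intro continuous_open_vimage continuous_intros) auto
      have "((\<lambda>s. 0) has_real_derivative 0) (at 0)" by simp
      then have "((\<lambda>s. ?G (z + s *\<^sub>R c)) has_real_derivative 0) (at 0)"
        by (rule has_field_derivative_transform_within_open[OF _ o]) (use False z1 in auto)
      moreover have "?A z + ?B z = 0" using False z1 z2 by simp
      ultimately show ?thesis by (simp only:)
    qed
  qed
  then show "(LINT z|lborel. ?A z) = - (LINT z|lborel. ?B z)" using iA iB by simp
  show "integrable lborel ?A" by (rule iA)
qed

text \<open>Moving all derivatives to the test function leaves \<open>\<Psi>\<^sub>b (\<partial>\<^sub>t \<partial>\<^sub>b \<psi> - \<partial>\<^sub>b \<partial>\<^sub>t \<psi>) = 0\<close>. This needs only one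
  derivative of the potential, whereas the field itself is merely continuous.\<close>

lemma distr_divergence_free_potential:
  fixes \<phi> :: "'a::euclidean_space \<times> real \<Rightarrow> 'a \<times> real" and \<Psi> \<Psi>t \<Psi>x :: "'a \<Rightarrow> 'a \<times> real \<Rightarrow> real"
  assumes V: "open V"
    and c: "\<And>b. b \<in> Basis \<Longrightarrow> continuous_on V (\<Psi> b)" "\<And>b. b \<in> Basis \<Longrightarrow> continuous_on V (\<Psi>t b)"
       "\<And>b. b \<in> Basis \<Longrightarrow> continuous_on V (\<Psi>x b)"
    and dt: "\<And>b z. b \<in> Basis \<Longrightarrow> z \<in> V \<Longrightarrow> ((\<lambda>s. \<Psi> b (z + s *\<^sub>R (0, 1))) has_real_derivative \<Psi>t b z) (at 0)"
    and dx: "\<And>b z. b \<in> Basis \<Longrightarrow> z \<in> V \<Longrightarrow> ((\<lambda>s. \<Psi> b (z + s *\<^sub>R (b, 0))) has_real_derivative \<Psi>x b z) (at 0)"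
    and \<phi>: "\<And>b z. b \<in> Basis \<Longrightarrow> z \<in> V \<Longrightarrow> fst (\<phi> z) \<bullet> b = \<Psi>t b z"
       "\<And>z. z \<in> V \<Longrightarrow> snd (\<phi> z) = - (\<Sum>b\<in>Basis. \<Psi>x b z)"
  shows "distr_divergence_free_on V \<phi>"
  unfolding distr_divergence_free_on_def
proof (intro allI impI)
  fix \<psi> assume \<psi>: "test_function_on V \<psi>"
  have C2: "Ck_on 2 UNIV \<psi>" using \<psi> by (auto simp: test_function_on_def)
  have d\<psi>: "\<psi> differentiable (at z)" for z using Ck_on_2_differentiable[OF C2] by blast
  have T: "(0, 1) \<in> (Basis :: ('a \<times> real) set)" by (simp add: Basis_prod_def)
  have X: "(b, 0) \<in> (Basis :: ('a \<times> real) set)" if "b \<in> Basis" for b using that by (simp add: Basis_prod_def)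
  have zero: "partial_deriv d \<psi> z = 0" if "z \<notin> V" for z d
  proof (rule partial_deriv_zero_open[of "- closure {x. \<psi> x \<noteq> 0}"])
    show "z \<in> - closure {x. \<psi> x \<noteq> 0}" using \<psi> that by (auto simp: test_function_on_def)
    show "\<psi> y = 0" if "y \<in> - closure {x. \<psi> x \<noteq> 0}" for y
      using that closure_subset[of "{x. \<psi> x \<noteq> 0}"] by auto
  qed (intro open_Compl closed_closure)
  let ?f = "\<lambda>b z. \<Psi>t b z * partial_deriv (b, 0) \<psi> z - \<Psi>x b z * partial_deriv (0, 1) \<psi> z"
  have eq: "\<phi> z \<bullet> gradient \<psi> z = (\<Sum>b\<in>Basis. ?f b z)" for z
  proof -
    have gr: "gradient \<psi> z \<bullet> h = partial_deriv h \<psi> z" for h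
      by (rule differentiable_imp_GDERIV_gradient(2)[OF d\<psi>])
    have 1: "fst (gradient \<psi> z) \<bullet> b = partial_deriv (b, 0) \<psi> z" for b
      using gr[of "(b, 0)"] by (simp add: inner_prod_def)
    have 2: "snd (gradient \<psi> z) = partial_deriv (0, 1) \<psi> z"
      using gr[of "(0, 1)"] by (simp add: inner_prod_def)
    show ?thesis
    proof (cases "z \<in> V")
      case True
      have "\<phi> z \<bullet> gradient \<psi> z = (\<Sum>b\<in>Basis. (fst (\<phi> z) \<bullet> b) * (fst (gradient \<psi> z) \<bullet> b)) + snd (\<phi> z) * snd (gradient \<psi> z)"
        unfolding inner_prod_def by (subst euclidean_inner) simp
      also have "\<dots> = (\<Sum>b\<in>Basis. \<Psi>t b z * partial_deriv (b, 0) \<psi> z) - (\<Sum>b\<in>Basis. \<Psi>x b z) * partial_deriv (0, 1) \<psi> z"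
        unfolding 1 2 \<phi>(2)[OF True] using \<phi>(1)[OF _ True] by simp
      finally show ?thesis by (simp add: sum_subtractf sum_distrib_right)
    next
      case False
      have "gradient \<psi> z = 0"
        using zero[OF False] 1 2 by (auto simp: prod_eq_iff intro: euclidean_eqI)
      then show ?thesis using zero[OF False] by simp
    qed
  qed
  have parts: "integrable lborel (?f b) \<and> (LINT z|lborel. ?f b z) = 0" if b: "b \<in> Basis" for b
  proof -
    note t = integration_by_parts_test_function[OF V \<psi> T X[OF b] c(1,2)[OF b] dt[OF b]]
    note x = integration_by_parts_test_function[OF V \<psi> X[OF b] T c(1,3)[OF b] dx[OF b]]
    have "(LINT z|lborel. ?f b z) = (LINT z|lborel. \<Psi>t b z * partial_deriv (b, 0) \<psi> z) - (LINT z|lborel. \<Psi>x b z * partial_deriv (0, 1) \<psi> z)"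
      using t(1) x(1) by (rule Bochner_Integration.integral_diff)
    also have "\<dots> = 0"
      using t(2) x(2) unfolding Ck_on_2_mixed_partials_commute[OF C2 T X[OF b]] by linarith
    finally show ?thesis using t(1) x(1) by auto
  qed
  show "(LINT z|lborel. \<phi> z \<bullet> gradient \<psi> z) = 0"
    unfolding eq using parts by (subst Bochner_Integration.integral_sum) auto
qed

section \<open>The profile in the vertical variable\<close>

text \<open>The integral \<open>h\<close> over \<open>[0, t]\<close> of \<open>2 min (\<beta> t) (a (1 - t))\<close>. For \<open>t\<close> above \<open>a / (a + \<beta>)\<close> it differs from \<open>\<beta> t\<^sup>2\<close> by a
  perfect square, and this form shows that it is \<open>C\<^sup>1\<close> in \<open>(a, t)\<close> across the interface. The function
  \<open>profile_a\<close> is its derivative with respect to \<open>a\<close>.\<close>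

definition profile :: "real \<Rightarrow> real \<Rightarrow> real \<Rightarrow> real" where
  "profile \<beta> a t = \<beta> * t\<^sup>2 - (max 0 (\<beta> * t - a * (1 - t)))\<^sup>2 * inverse (a + \<beta>)"

definition profile_a :: "real \<Rightarrow> real \<Rightarrow> real \<Rightarrow> real" where
  "profile_a \<beta> a t = 2 * max 0 (\<beta> * t - a * (1 - t)) * (1 - t) * inverse (a + \<beta>)
     + (max 0 (\<beta> * t - a * (1 - t)))\<^sup>2 * (inverse (a + \<beta>))\<^sup>2"

lemma DERIV_profile_t:
  assumes "\<beta> > 0" "a > 0"
  shows "(profile \<beta> a has_real_derivative 2 * min (\<beta> * t) (a * (1 - t))) (at t)"
proof -
  have "((\<lambda>t. \<beta> * t - a * (1 - t)) has_real_derivative \<beta> + a) (at t)"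
    by (auto intro!: derivative_eq_intros)
  from DERIV_chain2[OF DERIV_positive_part_square this]
  have "((\<lambda>t. (max 0 (\<beta> * t - a * (1 - t)))\<^sup>2) has_real_derivative 2 * max 0 (\<beta> * t - a * (1 - t)) * (\<beta> + a)) (at t)" .
  then have "(profile \<beta> a has_real_derivative \<beta> * (2 * t) - 2 * max 0 (\<beta> * t - a * (1 - t)) * (\<beta> + a) * inverse (a + \<beta>)) (at t)"
    unfolding profile_def
    by (intro DERIV_diff DERIV_cmult DERIV_cmult_right) (auto intro!: derivative_eq_intros)
  moreover have "(\<beta> + a) * inverse (a + \<beta>) = 1" using assms by (simp add: add.commute)
  ultimately have "(profile \<beta> a has_real_derivative \<beta> * (2 * t) - 2 * max 0 (\<beta> * t - a * (1 - t))) (at t)"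
    by (simp add: mult.assoc)
  moreover have "\<beta> * (2 * t) - 2 * max 0 (\<beta> * t - a * (1 - t)) = 2 * min (\<beta> * t) (a * (1 - t))"
    by (auto simp: max_def min_def)
  ultimately show ?thesis by simp
qed

lemma DERIV_profile_a:
  assumes "\<beta> > 0" "a > 0"
  shows "((\<lambda>a. profile \<beta> a t) has_real_derivative profile_a \<beta> a t) (at a)"
proof -
  have "((\<lambda>a. \<beta> * t - a * (1 - t)) has_real_derivative - (1 - t)) (at a)"
    by (auto intro!: derivative_eq_intros)
  from DERIV_chain2[OF DERIV_positive_part_square this]
  have 1: "((\<lambda>a. (max 0 (\<beta> * t - a * (1 - t)))\<^sup>2) has_real_derivative 2 * max 0 (\<beta> * t - a * (1 - t)) * - (1 - t)) (at a)" .
  have 2: "((\<lambda>a. inverse (a + \<beta>)) has_real_derivative - (inverse (a + \<beta>))\<^sup>2) (at a)"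
    using assms by (auto intro!: derivative_eq_intros simp: power2_eq_square)
  have "((\<lambda>a. \<beta> * t\<^sup>2 - (max 0 (\<beta> * t - a * (1 - t)))\<^sup>2 * inverse (a + \<beta>)) has_real_derivative
     0 - (2 * max 0 (\<beta> * t - a * (1 - t)) * - (1 - t) * inverse (a + \<beta>) + - (inverse (a + \<beta>))\<^sup>2 * (max 0 (\<beta> * t - a * (1 - t)))\<^sup>2)) (at a)"
    by (intro DERIV_diff DERIV_const DERIV_mult 1 2)
  moreover have "0 - (2 * max 0 (\<beta> * t - a * (1 - t)) * - (1 - t) * inverse (a + \<beta>) + - (inverse (a + \<beta>))\<^sup>2 * (max 0 (\<beta> * t - a * (1 - t)))\<^sup>2) = profile_a \<beta> a t"
    unfolding profile_a_def by algebra
  ultimately show ?thesis unfolding profile_def by simp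
qed

text \<open>The left-hand side is \<open>- div\<^sub>x \<Psi>\<close> once \<open>d = div \<nu>\<close> and \<open>\<nabla>a \<bullet> \<nu> = - (a d + a\<^sup>2)\<close> are inserted. In terms of
  \<open>s = a + \<beta>\<close> and \<open>\<delta> = a / s\<close> both cases are polynomial identities.\<close>

lemma profile_identity:
  assumes "\<beta> > 0" "a > 0"
  shows "profile \<beta> a t * d - profile_a \<beta> a t * (a * d + a\<^sup>2) =
    \<beta> * (min t (a / (a + \<beta>)))\<^sup>2 * d + (min (\<beta> * t) (a * (1 - t)))\<^sup>2 - \<beta>\<^sup>2 * (min t (a / (a + \<beta>)))\<^sup>2"
proof -
  define s where "s = a + \<beta>"
  define \<delta> where "\<delta> = a / s"
  have s: "s > 0" using assms by (simp add: s_def)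
  have a: "a = s * \<delta>" using s by (simp add: \<delta>_def)
  have b: "\<beta> = s * (1 - \<delta>)" using a by (simp add: s_def algebra_simps)
  have m: "\<beta> * t - a * (1 - t) = s * (t - \<delta>)" using a by (simp add: s_def algebra_simps)
  show ?thesis
  proof (cases "t \<le> \<delta>")
    case True
    then have "s * (t - \<delta>) \<le> 0" using s by (simp add: mult_le_0_iff)
    then have m0: "max 0 (\<beta> * t - a * (1 - t)) = 0" "\<beta> * t \<le> a * (1 - t)" using m by auto
    have "min t (a / (a + \<beta>)) = t" using True by (simp add: \<delta>_def s_def)
    moreover have "min (\<beta> * t) (a * (1 - t)) = \<beta> * t" using m0 by simp
    ultimately show ?thesis by (simp add: profile_def profile_a_def m0 power_mult_distrib)
  next
    case False
    then have "s * (t - \<delta>) > 0" using s by simp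
    then have m0: "max 0 (\<beta> * t - a * (1 - t)) = s * (t - \<delta>)" "a * (1 - t) \<le> \<beta> * t" using m by auto
    have q: "min t (a / (a + \<beta>)) = \<delta>" using False by (simp add: \<delta>_def s_def)
    have p: "min (\<beta> * t) (a * (1 - t)) = a * (1 - t)" using m0 by simp
    have i: "s * inverse s = 1" using s by simp
    have h: "profile \<beta> a t = s * (1 - \<delta>) * t\<^sup>2 - s * (t - \<delta>)\<^sup>2"
    proof -
      have "profile \<beta> a t = \<beta> * t\<^sup>2 - (s * (t - \<delta>))\<^sup>2 * inverse s" by (simp add: profile_def m0 s_def)
      also have "(s * (t - \<delta>))\<^sup>2 * inverse s = s * (t - \<delta>)\<^sup>2" using i by algebra
      finally show ?thesis by (simp add: b)
    qed
    have ha: "profile_a \<beta> a t = 2 * (t - \<delta>) * (1 - t) + (t - \<delta>)\<^sup>2"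
    proof -
      have "profile_a \<beta> a t = 2 * (s * (t - \<delta>)) * (1 - t) * inverse s + (s * (t - \<delta>))\<^sup>2 * (inverse s)\<^sup>2"
        by (simp add: profile_a_def m0 s_def)
      also have "\<dots> = 2 * (t - \<delta>) * (1 - t) + (t - \<delta>)\<^sup>2" using i by algebra
      finally show ?thesis .
    qed
    show ?thesis unfolding q p h ha using a b by algebra
  qed
qed

section \<open>The calibrating field of a harmonic function\<close>

locale harmonic_potential =
  fixes W :: "'a::euclidean_space set" and \<Gamma> :: "'a \<Rightarrow> real" and \<beta> :: real
  assumes open_W: "open W" and harmonic: "harmonic_on W \<Gamma>"
    and \<Gamma>_pos: "x \<in> W \<Longrightarrow> \<Gamma> x > 0" and grad_nonzero: "x \<in> W \<Longrightarrow> gradient \<Gamma> x \<noteq> 0"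
    and \<beta>_pos: "\<beta> > 0"
begin

abbreviation g :: "'a \<Rightarrow> 'a" where "g \<equiv> gradient \<Gamma>"

definition nu :: "'a \<Rightarrow> 'a" where "nu x = g x /\<^sub>R norm (g x)"

definition slope :: "'a \<Rightarrow> real" where "slope x = norm (g x) / \<Gamma> x"

text \<open>The derivative of \<open>\<nabla>\<Gamma>\<close> at \<open>x\<close> in the direction \<open>h\<close>.\<close>

definition hess :: "'a \<Rightarrow> 'a \<Rightarrow> 'a" where
  "hess x h = (\<Sum>b\<in>Basis. partial_deriv h (partial_deriv b \<Gamma>) x *\<^sub>R b)"

lemma C2: "Ck_on 2 W \<Gamma>" using harmonic by (simp add: harmonic_on_def)

lemma norm_g_pos: "x \<in> W \<Longrightarrow> norm (g x) > 0" using grad_nonzero by simp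

lemma slope_pos: "x \<in> W \<Longrightarrow> slope x > 0" using norm_g_pos \<Gamma>_pos by (simp add: slope_def)

lemma norm_nu: "x \<in> W \<Longrightarrow> norm (nu x) = 1" using grad_nonzero by (simp add: nu_def)

lemma g_deriv: "x \<in> W \<Longrightarrow> (g has_derivative hess x) (at x)"
  using Ck_on_2_gradient_differentiable[OF C2 open_W] unfolding hess_def .

lemma g_cont: "continuous_on W g" using Ck_on_2_continuous_gradient[OF C2 open_W] .

lemma \<Gamma>_deriv: "x \<in> W \<Longrightarrow> (\<Gamma> has_derivative (\<lambda>h. h \<bullet> g x)) (at x)"
  using Ck_on_2_GDERIV[OF C2] by (simp add: gderiv_def)

lemma \<Gamma>_cont: "continuous_on W \<Gamma>"
  using \<Gamma>_deriv by (meson continuous_at_imp_continuous_on has_derivative_continuous)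

lemma hess_linear: "x \<in> W \<Longrightarrow> linear (hess x)"
  using g_deriv has_derivative_linear by blast

lemma hess_cont: "b \<in> Basis \<Longrightarrow> continuous_on W (\<lambda>x. hess x b)"
  unfolding hess_def using C2 by (intro continuous_intros) (auto simp: numeral_2_eq_2)

lemma hess_trace: "x \<in> W \<Longrightarrow> (\<Sum>b\<in>Basis. hess x b \<bullet> b) = 0"
  using harmonic frechet_derivative_at[OF g_deriv] by (auto simp: harmonic_on_def divergence_def)

lemma norm_g_deriv:
  assumes "x \<in> W" shows "((\<lambda>y. norm (g y)) has_derivative (\<lambda>h. (g x \<bullet> hess x h) / norm (g x))) (at x)"
proof -
  have "(norm has_derivative (\<lambda>h. h \<bullet> sgn (g x))) (at (g x))"
    using GDERIV_norm[OF grad_nonzero[OF assms]] by (simp add: gderiv_def)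
  then have "((\<lambda>y. norm (g y)) has_derivative (\<lambda>h. hess x h \<bullet> sgn (g x))) (at x)"
    using diff_chain_at[OF g_deriv[OF assms]] by (fastforce simp: o_def)
  then show ?thesis by (rule has_derivative_eq_rhs) (auto simp: sgn_div_norm inner_commute divide_inverse mult.commute)
qed

definition dnu :: "'a \<Rightarrow> 'a \<Rightarrow> 'a" where
  "dnu x h = inverse (norm (g x)) *\<^sub>R hess x h - ((g x \<bullet> hess x h) * inverse (norm (g x)) ^ 3) *\<^sub>R g x"

lemma nu_deriv:
  assumes x: "x \<in> W" shows "(nu has_derivative dnu x) (at x)"
proof -
  have n0: "norm (g x) \<noteq> 0" using grad_nonzero[OF x] by simp
  have "((\<lambda>y. inverse (norm (g y))) has_derivative (\<lambda>h. - (inverse (norm (g x)) * ((g x \<bullet> hess x h) / norm (g x)) * inverse (norm (g x))))) (at x)"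
    by (rule Deriv.has_derivative_inverse[OF n0 norm_g_deriv[OF x]])
  from has_derivative_scaleR[OF this g_deriv[OF x]]
  have "(nu has_derivative (\<lambda>h. inverse (norm (g x)) *\<^sub>R hess x h +
     (- (inverse (norm (g x)) * ((g x \<bullet> hess x h) / norm (g x)) * inverse (norm (g x)))) *\<^sub>R g x)) (at x)"
    by (simp add: nu_def[abs_def])
  then show ?thesis
    by (rule has_derivative_eq_rhs) (auto simp: dnu_def fun_eq_iff divide_inverse power3_eq_cube mult.assoc mult.left_commute)
qed

lemma div_nu_sum: "x \<in> W \<Longrightarrow> divergence nu x = (\<Sum>b\<in>Basis. dnu x b \<bullet> b)"
  using frechet_derivative_at[OF nu_deriv] by (auto simp: divergence_def)

lemma sum_hess_Basis: "x \<in> W \<Longrightarrow> (\<Sum>b\<in>Basis. (v \<bullet> b) * (w \<bullet> hess x b)) = w \<bullet> hess x v"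
proof -
  assume x: "x \<in> W"
  have "hess x v = hess x (\<Sum>b\<in>Basis. (v \<bullet> b) *\<^sub>R b)" by (simp add: euclidean_representation)
  also have "\<dots> = (\<Sum>b\<in>Basis. (v \<bullet> b) *\<^sub>R hess x b)"
    by (simp add: linear_sum[OF hess_linear[OF x]] linear_cmul[OF hess_linear[OF x]])
  finally show ?thesis by (simp add: inner_sum_right)
qed

text \<open>Harmonicity removes the trace of the Hessian, and only the second derivative of \<open>\<Gamma>\<close> along \<open>\<nabla>\<Gamma>\<close> is left.\<close>

lemma div_nu: "x \<in> W \<Longrightarrow> divergence nu x = - ((g x \<bullet> hess x (g x)) * inverse (norm (g x)) ^ 3)"
proof -
  assume x: "x \<in> W"
  have "divergence nu x = (\<Sum>b\<in>Basis. inverse (norm (g x)) * (hess x b \<bullet> b) - inverse (norm (g x)) ^ 3 * ((g x \<bullet> b) * (g x \<bullet> hess x b)))"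
    unfolding div_nu_sum[OF x] by (rule sum.cong) (auto simp: dnu_def inner_diff_left mult.assoc mult.left_commute mult.commute)
  also have "\<dots> = inverse (norm (g x)) * (\<Sum>b\<in>Basis. hess x b \<bullet> b) - inverse (norm (g x)) ^ 3 * (g x \<bullet> hess x (g x))"
    unfolding sum_subtractf by (simp only: sum_distrib_left[symmetric] sum_hess_Basis[OF x])
  finally show ?thesis by (simp add: hess_trace[OF x] mult.commute)
qed

lemma nu_cont: "continuous_on W nu"
  unfolding nu_def using grad_nonzero by (intro continuous_intros g_cont) auto

lemma slope_cont: "continuous_on W slope"
  unfolding slope_def using \<Gamma>_pos by (intro continuous_intros g_cont \<Gamma>_cont) (auto dest: less_imp_neq[symmetric] simp: less_imp_neq[symmetric])

lemma dnu_cont: "b \<in> Basis \<Longrightarrow> continuous_on W (\<lambda>x. dnu x b)"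
  unfolding dnu_def using grad_nonzero by (intro continuous_intros g_cont hess_cont) auto

lemma div_nu_cont: "continuous_on W (divergence nu)"
proof -
  have "continuous_on W (\<lambda>x. \<Sum>b\<in>Basis. dnu x b \<bullet> b)" by (intro continuous_intros dnu_cont)
  then show ?thesis by (rule continuous_on_eq) (simp add: div_nu_sum)
qed

definition dslope :: "'a \<Rightarrow> 'a \<Rightarrow> real" where
  "dslope x h = (g x \<bullet> hess x h) * inverse (norm (g x)) * inverse (\<Gamma> x) - norm (g x) * (h \<bullet> g x) * (inverse (\<Gamma> x))\<^sup>2"

lemma slope_deriv:
  assumes x: "x \<in> W" shows "(slope has_derivative dslope x) (at x)"
proof -
  have n0: "\<Gamma> x \<noteq> 0" using \<Gamma>_pos[OF x] by simp
  have "((\<lambda>y. norm (g y) * inverse (\<Gamma> y)) has_derivative (\<lambda>h. norm (g x) * - (inverse (\<Gamma> x) * (h \<bullet> g x) * inverse (\<Gamma> x)) + ((g x \<bullet> hess x h) / norm (g x)) * inverse (\<Gamma> x))) (at x)"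
    by (rule has_derivative_mult[OF norm_g_deriv[OF x] Deriv.has_derivative_inverse[OF n0 \<Gamma>_deriv[OF x]]])
  then have "(slope has_derivative (\<lambda>h. norm (g x) * - (inverse (\<Gamma> x) * (h \<bullet> g x) * inverse (\<Gamma> x)) + ((g x \<bullet> hess x h) / norm (g x)) * inverse (\<Gamma> x))) (at x)"
    by (simp add: slope_def[abs_def] divide_inverse)
  then show ?thesis
    by (rule has_derivative_eq_rhs) (auto simp: dslope_def fun_eq_iff divide_inverse power2_eq_square algebra_simps)
qed

lemma dslope_cont: "b \<in> Basis \<Longrightarrow> continuous_on W (\<lambda>x. dslope x b)"
  unfolding dslope_def using grad_nonzero \<Gamma>_pos
  by (intro continuous_intros g_cont hess_cont \<Gamma>_cont) (auto simp: less_imp_neq[symmetric])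

text \<open>The derivative of \<open>|\<nabla>\<Gamma>|\<close> along \<open>\<nu>\<close> is \<open>- |\<nabla>\<Gamma>| div \<nu>\<close>, by the formula for \<open>div \<nu>\<close> above.\<close>

lemma sum_nu_dslope: "x \<in> W \<Longrightarrow> (\<Sum>b\<in>Basis. (nu x \<bullet> b) * dslope x b) = - (slope x * divergence nu x + (slope x)\<^sup>2)"
proof -
  assume x: "x \<in> W"
  let ?n = "norm (g x)" and ?i = "inverse (norm (g x))" and ?k = "inverse (\<Gamma> x)" and ?H = "g x \<bullet> hess x (g x)"
  have i: "?n * ?i = 1" using grad_nonzero[OF x] by simp
  have "(\<Sum>b\<in>Basis. (nu x \<bullet> b) * dslope x b) =
     (\<Sum>b\<in>Basis. ?i * ?i * ?k * ((g x \<bullet> b) * (g x \<bullet> hess x b)) - ?i * ?n * ?k\<^sup>2 * ((g x \<bullet> b) * (g x \<bullet> b)))"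
    by (rule sum.cong) (auto simp: nu_def dslope_def algebra_simps inner_commute)
  also have "\<dots> = ?i * ?i * ?k * ?H - ?i * ?n * ?k\<^sup>2 * (g x \<bullet> g x)"
    unfolding sum_subtractf by (simp only: sum_distrib_left[symmetric] sum_hess_Basis[OF x] euclidean_inner[symmetric])
  also have "\<dots> = - (?n * ?k * (- (?H * ?i ^ 3)) + (?n * ?k)\<^sup>2)"
  proof -
    have "g x \<bullet> g x = ?n\<^sup>2" by (simp add: power2_norm_eq_inner)
    then show ?thesis using i by algebra
  qed
  also have "\<dots> = - (slope x * divergence nu x + (slope x)\<^sup>2)"
    by (simp add: slope_def div_nu[OF x] divide_inverse)
  finally show ?thesis .
qed

text \<open>The quantities \<open>p\<close> (half the horizontal speed) and \<open>q\<close> of the introduction, and the field itself.\<close>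

definition hor :: "'a \<times> real \<Rightarrow> real" where
  "hor z = min (\<beta> * snd z) (slope (fst z) * (1 - snd z))"

definition cut :: "'a \<times> real \<Rightarrow> real" where
  "cut z = min (snd z) (slope (fst z) / (slope (fst z) + \<beta>))"

definition field :: "'a \<times> real \<Rightarrow> 'a \<times> real" where
  "field z = (- (2 * hor z) *\<^sub>R nu (fst z),
     \<beta> * (cut z)\<^sup>2 * divergence nu (fst z) + (hor z)\<^sup>2 - \<beta>\<^sup>2 * (cut z)\<^sup>2)"

lemma cont_fst: "continuous_on W f \<Longrightarrow> continuous_on (W \<times> T) (\<lambda>z. f (fst z))"
  by (rule continuous_on_compose2[of W f]) (auto intro: continuous_intros)

lemma field_cont: "continuous_on (W \<times> T) field"
proof -
  have "slope (fst z) + \<beta> \<noteq> 0" if "z \<in> W \<times> T" for z using slope_pos[of "fst z"] \<beta>_pos that by force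
  then show ?thesis
    unfolding field_def hor_def cut_def
    by (intro continuous_intros cont_fst[OF slope_cont] cont_fst[OF nu_cont] cont_fst[OF div_nu_cont] ballI) auto
qed

lemma has_derivative_directional_real:
  fixes f :: "'a \<Rightarrow> real"
  assumes "(f has_derivative f') (at x)"
  shows "((\<lambda>s. f (x + s *\<^sub>R b)) has_real_derivative f' b) (at 0)"
  using differentiable_directional[of f x b] assms frechet_derivative_at[OF assms]
  by (auto simp: differentiable_def)

text \<open>The potential is \<open>\<Psi> = - profile \<beta> (slope x) t \<cdot> \<nu>(x)\<close>.\<close>

lemma field_divergence_free: "distr_divergence_free_on (W \<times> {0<..<1}) field"
proof (rule distr_divergence_free_potential)
  let ?V = "W \<times> {0<..<1::real}"
  let ?\<Psi> = "\<lambda>b z. - (nu (fst z) \<bullet> b) * profile \<beta> (slope (fst z)) (snd z)"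
  let ?\<Psi>t = "\<lambda>b z. - (nu (fst z) \<bullet> b) * (2 * hor z)"
  let ?\<Psi>x = "\<lambda>b z. - ((dnu (fst z) b \<bullet> b) * profile \<beta> (slope (fst z)) (snd z) +
     (nu (fst z) \<bullet> b) * (profile_a \<beta> (slope (fst z)) (snd z) * dslope (fst z) b))"
  show "open ?V" by (intro open_Times open_W open_greaterThanLessThan)
  have sb: "slope (fst z) + \<beta> \<noteq> 0" if "z \<in> ?V" for z using slope_pos[of "fst z"] \<beta>_pos that by force
  have c1: "continuous_on ?V (\<lambda>z. profile \<beta> (slope (fst z)) (snd z))"
    unfolding profile_def by (intro continuous_intros cont_fst[OF slope_cont] ballI sb)
  have c2: "continuous_on ?V (\<lambda>z. profile_a \<beta> (slope (fst z)) (snd z))"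
    unfolding profile_a_def by (intro continuous_intros cont_fst[OF slope_cont] ballI sb)
  show "continuous_on ?V (?\<Psi> b)" if "b \<in> Basis" for b
    by (intro continuous_intros c1 cont_fst[OF nu_cont])
  show "continuous_on ?V (?\<Psi>t b)" if "b \<in> Basis" for b
    unfolding hor_def by (intro continuous_intros cont_fst[OF nu_cont] cont_fst[OF slope_cont])
  show "continuous_on ?V (?\<Psi>x b)" if "b \<in> Basis" for b
    by (intro continuous_intros c1 c2 cont_fst[OF nu_cont] cont_fst[OF dnu_cont[OF that]] cont_fst[OF dslope_cont[OF that]])
  fix b :: 'a and z assume b: "b \<in> Basis" and z: "z \<in> ?V"
  obtain x t where zt: "z = (x, t)" and x: "x \<in> W" using z by (cases z) auto
  show "((\<lambda>s. ?\<Psi> b (z + s *\<^sub>R (0, 1))) has_real_derivative ?\<Psi>t b z) (at 0)"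
  proof -
    have "((\<lambda>s. profile \<beta> (slope x) (s + t)) has_real_derivative 2 * min (\<beta> * t) (slope x * (1 - t))) (at 0)"
      using DERIV_profile_t[OF \<beta>_pos slope_pos[OF x], of t] DERIV_shift[of "profile \<beta> (slope x)" _ 0 t] by simp
    then have "((\<lambda>s. profile \<beta> (slope x) (t + s)) has_real_derivative 2 * hor z) (at 0)"
      by (simp add: hor_def zt add.commute)
    then show ?thesis by (simp add: zt) (drule DERIV_cmult[where c="- (nu x \<bullet> b)"], simp)
  qed
  show "((\<lambda>s. ?\<Psi> b (z + s *\<^sub>R (b, 0))) has_real_derivative ?\<Psi>x b z) (at 0)"
  proof -
    have 1: "((\<lambda>s. nu (x + s *\<^sub>R b) \<bullet> b) has_real_derivative dnu x b \<bullet> b) (at 0)"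
      using has_derivative_directional_real[OF has_derivative_inner_left[OF nu_deriv[OF x], of b], of b] .
    have 2: "((\<lambda>s. slope (x + s *\<^sub>R b)) has_real_derivative dslope x b) (at 0)"
      by (rule has_derivative_directional_real[OF slope_deriv[OF x]])
    have "((\<lambda>a. profile \<beta> a t) has_real_derivative profile_a \<beta> (slope x) t) (at (slope (x + 0 *\<^sub>R b)))"
      using DERIV_profile_a[OF \<beta>_pos slope_pos[OF x]] by simp
    from DERIV_chain2[OF this 2]
    have 3: "((\<lambda>s. profile \<beta> (slope (x + s *\<^sub>R b)) t) has_real_derivative profile_a \<beta> (slope x) t * dslope x b) (at 0)" .
    have "((\<lambda>s. - (nu (x + s *\<^sub>R b) \<bullet> b) * profile \<beta> (slope (x + s *\<^sub>R b)) t) has_real_derivative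
       - (dnu x b \<bullet> b) * profile \<beta> (slope (x + 0 *\<^sub>R b)) t + (profile_a \<beta> (slope x) t * dslope x b) * - (nu (x + 0 *\<^sub>R b) \<bullet> b)) (at 0)"
      by (intro DERIV_mult DERIV_minus 1 3)
    then show ?thesis by (simp add: zt algebra_simps)
  qed
  show "fst (field z) \<bullet> b = ?\<Psi>t b z" by (simp add: field_def)
next
  fix z assume z: "z \<in> W \<times> {0<..<1::real}"
  then have x: "fst z \<in> W" by auto
  let ?a = "slope (fst z)" and ?d = "divergence nu (fst z)"
  have "(\<Sum>b\<in>Basis. (dnu (fst z) b \<bullet> b) * profile \<beta> ?a (snd z) + (nu (fst z) \<bullet> b) * (profile_a \<beta> ?a (snd z) * dslope (fst z) b))
     = (\<Sum>b\<in>Basis. dnu (fst z) b \<bullet> b) * profile \<beta> ?a (snd z) + profile_a \<beta> ?a (snd z) * (\<Sum>b\<in>Basis. (nu (fst z) \<bullet> b) * dslope (fst z) b)"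
    by (simp add: sum.distrib sum_distrib_left sum_distrib_right mult.left_commute)
  also have "\<dots> = profile \<beta> ?a (snd z) * ?d - profile_a \<beta> ?a (snd z) * (?a * ?d + ?a\<^sup>2)"
    unfolding div_nu_sum[OF x, symmetric] sum_nu_dslope[OF x] by (simp add: algebra_simps)
  also have "\<dots> = snd (field z)"
    by (simp add: profile_identity[OF \<beta>_pos slope_pos[OF x]] field_def hor_def cut_def)
  finally show "snd (field z) = - (\<Sum>b\<in>Basis. - ((dnu (fst z) b \<bullet> b) * profile \<beta> (slope (fst z)) (snd z) +
     (nu (fst z) \<bullet> b) * (profile_a \<beta> (slope (fst z)) (snd z) * dslope (fst z) b)))"
    unfolding sum_negf by simp
qed

lemma hor_bounds: "x \<in> W \<Longrightarrow> t \<in> {0..1} \<Longrightarrow> 0 \<le> hor (x, t) \<and> hor (x, t) \<le> \<beta> * t"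
  using slope_pos[of x] \<beta>_pos by (auto simp: hor_def)

lemma cut_bounds: "x \<in> W \<Longrightarrow> t \<in> {0..1} \<Longrightarrow> 0 \<le> cut (x, t) \<and> cut (x, t) \<le> 1"
  using slope_pos[of x] \<beta>_pos by (auto simp: cut_def)

end

section \<open>The calibration\<close>

lemma density_zero_at_continuous:
  assumes cont: "continuous (at z\<^sub>0 within D) (\<lambda>z. \<phi> z \<bullet> v)" and \<epsilon>: "\<epsilon> > 0"
  shows "density_zero_at {z\<in>D. \<bar>(\<phi> z - \<phi> z\<^sub>0) \<bullet> v\<bar> > \<epsilon>} z\<^sub>0"
proof -
  obtain d where d: "d > 0" "\<And>z. z \<in> D \<Longrightarrow> dist z z\<^sub>0 < d \<Longrightarrow> dist (\<phi> z \<bullet> v) (\<phi> z\<^sub>0 \<bullet> v) < \<epsilon>"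
    using cont \<epsilon> unfolding continuous_within_eps_delta by blast
  have empty: "{z\<in>D. \<bar>(\<phi> z - \<phi> z\<^sub>0) \<bullet> v\<bar> > \<epsilon>} \<inter> ball z\<^sub>0 r = {}" if "r < d" for r
  proof -
    have "\<bar>(\<phi> z - \<phi> z\<^sub>0) \<bullet> v\<bar> < \<epsilon>" if "z \<in> D" "z \<in> ball z\<^sub>0 r" for z
      using d(2)[of z] that \<open>r < d\<close> by (simp add: dist_real_def inner_diff_left dist_commute)
    then show ?thesis by force
  qed
  have "\<forall>\<^sub>F r in at_right 0. r < d" using d(1) by (auto simp: eventually_at_right_field)
  then have "\<forall>\<^sub>F r in at_right 0. measure lebesgue ({z\<in>D. \<bar>(\<phi> z - \<phi> z\<^sub>0) \<bullet> v\<bar> > \<epsilon>} \<inter> ball z\<^sub>0 r) / measure lebesgue (ball z\<^sub>0 r) = 0"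
    by eventually_elim (simp only: empty measure_empty div_0)
  then show ?thesis unfolding density_zero_at_def by (rule tendsto_eventually)
qed

lemma divergence_cong_open:
  assumes "open W" "x \<in> W" "\<And>y. y \<in> W \<Longrightarrow> F y = H y" "(H has_derivative H') (at x)"
  shows "divergence F x = divergence H x"
proof -
  have "(F has_derivative H') (at x)"
    by (rule has_derivative_transform_within_open[OF assms(4,1,2)]) (simp add: assms(3))
  then show ?thesis
    using frechet_derivative_at[OF assms(4)] frechet_derivative_at unfolding divergence_def by metis
qed

lemma interval_integral_ray:
  fixes n :: "'a::euclidean_space" and c :: "real \<Rightarrow> real"
  assumes "continuous_on UNIV c" "r \<le> s"
  shows "(LBINT t=ereal r..ereal s. c t *\<^sub>R n) = integral {r..s} (\<lambda>t. c t *\<^sub>R n)"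
    "(\<lambda>t. c t *\<^sub>R n) integrable_on {r..s}"
proof -
  have c: "continuous_on {r..s} (\<lambda>t. c t *\<^sub>R n)"
    by (intro continuous_intros continuous_on_subset[OF assms(1)]) auto
  then show "(\<lambda>t. c t *\<^sub>R n) integrable_on {r..s}" by (rule integrable_continuous_interval)
  have "set_integrable lborel {r..s} (\<lambda>t. c t *\<^sub>R n)"
    by (rule borel_integrable_atLeastAtMost') (rule c)
  then have "set_integrable lborel (einterval (ereal r) (ereal s)) (\<lambda>t. c t *\<^sub>R n)"
    by (rule set_integrable_subset) auto
  then show "(LBINT t=ereal r..ereal s. c t *\<^sub>R n) = integral {r..s} (\<lambda>t. c t *\<^sub>R n)"
    using assms(2) \<open>set_integrable lborel {r..s} _\<close> by (intro interval_integral_eq_integral)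
qed

lemma linear_profile_integral:
  assumes "r \<le> s" shows "((\<lambda>t. 2 * \<beta> * t) has_integral \<beta> * (s\<^sup>2 - r\<^sup>2)) {r..s::real}"
proof -
  have "((\<lambda>t. 2 * \<beta> * t) has_integral \<beta> * s\<^sup>2 - \<beta> * r\<^sup>2) {r..s}"
    by (rule fundamental_theorem_of_calculus[OF assms])
      (auto intro!: derivative_eq_intros simp flip: has_real_derivative_iff_has_vector_derivative)
  then show ?thesis by (simp add: right_diff_distrib)
qed

text \<open>The bound \<open>|\<phi>\<^sup>x| \<le> 2 \<beta> t\<close> integrates to \<open>\<beta> |s\<^sup>2 - r\<^sup>2|\<close>, which is stronger than required.\<close>

lemma norm_vertical_integral_le:
  fixes n :: "'a::euclidean_space" and c :: "real \<Rightarrow> real"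
  assumes c: "continuous_on UNIV c" and b: "\<And>t. t \<in> {0..1} \<Longrightarrow> 0 \<le> c t \<and> c t \<le> \<beta> * t"
    and n: "norm n = 1" and rs: "r \<in> {0..1}" "s \<in> {0..1}" and \<beta>: "\<beta> > 0"
  shows "norm (LBINT t=ereal r..ereal s. - (2 * c t) *\<^sub>R n) \<le> \<beta> * (r\<^sup>2 + s\<^sup>2)"
proof -
  have c': "continuous_on UNIV (\<lambda>t. - (2 * c t))" using c by (intro continuous_intros)
  have main: "norm (LBINT t=ereal r..ereal s. - (2 * c t) *\<^sub>R n) \<le> \<beta> * (r\<^sup>2 + s\<^sup>2)"
    if "r \<le> s" "r \<in> {0..1}" "s \<in> {0..1}" for r s
  proof -
    have "norm (integral {r..s} (\<lambda>t. - (2 * c t) *\<^sub>R n)) \<le> integral {r..s} (\<lambda>t. 2 * \<beta> * t)"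
    proof (rule integral_norm_bound_integral)
      show "(\<lambda>t. - (2 * c t) *\<^sub>R n) integrable_on {r..s}" by (rule interval_integral_ray(2)[OF c' that(1)])
      show "(\<lambda>t. 2 * \<beta> * t) integrable_on {r..s}" using linear_profile_integral[OF that(1)] by blast
      fix t assume "t \<in> {r..s}"
      then have "t \<in> {0..1}" using that by auto
      from b[OF this] show "norm (- (2 * c t) *\<^sub>R n) \<le> 2 * \<beta> * t" using n by simp
    qed
    also have "\<dots> = \<beta> * (s\<^sup>2 - r\<^sup>2)" using linear_profile_integral[OF that(1)] by (rule integral_unique)
    also have "\<dots> \<le> \<beta> * (r\<^sup>2 + s\<^sup>2)" using \<beta> by (intro mult_left_mono) auto
    finally show ?thesis unfolding interval_integral_ray(1)[OF c' that(1)] .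
  qed
  show ?thesis
  proof (cases "r \<le> s")
    case True then show ?thesis using main rs by blast
  next
    case False
    then have "norm (LBINT t=ereal s..ereal r. - (2 * c t) *\<^sub>R n) \<le> \<beta> * (s\<^sup>2 + r\<^sup>2)" using main rs by simp
    then show ?thesis by (subst interval_integral_endpoints_reverse) (simp add: add.commute)
  qed
qed

lemma vertical_integral_boundary:
  fixes n :: "'a::euclidean_space"
  shows "(LBINT t=ereal 0..ereal 1. - (2 * (\<beta> * t)) *\<^sub>R n) = - (\<beta> *\<^sub>R n)"
proof -
  have c: "continuous_on UNIV (\<lambda>t::real. - (2 * (\<beta> * t)))" by (intro continuous_intros)
  have "((\<lambda>t. (2 * \<beta> * t) *\<^sub>R n) has_integral (\<beta> * (1\<^sup>2 - 0\<^sup>2)) *\<^sub>R n) {0..1}"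
    by (intro has_integral_scaleR_left linear_profile_integral) simp
  then have "((\<lambda>t. - ((2 * \<beta> * t) *\<^sub>R n)) has_integral - ((\<beta> * (1\<^sup>2 - 0\<^sup>2)) *\<^sub>R n)) {0..1}"
    by (rule has_integral_neg)
  then have "((\<lambda>t. - (2 * (\<beta> * t)) *\<^sub>R n) has_integral - (\<beta> *\<^sub>R n)) {0..1}" by (simp add: mult.assoc)
  then have "integral {0..1} (\<lambda>t. - (2 * (\<beta> * t)) *\<^sub>R n) = - (\<beta> *\<^sub>R n)" by (rule integral_unique)
  then show ?thesis using interval_integral_ray(1)[OF c zero_le_one, of n] by (simp only:)
qed

text \<open>The field \<open>\<phi>\<close> is \<open>field\<close> off \<open>closure \<Omega>\<close> and \<open>(- 2 \<beta> t N, 0)\<close> on the boundary cylinder. The horizontal part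
  is continuous up to the cylinder for \<open>t < 1\<close>, since \<open>slope = |\<nabla>\<Gamma>| / \<Gamma>\<close> tends to infinity at the boundary, so
  that \<open>hor = \<beta> t\<close> nearby. The vertical part need not be, because \<open>div \<nu>\<close> is only assumed to be bounded.\<close>

lemma calibration_exists:
  fixes \<Omega> :: "'a::euclidean_space set"
  assumes \<beta>: "\<beta> > 0" and bd: "bounded \<Omega>" and op: "open \<Omega>" and C2b: "C2_boundary \<Omega>"
    and \<Gamma>c: "continuous_on (- \<Omega>) \<Gamma>"
    and pot: "harmonic_potential (- closure \<Omega>) \<Gamma> \<beta>"
    and \<Gamma>0: "\<And>x. x \<in> frontier \<Omega> \<Longrightarrow> \<Gamma> x = 0"
    and Gc: "continuous_on (- \<Omega>) G" and Gg: "\<And>x. x \<in> - closure \<Omega> \<Longrightarrow> G x = gradient \<Gamma> x"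
    and Gn: "\<And>x. x \<in> frontier \<Omega> \<Longrightarrow> \<exists>t>0. \<exists>v. outward_unit_normal \<Omega> x v \<and> G x = t *\<^sub>R v"
    and divb: "\<And>x. x \<in> - closure \<Omega> \<Longrightarrow> \<bar>divergence (harmonic_potential.nu \<Gamma>) x\<bar> \<le> M"
    and ineq: "\<And>x. x \<in> - closure \<Omega> \<Longrightarrow>
       (\<beta>\<^sup>2 - \<beta> * divergence (harmonic_potential.nu \<Gamma>) x) *
         (harmonic_potential.slope \<Gamma> x / (harmonic_potential.slope \<Gamma> x + \<beta>))\<^sup>2 \<le> \<gamma>\<^sup>2"
  shows "\<exists>\<phi>. calibration \<beta> \<gamma> \<Omega> (indicator \<Omega>) \<phi>"
proof -
  let ?W = "- closure \<Omega>" and ?D = "(- \<Omega>) \<times> {0..1::real}"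
  interpret harmonic_potential ?W \<Gamma> \<beta> by (rule pot)
  have fr: "frontier \<Omega> = closure \<Omega> - \<Omega>" using op by (simp add: frontier_def interior_open)
  have G_frontier: "outward_unit_normal \<Omega> x (G x /\<^sub>R norm (G x))" "G x \<noteq> 0" if xfr: "x \<in> frontier \<Omega>" for x
  proof -
    obtain t v where t: "t > 0" and v: "outward_unit_normal \<Omega> x v" "G x = t *\<^sub>R v" using Gn[OF xfr] by blast
    have "norm v = 1" using v(1) by (simp add: outward_unit_normal_def unit_normal_def)
    then show "G x \<noteq> 0" "outward_unit_normal \<Omega> x (G x /\<^sub>R norm (G x))" using v t by auto
  qed
  have G0: "G x \<noteq> 0" if "x \<in> - \<Omega>" for x
    using that G_frontier(2)[of x] Gg[of x] grad_nonzero[of x] by (cases "x \<in> closure \<Omega>") (auto simp: fr)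
  define N' where "N' x = G x /\<^sub>R norm (G x)" for x
  have N'c: "continuous_on (- \<Omega>) N'" unfolding N'_def using G0 by (intro continuous_intros Gc) auto
  have N'n: "norm (N' x) = 1" if "x \<in> - \<Omega>" for x using G0[OF that] by (simp add: N'_def)
  have N'nu: "N' x = nu x" if "x \<in> ?W" for x using Gg[OF that] by (simp add: N'_def nu_def)
  \<comment> \<open>An arbitrary unit vector, used as the value of \<open>N\<close> off the boundary.\<close>
  define u0 :: 'a where "u0 = (SOME b. b \<in> Basis)"
  have u0: "norm u0 = 1" unfolding u0_def by (simp add: norm_Basis SOME_Basis)
  define N where "N x = (if x \<in> frontier \<Omega> then N' x else u0)" for x
  have Nn: "norm (N x) = 1" for x using N'n[of x] u0 by (auto simp: N_def fr)
  have Nout: "outward_unit_normal \<Omega> x (N x)" if "x \<in> frontier \<Omega>" for x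
    using G_frontier(1)[OF that] that by (simp add: N_def N'_def)
  have Nm[measurable]: "N \<in> borel_measurable borel"
    unfolding N_def
  proof (subst measurable_If_restrict_space_iff)
    show "{x \<in> space borel. x \<in> frontier \<Omega>} \<in> sets borel" by (simp add: borel_closed)
    have "continuous_on (frontier \<Omega>) N'" by (rule continuous_on_subset[OF N'c]) (auto simp: fr)
    then have "N' \<in> borel_measurable (restrict_space borel (frontier \<Omega>))"
      by (rule borel_measurable_continuous_on_restrict)
    then show "N' \<in> borel_measurable (restrict_space borel {x. x \<in> frontier \<Omega>}) \<and>
        (\<lambda>x. u0) \<in> borel_measurable (restrict_space borel {x. x \<notin> frontier \<Omega>})" by simp
  qed
  have sbv: "sbv_gradient (indicator \<Omega>) (\<lambda>_. 0)"
    by (rule sbv_gradient_indicator[OF op bd C2b Nm Nn Nout])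
  define \<phi> where "\<phi> z = (if fst z \<in> closure \<Omega> then (- (2 * (\<beta> * snd z)) *\<^sub>R N (fst z), 0) else field z)" for z
  have \<phi>W: "\<phi> z = field z" if "fst z \<in> ?W" for z using that by (simp add: \<phi>_def)
  have \<phi>F: "\<phi> z = (- (2 * (\<beta> * snd z)) *\<^sub>R N (fst z), 0)" if "fst z \<in> frontier \<Omega>" for z
    using that by (simp add: \<phi>_def fr)
  have adm: "admissible \<Omega> (indicator \<Omega>)"
  proof -
    have "{x. indicator \<Omega> x \<noteq> (0::real)} = \<Omega>" by (auto simp: indicator_def)
    then show ?thesis
      unfolding admissible_def using bd op C2_boundary_imp_lipschitz_boundary[OF C2b] sbv
      by (auto simp: SBV_def indicator_def)
  qed
  have meas: "\<phi> \<in> borel_measurable (restrict_space borel ?D)"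
  proof (rule measurable_restrict_space1)
    show "\<phi> \<in> borel_measurable borel"
      unfolding \<phi>_def
    proof (subst measurable_If_restrict_space_iff)
      have cl: "closed {z :: 'a \<times> real. fst z \<in> closure \<Omega>}"
        using closed_vimage_fst[of "closure \<Omega>"] by (simp add: vimage_def)
      then show "{z \<in> space borel. fst z \<in> closure \<Omega>} \<in> sets (borel :: ('a \<times> real) measure)" by (simp add: borel_closed)
      have "(\<lambda>z. (- (2 * (\<beta> * snd z)) *\<^sub>R N (fst z), 0)) \<in> (borel :: ('a \<times> real) measure) \<rightarrow>\<^sub>M (borel :: ('a \<times> real) measure)"
        unfolding borel_prod[symmetric] by measurable
      then have 1: "(\<lambda>z. (- (2 * (\<beta> * snd z)) *\<^sub>R N (fst z), 0)) \<in>
          restrict_space (borel :: ('a \<times> real) measure) {z. fst z \<in> closure \<Omega>} \<rightarrow>\<^sub>M (borel :: ('a \<times> real) measure)"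
        by (rule measurable_restrict_space1)
      have "{z :: 'a \<times> real. fst z \<notin> closure \<Omega>} = ?W \<times> UNIV" by auto
      then have 2: "field \<in> borel_measurable (restrict_space borel {z. fst z \<notin> closure \<Omega>})"
        using borel_measurable_continuous_on_restrict[OF field_cont[of UNIV]] by simp
      show "(\<lambda>z. (- (2 * (\<beta> * snd z)) *\<^sub>R N (fst z), 0 :: real)) \<in> borel_measurable (restrict_space borel {z. fst z \<in> closure \<Omega>}) \<and>
         field \<in> borel_measurable (restrict_space borel {z. fst z \<notin> closure \<Omega>})"
        using 1 2 by (rule conjI)
    qed
  qed
  have bounded: "bounded (\<phi> ` ?D)"
  proof -
    have "norm (\<phi> (x, t)) \<le> 2 * \<beta> + (\<beta> * M + \<beta>\<^sup>2 + \<beta>\<^sup>2)" if x: "x \<in> - \<Omega>" and t: "t \<in> {0..1}" for x t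
    proof -
      have bt: "\<beta> * t \<le> \<beta>" "0 \<le> \<beta> * t" using \<beta> t by (auto simp: mult_left_le)
      show ?thesis
      proof (cases "x \<in> closure \<Omega>")
        case True
        have "\<exists>x. x \<in> ?W"
        proof -
          have "closure \<Omega> \<noteq> UNIV" using bd not_bounded_UNIV bounded_closure by metis
          then show ?thesis by blast
        qed
        then have "M \<ge> 0" using divb abs_ge_zero order_trans by meson
        then have "0 \<le> \<beta> * M + \<beta>\<^sup>2 + \<beta>\<^sup>2" using \<beta> by simp
        moreover have "\<phi> (x, t) = (- (2 * (\<beta> * t)) *\<^sub>R N x, 0)" using \<phi>F[of "(x, t)"] True x by (simp add: fr)
        then have "norm (\<phi> (x, t)) \<le> norm (- (2 * (\<beta> * t)) *\<^sub>R N x) + norm (0::real)"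
          by (simp only: norm_Pair_le)
        then have "norm (\<phi> (x, t)) \<le> 2 * (\<beta> * t)" using bt Nn[of x] by simp
        ultimately show ?thesis using bt by linarith
      next
        case False
        then have xW: "x \<in> ?W" by simp
        let ?h = "hor (x, t)" and ?q = "cut (x, t)" and ?d = "divergence nu x"
        have h: "0 \<le> ?h" "?h \<le> \<beta>" using hor_bounds[OF xW t] bt by auto
        have q: "0 \<le> ?q" "?q \<le> 1" using cut_bounds[OF xW t] by auto
        have q2: "0 \<le> ?q\<^sup>2" "?q\<^sup>2 \<le> 1" using q by (auto simp: power_le_one)
        have "\<phi> (x, t) = (- (2 * ?h) *\<^sub>R nu x, \<beta> * ?q\<^sup>2 * ?d + ?h\<^sup>2 - \<beta>\<^sup>2 * ?q\<^sup>2)"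
          using \<phi>W[of "(x, t)"] xW by (simp add: field_def)
        then have "norm (\<phi> (x, t)) \<le> norm (- (2 * ?h) *\<^sub>R nu x) + norm (\<beta> * ?q\<^sup>2 * ?d + ?h\<^sup>2 - \<beta>\<^sup>2 * ?q\<^sup>2)"
          by (simp only: norm_Pair_le)
        moreover have "norm (- (2 * ?h) *\<^sub>R nu x) \<le> 2 * \<beta>" using h norm_nu[OF xW] by simp
        moreover have "\<bar>\<beta> * ?q\<^sup>2 * ?d\<bar> \<le> \<beta> * M"
        proof -
          have "\<bar>\<beta> * ?q\<^sup>2 * ?d\<bar> = \<beta> * (?q\<^sup>2 * \<bar>?d\<bar>)" using \<beta> by (simp add: abs_mult)
          also have "\<dots> \<le> \<beta> * (1 * M)" using \<beta> q2 divb[OF xW] by (intro mult_left_mono mult_mono) auto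
          finally show ?thesis by simp
        qed
        moreover have "\<bar>?h\<^sup>2\<bar> \<le> \<beta>\<^sup>2" using h by (simp add: power_mono)
        moreover have "\<bar>\<beta>\<^sup>2 * ?q\<^sup>2\<bar> \<le> \<beta>\<^sup>2" using q2 by (simp add: mult_left_le)
        ultimately show ?thesis unfolding real_norm_def by linarith
      qed
    qed
    then show ?thesis unfolding bounded_iff by (intro exI[of _ "2 * \<beta> + (\<beta> * M + \<beta>\<^sup>2 + \<beta>\<^sup>2)"]) auto
  qed
  have contW: "isCont \<phi> z" if "fst z \<in> ?W" for z
  proof -
    have o: "open (?W \<times> (UNIV :: real set))" by (intro open_Times open_W open_UNIV)
    have "continuous_on (?W \<times> (UNIV :: real set)) \<phi>"
      by (rule continuous_on_eq[OF field_cont]) (auto simp: \<phi>_def)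
    then show ?thesis using continuous_on_eq_continuous_at[OF o] that by (cases z) auto
  qed
  have contF: "continuous (at z within ?D) (\<lambda>z. fst (\<phi> z))"
    if z: "fst z \<in> frontier \<Omega>" "snd z \<in> {0..<1}" for z
  proof -
    let ?F = "\<lambda>z. - (2 * (\<beta> * snd z)) *\<^sub>R N' (fst z)"
    \<comment> \<open>Where \<open>?h\<close> is positive, \<open>\<beta> t < slope (1 - t)\<close>; \<open>?h\<close> extends continuously to the boundary, where \<open>\<Gamma> = 0\<close>.\<close>
    let ?h = "\<lambda>z. norm (G (fst z)) * (1 - snd z) - \<beta> * snd z * \<Gamma> (fst z)"
    have zD: "z \<in> ?D" using z by (cases z) (auto simp: fr)
    have cf: "continuous_on ?D (\<lambda>z. f (fst z))" if "continuous_on (- \<Omega>) f" for f :: "'a \<Rightarrow> 'b::topological_space"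
      by (rule continuous_on_compose2[OF that]) (auto intro: continuous_intros)
    have Fc: "continuous_on ?D ?F" by (intro continuous_intros cf[OF N'c])
    have hc: "continuous_on ?D ?h" by (intro continuous_intros cf[OF Gc] cf[OF \<Gamma>c])
    have "fst z \<in> - \<Omega>" using z by (simp add: fr)
    then have "?h z > 0" using z \<Gamma>0[OF z(1)] G0 by simp
    moreover have "(?h \<longlongrightarrow> ?h z) (at z within ?D)" using hc zD unfolding continuous_on_def by blast
    ultimately have "\<forall>\<^sub>F y in at z within ?D. ?h y > 0" by (rule order_tendstoD(1)[rotated])
    moreover have "\<forall>\<^sub>F y in at z within ?D. y \<in> ?D" by (simp add: eventually_at_filter)
    ultimately have ev: "\<forall>\<^sub>F y in at z within ?D. ?F y = fst (\<phi> y)"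
    proof eventually_elim
      case (elim y)
      obtain x t where y: "y = (x, t)" by (cases y)
      show ?case
      proof (cases "x \<in> closure \<Omega>")
        case True
        then have "x \<in> frontier \<Omega>" using elim y by (auto simp: fr)
        then show ?thesis using \<phi>F[of y] y by (simp add: N_def)
      next
        case False
        then have xW: "x \<in> ?W" by simp
        have "\<beta> * t * \<Gamma> x \<le> norm (G x) * (1 - t)" using elim y by simp
        then have "\<beta> * t \<le> slope x * (1 - t)"
          using \<Gamma>_pos[OF xW] Gg[OF xW] by (simp add: slope_def pos_le_divide_eq)
        then have "hor y = \<beta> * t" by (simp add: hor_def y)
        then show ?thesis using \<phi>W[of y] xW y N'nu[OF xW] by (simp add: field_def)
      qed
    qed
    have "(?F \<longlongrightarrow> ?F z) (at z within ?D)" using Fc zD unfolding continuous_on_def by blast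
    then have "((\<lambda>y. fst (\<phi> y)) \<longlongrightarrow> ?F z) (at z within ?D)" using ev by (rule Lim_transform_eventually)
    moreover have "fst (\<phi> z) = ?F z" using \<phi>F[OF z(1)] z(1) by (simp add: N_def)
    ultimately show ?thesis by (simp add: continuous_within)
  qed
  have reg: "approx_regular_on ?D \<phi>"
    unfolding approx_regular_on_def
  proof (intro allI impI)
    fix S :: "('a \<times> real) set" assume "lipschitz_hypersurface S"
    \<comment> \<open>\<open>E1\<close> and \<open>E2\<close> contain the points of the cylinder at which approximate regularity may fail. The set \<open>E2\<close> is horizontal, hence tangent to \<open>(0, 1)\<^sup>\<bottom>\<close>.\<close>
    define E1 where "E1 = {z \<in> S \<inter> (frontier \<Omega> \<times> {0..1}). \<exists>v. unit_normal S z v \<and> snd v \<noteq> 0}"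
    define E2 where "E2 = frontier \<Omega> \<times> {1::real}"
    have E1: "hausdorff_outer DIM('a) E1 = 0"
    proof (rule hausdorff_null_transversal[OF op bd C2b])
      show "E1 \<subseteq> frontier \<Omega> \<times> {0..1}" by (auto simp: E1_def)
      fix z assume "z \<in> E1"
      then obtain v where v: "unit_normal S z v" "snd v \<noteq> 0" by (auto simp: E1_def)
      moreover have "E1 \<subseteq> S" by (auto simp: E1_def)
      ultimately show "\<exists>v. snd v \<noteq> 0 \<and> ((\<lambda>y. ((y - z) \<bullet> v) / norm (y - z)) \<longlongrightarrow> 0) (at z within E1)"
        unfolding unit_normal_def by (meson tendsto_within_subset)
    qed
    have E2: "hausdorff_outer DIM('a) E2 = 0"
    proof (rule hausdorff_null_transversal[OF op bd C2b])
      show "E2 \<subseteq> frontier \<Omega> \<times> {0..1}" by (auto simp: E2_def)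
      fix z assume z: "z \<in> E2"
      have "\<forall>\<^sub>F y in at z within E2. ((y - z) \<bullet> (0, 1)) / norm (y - z) = 0"
        unfolding eventually_at_filter using z by (auto simp: E2_def inner_prod_def intro!: always_eventually)
      then have "((\<lambda>y. ((y - z) \<bullet> (0, 1)) / norm (y - z)) \<longlongrightarrow> 0) (at z within E2)" by (rule tendsto_eventually)
      then show "\<exists>v. snd v \<noteq> 0 \<and> ((\<lambda>y. ((y - z) \<bullet> v) / norm (y - z)) \<longlongrightarrow> 0) (at z within E2)"
        by (intro exI[of _ "(0, 1)"]) simp
    qed
    have dens: "density_zero_at {y\<in>?D. \<bar>(\<phi> y - \<phi> z) \<bullet> v\<bar> > \<epsilon>} z"
      if z: "z \<in> S \<inter> ?D" "z \<notin> E1 \<union> E2" and v: "unit_normal S z v" and \<epsilon>: "\<epsilon> > 0" for z v \<epsilon>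
    proof (rule density_zero_at_continuous[OF _ \<epsilon>])
      show "continuous (at z within ?D) (\<lambda>z. \<phi> z \<bullet> v)"
      proof (cases "fst z \<in> closure \<Omega>")
        case False
        then have "isCont \<phi> z" by (intro contW) simp
        then have "continuous (at z within ?D) \<phi>" by (rule continuous_at_imp_continuous_at_within)
        then show ?thesis by (intro continuous_inner continuous_const)
      next
        case True
        then have zf: "fst z \<in> frontier \<Omega>" using z(1) by (cases z) (auto simp: fr)
        moreover have "snd z \<in> {0..<1}" using z zf by (cases z) (auto simp: E2_def less_le)
        ultimately have "continuous (at z within ?D) (\<lambda>z. fst (\<phi> z))" by (rule contF)
        moreover have "snd v = 0" using z zf v by (cases z, cases v) (auto simp: E1_def)
        ultimately have "continuous (at z within ?D) (\<lambda>z. fst (\<phi> z) \<bullet> fst v)" by (intro continuous_inner continuous_const)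
        then show ?thesis using \<open>snd v = 0\<close> by (simp add: inner_prod_def)
      qed
    qed
    show "hausdorff_ae (DIM('a \<times> real) - 1) (S \<inter> ?D)
        (\<lambda>z\<^sub>0. \<forall>v. unit_normal S z\<^sub>0 v \<longrightarrow> (\<forall>\<epsilon>>0. density_zero_at {z\<in>?D. \<bar>(\<phi> z - \<phi> z\<^sub>0) \<bullet> v\<bar> > \<epsilon>} z\<^sub>0))"
      unfolding hausdorff_ae_def
    proof (rule hausdorff_outer_zero_subset[OF _ subsetI])
      show "hausdorff_outer (DIM('a \<times> real) - 1) (E1 \<union> E2) = 0"
        using hausdorff_outer_zero_Un[OF E1 E2] by simp
      fix z assume "z \<in> {z \<in> S \<inter> ?D. \<not> (\<forall>v. unit_normal S z v \<longrightarrow> (\<forall>\<epsilon>>0. density_zero_at {y\<in>?D. \<bar>(\<phi> y - \<phi> z) \<bullet> v\<bar> > \<epsilon>} z))}"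
      then show "z \<in> E1 \<union> E2" using dens by blast
    qed
  qed
  have divf: "distr_divergence_free_on (?W \<times> {0<..<1::real}) \<phi>"
    unfolding distr_divergence_free_on_def
  proof (intro allI impI)
    fix \<psi> :: "'a \<times> real \<Rightarrow> real" assume \<psi>: "test_function_on (?W \<times> {0<..<1}) \<psi>"
    have "\<phi> z \<bullet> gradient \<psi> z = field z \<bullet> gradient \<psi> z" for z
    proof (cases "fst z \<in> closure \<Omega>")
      case True
      let ?O = "- closure {z. \<psi> z \<noteq> 0}"
      have zO: "z \<in> ?O" using \<psi> True by (cases z) (auto simp: test_function_on_def)
      have "gradient \<psi> z = 0"
        by (rule gradient_zero_open[OF _ zO]) (use closure_subset[of "{z. \<psi> z \<noteq> 0}"] in \<open>auto intro: open_Compl closed_closure\<close>)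
      then show ?thesis by simp
    qed (simp add: \<phi>_def)
    then show "(LINT z|lborel. \<phi> z \<bullet> gradient \<psi> z) = 0"
      using field_divergence_free \<psi> unfolding distr_divergence_free_on_def by simp
  qed
  \<comment> \<open>As \<open>q \<le> \<delta>\<close>, the hypothesis on \<open>\<delta>\<close> bounds \<open>q\<^sup>2 (\<beta>\<^sup>2 - \<beta> div \<nu>)\<close> by \<open>\<gamma>\<^sup>2\<close> when the second factor is positive; \<open>q = 0\<close> at \<open>t = 0\<close>.\<close>
  have a: "snd (\<phi> (x, t)) \<ge> 1 / 4 * (norm (fst (\<phi> (x, t))))\<^sup>2 - \<gamma>\<^sup>2 * indicator {0<..} t"
    if x: "x \<in> ?W" and t: "t \<in> {0..1}" for x t
  proof -
    let ?q = "cut (x, t)" and ?d = "divergence nu x" and ?\<delta> = "slope x / (slope x + \<beta>)"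
    have q: "0 \<le> ?q" "?q \<le> ?\<delta>" using cut_bounds[OF x t] by (auto simp: cut_def)
    have n: "1 / 4 * (norm (fst (\<phi> (x, t))))\<^sup>2 = (hor (x, t))\<^sup>2"
      using \<phi>W[of "(x, t)"] x norm_nu[OF x] by (simp add: field_def power_mult_distrib)
    have "?q\<^sup>2 * (\<beta>\<^sup>2 - \<beta> * ?d) \<le> \<gamma>\<^sup>2 * indicator {0<..} t"
    proof (cases "t > 0 \<and> \<beta>\<^sup>2 - \<beta> * ?d \<ge> 0")
      case True
      have "?q\<^sup>2 * (\<beta>\<^sup>2 - \<beta> * ?d) \<le> ?\<delta>\<^sup>2 * (\<beta>\<^sup>2 - \<beta> * ?d)"
        using True q by (intro mult_right_mono power_mono) auto
      also have "\<dots> \<le> \<gamma>\<^sup>2" using ineq[OF x] by (simp add: mult.commute)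
      finally show ?thesis using True by simp
    next
      case False
      show ?thesis
      proof (cases "t > 0")
        case True
        then have "?q\<^sup>2 * (\<beta>\<^sup>2 - \<beta> * ?d) \<le> 0" using False by (intro mult_nonneg_nonpos) auto
        then show ?thesis using True by simp (smt (verit) zero_le_power2)
      next
        case F: False
        then have "t = 0" using t by simp
        then have "?q = 0" using slope_pos[OF x] \<beta> by (simp add: cut_def)
        then show ?thesis using F by simp
      qed
    qed
    moreover have "snd (\<phi> (x, t)) = (hor (x, t))\<^sup>2 - ?q\<^sup>2 * (\<beta>\<^sup>2 - \<beta> * ?d)"
      using \<phi>W[of "(x, t)"] x by (simp add: field_def algebra_simps)
    ultimately show ?thesis using n by linarith
  qed
  have b: "norm (LBINT t=ereal r..ereal s. fst (\<phi> (x, t))) \<le> \<beta> * (r\<^sup>2 + s\<^sup>2)"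
    if x: "x \<in> - \<Omega>" and rs: "r \<in> {0..1}" "s \<in> {0..1}" for x r s
  proof (cases "x \<in> closure \<Omega>")
    case True
    then have "fst (\<phi> (x, t)) = - (2 * (\<beta> * t)) *\<^sub>R N x" for t by (simp add: \<phi>_def)
    then show ?thesis
      using norm_vertical_integral_le[of "\<lambda>t. \<beta> * t" \<beta> "N x" r s] rs \<beta> Nn by (simp add: continuous_intros)
  next
    case False
    then have xW: "x \<in> ?W" by simp
    have "fst (\<phi> (x, t)) = - (2 * hor (x, t)) *\<^sub>R nu x" for t using \<phi>W[of "(x, t)"] xW by (simp add: field_def)
    moreover have "continuous_on UNIV (\<lambda>t. hor (x, t))" unfolding hor_def by (simp, intro continuous_intros)
    ultimately show ?thesis
      using norm_vertical_integral_le[of "\<lambda>t. hor (x, t)" \<beta> "nu x" r s] rs \<beta> norm_nu[OF xW] hor_bounds[OF xW] by simp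
  qed
  have b': "(LBINT t=ereal p..ereal q. fst (\<phi> (x, t))) = (\<beta> * (p\<^sup>2 + q\<^sup>2)) *\<^sub>R v"
    if j: "jump_triple (indicator \<Omega>) x p q v" for x p q v
  proof -
    have xf: "x \<in> frontier \<Omega>"
      using j jump_set_indicator_subset_frontier[OF op] by (auto simp: jump_set_def)
    obtain e F gF U where ch: "C1_chart e F gF \<Omega> U" and xU: "x \<in> U" using C2_boundary_chart[OF C2b xf] by blast
    interpret C1_chart e F gF \<Omega> U by (rule ch)
    have pq: "p = 0" "q = 1" "v = - N x"
      using jump_triple_indicator[OF op xU xf j] outward_unit_normal_eq[OF xU xf op Nout[OF xf]] by auto
    have "fst (\<phi> (x, t)) = - (2 * (\<beta> * t)) *\<^sub>R N x" for t using \<phi>F[of "(x, t)"] xf by simp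
    then show ?thesis using vertical_integral_boundary[of \<beta> "N x"] by (simp add: pq)
  qed
  have a': "fst (\<phi> (x, 0)) = 0 \<and> snd (\<phi> (x, 0)) = 0" if x: "x \<in> ?W" for x
    using \<phi>W[of "(x, 0)"] x slope_pos[OF x] \<beta> by (simp add: field_def hor_def cut_def)
  have ind0: "indicator \<Omega> x = (0::real)" if "x \<notin> closure \<Omega>" for x using that closure_subset[of \<Omega>] by (auto simp: indicator_def)
  have "calibration \<beta> \<gamma> \<Omega> (indicator \<Omega>) \<phi>"
    unfolding calibration_def
  proof (intro conjI)
    show "admissible \<Omega> (indicator \<Omega>)" "\<phi> \<in> borel_measurable (restrict_space borel ?D)" "bounded (\<phi> ` ?D)"
      "approx_regular_on ?D \<phi>" "distr_divergence_free_on (?W \<times> {0<..<1}) \<phi>" by fact+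
    show "AE x in lborel. x \<notin> closure \<Omega> \<longrightarrow> (\<forall>t\<in>{0..1}. snd (\<phi> (x, t)) \<ge>
           1 / 4 * (norm (fst (\<phi> (x, t))))\<^sup>2 - \<gamma>\<^sup>2 * indicator {0<..} t)"
      using a by (intro AE_I2) simp
    show "hausdorff_ae (DIM('a) - 1) (- \<Omega>) (\<lambda>x. \<forall>r\<in>{0..1}. \<forall>s\<in>{0..1}.
          norm (LBINT t=ereal r..ereal s. fst (\<phi> (x, t))) \<le> \<beta> * (r\<^sup>2 + s\<^sup>2))"
      using b by (intro hausdorff_aeI) blast
    show "hausdorff_ae (DIM('a) - 1) (jump_set (indicator \<Omega>)) (\<lambda>x. \<forall>a b v. jump_triple (indicator \<Omega>) x a b v \<longrightarrow>
          (LBINT t=ereal a..ereal b. fst (\<phi> (x, t))) = (\<beta> * (a\<^sup>2 + b\<^sup>2)) *\<^sub>R v)"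
      using b' by (intro hausdorff_aeI) blast
    show "\<exists>g. sbv_gradient (indicator \<Omega>) g \<and> (AE x in lborel. x \<notin> closure \<Omega> \<longrightarrow>
           fst (\<phi> (x, indicator \<Omega> x)) = 2 *\<^sub>R g x \<and>
           snd (\<phi> (x, indicator \<Omega> x)) = (norm (g x))\<^sup>2 - \<gamma>\<^sup>2 * indicator {0<..} (indicator \<Omega> x :: real))"
      using sbv a' ind0 by (intro exI[of _ "\<lambda>_. 0"] conjI AE_I2) auto
  qed
  then show ?thesis by blast
qed

theorem theorem3p7:
  fixes \<beta> \<gamma> :: real
    and \<Omega> :: "(real ^ 'n) set"
    and \<Gamma> \<delta> :: "real ^ 'n \<Rightarrow> real"
    and \<nu> :: "real ^ 'n \<Rightarrow> real ^ 'n"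
  assumes "\<beta> > 0" and "\<gamma> > 0"
    and "\<Omega> \<noteq> {}" and "starlike \<Omega>" and "bounded \<Omega>" and "open \<Omega>" and "C2_boundary \<Omega>"
    and "continuous_on (- \<Omega>) \<Gamma>"
    and "harmonic_on (- closure \<Omega>) \<Gamma>" and "\<forall>x\<in>- closure \<Omega>. \<Gamma> x > 0"
    and "\<forall>x\<in>frontier \<Omega>. \<Gamma> x = 0"
    and "\<forall>x\<in>- closure \<Omega>. gradient \<Gamma> x \<noteq> 0"
    and "\<exists>G. continuous_on (- \<Omega>) G \<and> (\<forall>x\<in>- closure \<Omega>. G x = gradient \<Gamma> x) \<and>
           (\<forall>x\<in>frontier \<Omega>. \<exists>t>0. \<exists>v. outward_unit_normal \<Omega> x v \<and> G x = t *\<^sub>R v)"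
    and "\<forall>x\<in>- closure \<Omega>. \<nu> x = gradient \<Gamma> x /\<^sub>R norm (gradient \<Gamma> x)"
    and "\<forall>x\<in>- closure \<Omega>. \<delta> x = 1 / (1 + \<beta> * inverse (norm (gradient \<Gamma> x)) * \<Gamma> x)"
    and "bounded (divergence \<nu> ` (- closure \<Omega>))"
    and "\<forall>x\<in>- closure \<Omega>. (\<beta>\<^sup>2 - \<beta> * divergence \<nu> x) * (\<delta> x)\<^sup>2 \<le> \<gamma>\<^sup>2"
  shows "\<exists>\<phi>. calibration \<beta> \<gamma> \<Omega> (indicator \<Omega>) \<phi>"
proof -
  have pot: "harmonic_potential (- closure \<Omega>) \<Gamma> \<beta>"
    by unfold_locales (use assms in auto)
  interpret harmonic_potential "- closure \<Omega>" \<Gamma> \<beta> by (rule pot)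
  have div: "divergence \<nu> x = divergence nu x" if "x \<in> - closure \<Omega>" for x
    by (rule divergence_cong_open[OF open_W that _ nu_deriv[OF that]]) (use assms(14) in \<open>simp add: nu_def\<close>)
  have \<delta>: "\<delta> x = slope x / (slope x + \<beta>)" if x: "x \<in> - closure \<Omega>" for x
  proof -
    have "1 / (1 + \<beta> * inverse m * c) = (m / c) / (m / c + \<beta>)" if "m > 0" "c > 0" for m c :: real
    proof -
      have "m / c + \<beta> > 0" "1 + \<beta> * inverse m * c > 0" using that \<beta>_pos by (auto intro!: add_pos_pos)
      then show ?thesis using that by (simp add: divide_simps)
    qed
    then show ?thesis using assms(15) x norm_g_pos[OF x] \<Gamma>_pos[OF x] by (simp add: slope_def)
  qed
  obtain M where M: "\<And>x. x \<in> - closure \<Omega> \<Longrightarrow> \<bar>divergence \<nu> x\<bar> \<le> M"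
    using assms(16) by (auto simp: bounded_iff)
  obtain G where G: "continuous_on (- \<Omega>) G" "\<And>x. x \<in> - closure \<Omega> \<Longrightarrow> G x = gradient \<Gamma> x"
    "\<And>x. x \<in> frontier \<Omega> \<Longrightarrow> \<exists>t>0. \<exists>v. outward_unit_normal \<Omega> x v \<and> G x = t *\<^sub>R v"
    using assms(13) by blast
  have \<Gamma>0: "\<And>x. x \<in> frontier \<Omega> \<Longrightarrow> \<Gamma> x = 0" using assms(11) by blast
  show ?thesis
  proof (rule calibration_exists[OF assms(1,5,6,7,8) pot \<Gamma>0 G])
    show "\<bar>divergence nu x\<bar> \<le> M" if "x \<in> - closure \<Omega>" for x using M[OF that] div[OF that] by simp
    show "(\<beta>\<^sup>2 - \<beta> * divergence nu x) * (slope x / (slope x + \<beta>))\<^sup>2 \<le> \<gamma>\<^sup>2" if "x \<in> - closure \<Omega>" for x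
      using bspec[OF assms(17) that] unfolding div[OF that] \<delta>[OF that] .
  qed
qed

end
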